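(* Let $X$ be a real-valued L\'evy process with $X_0=0$ and characteristic triplet $(\sigma^2,\nu,\gamma)$ (Gaussian variance $\sigma^2\ge 0$, L\'evy measure $\nu$, drift $\gamma$), such that $e^{X}$ is a true martingale and $\int_{|z|>1}e^{|z|(1+\delta)}\nu(dz)<\infty$ for some $\delta>0$. Assume that $$\lim_{x\downarrow 0}x^{\alpha_+}\nu((x,\infty))=c_+,\qquad \lim_{x\downarrow 0}x^{\alpha_-}\nu((-\infty,-x))=c_-$$ for some $\alpha_+,\alpha_-\in(1,2)$ and $c_+,c_-\in[0,\infty)$. Let $t\mapsto k_t$ be a deterministic function with $k_t>0$ for all $t>0$ and $\lim_{t\downarrow0}k_t=0$, and such that: if $\sigma^2=0$, then $\lim_{t\downarrow0}t^{1/\alpha}/k_t=0$ for some $\alpha\in(\max(\alpha_-,\alpha_+),2)$; if $\sigma^2>0$, then $\lim_{t\downarrow 0}\sqrt{t}/k_t=0$. Let $W$ be a standard Brownian motion. Then, if $c_+>0$, $$\mathbb E[(e^{X_t}-e^{k_t})^+]\sim \mathbb E[(e^{\sigma W_t-\frac{\sigma^2t}{2}}-e^{k_t})^+]+\frac{t\,k_t^{1-\alpha_+}c_+}{\alpha_+-1}\quad\text{as }t\downarrow0,$$ and, if $c_->0$, $$\mathbb E[(e^{-k_t}-e^{X_t})^+]\sim \mathbb E[(e^{-k_t}-e^{\sigma W_t-\frac{\sigma^2t}{2}})^+]+\frac{t\,k_t^{1-\alpha_-}c_-}{\alpha_--1}\quad\text{as }t\downarrow0.$$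
   Context: For functions $f,g$ with $g(t)>0$ for small $t>0$, $f(t)\sim g(t)$ as $t\downarrow0$ means $\lim_{t\downarrow0}f(t)/g(t)=1$. $x^+=\max\{x,0\}$. *)

theory Defs
  imports "HOL-Probability.Probability" "HOL-Library.Landau_Symbols"
begin

definition indep_increments :: "'a measure \<Rightarrow> (real \<Rightarrow> 'a \<Rightarrow> real) \<Rightarrow> bool" where
  "indep_increments M X \<longleftrightarrow>
     (\<forall>(n::nat) (t::nat \<Rightarrow> real). 0 \<le> t 0 \<longrightarrow> (\<forall>i<n. t i < t (Suc i)) \<longrightarrow>
        prob_space.indep_vars M (\<lambda>_. borel) (\<lambda>i \<omega>. X (t (Suc i)) \<omega> - X (t i) \<omega>) {..<n})"

definition levy_process :: "'a measure \<Rightarrow> (real \<Rightarrow> 'a \<Rightarrow> real) \<Rightarrow> bool" where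
  "levy_process M X \<longleftrightarrow>
     prob_space M \<and>
     (\<forall>t\<ge>0. X t \<in> borel_measurable M) \<and>
     (AE \<omega> in M. X 0 \<omega> = 0) \<and>
     indep_increments M X \<and>
     (\<forall>s t. 0 \<le> s \<longrightarrow> s \<le> t \<longrightarrow>
        distr M borel (\<lambda>\<omega>. X t \<omega> - X s \<omega>) = distr M borel (X (t - s))) \<and>
     (\<forall>t\<ge>0. \<forall>e>0. ((\<lambda>s. measure M {\<omega>\<in>space M. \<bar>X s \<omega> - X t \<omega>\<bar> > e}) \<longlongrightarrow> 0)
                     (at t within {0..})) \<and>
     (AE \<omega> in M. (\<forall>t\<ge>0. continuous (at_right t) (\<lambda>s. X s \<omega>)) \<and>
                  (\<forall>t>0. \<exists>l. ((\<lambda>s. X s \<omega>) \<longlongrightarrow> l) (at_left t)))"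

definition levy_measure :: "real measure \<Rightarrow> bool" where
  "levy_measure \<nu> \<longleftrightarrow> sets \<nu> = sets borel \<and> emeasure \<nu> {0} = 0 \<and>
     integrable \<nu> (\<lambda>z. min 1 (z\<^sup>2))"

definition levy_exponent :: "real \<Rightarrow> real measure \<Rightarrow> real \<Rightarrow> real \<Rightarrow> complex" where
  "levy_exponent s2 \<nu> \<gamma> u =
     \<i> * complex_of_real (\<gamma> * u) - complex_of_real (s2 * u\<^sup>2 / 2) +
     integral\<^sup>L \<nu> (\<lambda>z. iexp (u * z) - 1 - \<i> * complex_of_real (u * z * indicator {-1..1} z))"

definition has_char_triplet :: "'a measure \<Rightarrow> (real \<Rightarrow> 'a \<Rightarrow> real) \<Rightarrow> real \<Rightarrow> real measure \<Rightarrow> real \<Rightarrow> bool" where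
  "has_char_triplet M X s2 \<nu> \<gamma> \<longleftrightarrow> s2 \<ge> 0 \<and> levy_measure \<nu> \<and>
     (\<forall>t\<ge>0. \<forall>u. char (distr M borel (X t)) u = exp (complex_of_real t * levy_exponent s2 \<nu> \<gamma> u))"

definition nat_filtration :: "'a measure \<Rightarrow> (real \<Rightarrow> 'a \<Rightarrow> real) \<Rightarrow> real \<Rightarrow> 'a measure" where
  "nat_filtration M X s = sigma (space M)
     {X r -` A \<inter> space M | r A. 0 \<le> r \<and> r \<le> s \<and> A \<in> sets borel}"

text \<open>Y is a (true) martingale w.r.t. the natural filtration of X: Y_t integrable,
  Y_s F_s-measurable and E[Y_t | F_s] = Y_s, i.e. \<integral>_A Y_t = \<integral>_A Y_s for A \<in> F_s.\<close>
definition is_martingale :: "'a measure \<Rightarrow> (real \<Rightarrow> 'a \<Rightarrow> real) \<Rightarrow> (real \<Rightarrow> 'a \<Rightarrow> real) \<Rightarrow> bool" where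
  "is_martingale M X Y \<longleftrightarrow>
     (\<forall>t\<ge>0. integrable M (Y t) \<and> Y t \<in> borel_measurable (nat_filtration M X t)) \<and>
     (\<forall>s t A. 0 \<le> s \<longrightarrow> s \<le> t \<longrightarrow> A \<in> sets (nat_filtration M X s) \<longrightarrow>
        (\<integral>\<omega>. indicator A \<omega> * Y t \<omega> \<partial>M) = (\<integral>\<omega>. indicator A \<omega> * Y s \<omega> \<partial>M))"

definition std_brownian_motion :: "'b measure \<Rightarrow> (real \<Rightarrow> 'b \<Rightarrow> real) \<Rightarrow> bool" where
  "std_brownian_motion N W \<longleftrightarrow>
     prob_space N \<and>
     (\<forall>t\<ge>0. W t \<in> borel_measurable N) \<and>
     (AE \<omega> in N. W 0 \<omega> = 0) \<and>
     indep_increments N W \<and>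
     (\<forall>s t. 0 \<le> s \<longrightarrow> s < t \<longrightarrow>
        distributed N lborel (\<lambda>\<omega>. W t \<omega> - W s \<omega>) (normal_density 0 (sqrt (t - s)))) \<and>
     (AE \<omega> in N. continuous_on {0..} (\<lambda>s. W s \<omega>))"

end

theory Submission
  imports Defs
begin

text \<open>Only the one-dimensional laws matter. Cutting the jumps at \<open>h = \<epsilon> k\<^sub>t\<close>, the law of \<open>X\<^sub>t\<close> is a
  convolution of a Gaussian law, the law of the compensated small jumps, and a compound Poisson law.
  At most one positive big jump matters to first order; its contribution \<open>t \<integral>(z - k\<^sub>t)\<^sup>+ \<nu>(dz)\<close> is
  the power term, by integrating the regularly varying tail of \<open>\<nu>\<close> once. The small jumps and the
  drift change the Gaussian call price only by a factor tending to 1, up to \<open>o(t k\<^sub>t\<^sup>1\<^sup>-\<^sup>\<alpha>)\<close>: they have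
  exponential moments of order \<open>log (1 / t) / k\<^sub>t\<close>, while the Gaussian price is log-Lipschitz in the
  strike at rate \<open>O(k\<^sub>t / (\<sigma>\<^sup>2 t))\<close>, and negligible once \<open>k\<^sub>t\<^sup>2\<close> exceeds a large multiple of
  \<open>\<sigma>\<^sup>2 t log (1 / t)\<close>. Since \<open>E(cosh X\<^sub>t - 1) = O(t)\<close>, exponential payoffs may be replaced by
  \<open>(x - k\<^sub>t)\<^sup>+\<close>, which treats calls and (after reflection) puts alike.\<close>

section \<open>Compound Poisson laws\<close>

text \<open>The obstacle is uniformity: nothing says which of the Gaussian price and the power term
  dominates, and the Gaussian price may be smaller than every power of \<open>t\<close>. Each error
  is therefore charged to one of the two summands: multiplicative errors to the Gaussian price,
  additive ones to the power term. An additive error of order \<open>t\<close> is affordable because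
  \<open>k powr (1 - a)\<close> blows up. The other resource is a polynomial margin: eventually
  \<open>k t\<close> exceeds \<open>t powr (1 / \<alpha>0)\<close> with \<open>\<alpha>0\<close>
  above both tail exponents, whence \<open>t * k t powr (- \<alpha>) \<le> t powr \<beta>\<close>
  with \<open>\<beta> > 0\<close>. It pays for the logarithms and for the factor
  \<open>exp (\<theta> * h)\<close>, which is why the truncation ratio is proportional to \<beta>.
  That ratio stays fixed as \<open>t\<close> tends to 0, so its negative powers enter as constants,
  but only in front of errors that are already small. No path decomposition is made: the three
  factors are laws, built separately and recognised by their characteristic functions. With \<sigma>
  = 0 the Gaussian factor is a point mass, so both cases of the theorem run through the same
  estimates.\<close>

abbreviation mgf :: "real measure \<Rightarrow> real \<Rightarrow> ennreal" where
  "mgf M \<theta> \<equiv> (\<integral>\<^sup>+x. ennreal (exp (\<theta> * x)) \<partial>M)"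

abbreviation comp_iexp :: "real \<Rightarrow> real \<Rightarrow> complex" where
  "comp_iexp u z \<equiv> iexp (u * z) - 1 - \<i> * complex_of_real (u * z)"

section \<open>Convolutions and convolution powers of laws on the line\<close>

lemma real_distribution_convolution:
  assumes "real_distribution M" "real_distribution N"
  shows "real_distribution (M \<star> N)"
proof -
  interpret M: real_distribution M by fact
  interpret N: real_distribution N by fact
  interpret pair_prob_space M N ..
  show ?thesis
    unfolding real_distribution_def real_distribution_axioms_def
    by (auto simp: convolution_def intro!: prob_space_distr)
qed

lemma nn_integral_convolution_distr:
  assumes "real_distribution M" "real_distribution N" "f \<in> borel_measurable borel"
  shows "(\<integral>\<^sup>+x. f x \<partial>(M \<star> N)) = (\<integral>\<^sup>+x. \<integral>\<^sup>+y. f (x + y) \<partial>N \<partial>M)"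
proof -
  interpret M: real_distribution M by fact
  interpret N: real_distribution N by fact
  show ?thesis
    using assms(3) by (intro nn_integral_convolution) (auto intro: M.finite_measure_axioms N.finite_measure_axioms)
qed

lemma char_convolution:
  assumes "real_distribution M" "real_distribution N"
  shows "char (M \<star> N) u = char M u * char N u"
proof -
  interpret M: real_distribution M by fact
  interpret N: real_distribution N by fact
  interpret pair_prob_space M N ..
  have meas [measurable]: "(\<lambda>z. iexp (u * (fst z + snd z))) \<in> borel_measurable (M \<Otimes>\<^sub>M N)"
    by measurable
  have int: "integrable (M \<Otimes>\<^sub>M N) (\<lambda>z. iexp (u * (fst z + snd z)))"
    using meas by (intro integrable_const_bound[where B=1]) auto
  have "char (M \<star> N) u = (\<integral>z. iexp (u * (fst z + snd z)) \<partial>(M \<Otimes>\<^sub>M N))"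
    unfolding char_def convolution_def
    by (subst integral_distr) (auto simp: case_prod_beta)
  also have "\<dots> = (\<integral>x. (\<integral>y. iexp (u * (x + y)) \<partial>N) \<partial>M)"
    using integral_fst'[OF int] by simp
  also have "\<dots> = (\<integral>x. iexp (u * x) * char N u \<partial>M)"
    unfolding char_def
    by (intro Bochner_Integration.integral_cong refl)
       (simp add: distrib_left exp_add algebra_simps flip: integral_mult_right_zero)
  also have "\<dots> = char M u * char N u"
    unfolding char_def by simp
  finally show ?thesis .
qed

primrec conv_pow :: "real measure \<Rightarrow> nat \<Rightarrow> real measure" where
  "conv_pow M 0 = return borel 0"
| "conv_pow M (Suc n) = (M \<star> conv_pow M n)"

lemma real_distribution_return: "real_distribution (return borel (a::real))"
  by (simp add: real_distribution_def real_distribution_axioms_def prob_space_return)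

lemma real_distribution_conv_pow:
  "real_distribution M \<Longrightarrow> real_distribution (conv_pow M n)"
  by (induction n) (auto intro: real_distribution_convolution real_distribution_return)

lemma char_conv_pow:
  assumes "real_distribution M"
  shows "char (conv_pow M n) u = char M u ^ n"
proof (induction n)
  case 0
  show ?case by (simp add: char_def integral_return)
qed (simp add: char_convolution assms real_distribution_conv_pow)

lemma nn_integral_exp_conv_pow:
  assumes "real_distribution M"
  shows "mgf (conv_pow M n) \<theta> = mgf M \<theta> ^ n"
proof (induction n)
  case 0
  show ?case by (simp add: nn_integral_return)
next
  case (Suc n)
  interpret M: real_distribution M by fact
  interpret Q: real_distribution "conv_pow M n" using assms by (rule real_distribution_conv_pow)
  show ?case
    using assms Suc
    by (simp add: nn_integral_convolution_distr real_distribution_conv_pow distrib_left exp_add ennreal_mult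
        nn_integral_cmult nn_integral_multc)
qed

text \<open>One of the \<open>n + 1\<close> summands carries \<open>\<phi>\<close>; each of the
  other \<open>n\<close> is removed through the upward Lipschitz bound at the price of its positive
  part. The function is generalised in the induction because the step applies the hypothesis to
  \<open>\<phi>\<close> shifted by the first summand.\<close>

lemma nn_integral_conv_pow_Suc_le:
  fixes \<phi> :: "real \<Rightarrow> real"
  assumes M: "real_distribution M"
    and "mono \<phi>" "\<And>x. 0 \<le> \<phi> x" "\<And>x y. x \<le> y \<Longrightarrow> \<phi> y \<le> \<phi> x + (y - x)"
  shows "(\<integral>\<^sup>+x. ennreal (\<phi> x) \<partial>conv_pow M (Suc n)) \<le>
    (\<integral>\<^sup>+x. ennreal (\<phi> (max x 0)) \<partial>M) + of_nat n * (\<integral>\<^sup>+x. ennreal (max x 0) \<partial>M)"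
  using assms(2-)
proof (induction n arbitrary: \<phi>)
  case 0
  note [measurable] = borel_measurable_mono[OF 0(1)]
  interpret M: real_distribution M by fact
  have "(\<integral>\<^sup>+x. ennreal (\<phi> x) \<partial>conv_pow M (Suc 0)) = (\<integral>\<^sup>+x. ennreal (\<phi> x) \<partial>M)"
    using M by (simp add: nn_integral_convolution_distr real_distribution_return nn_integral_return)
  also have "\<dots> \<le> (\<integral>\<^sup>+x. ennreal (\<phi> (max x 0)) \<partial>M)"
    using 0 by (intro nn_integral_mono ennreal_leI) (auto intro: monoD)
  finally show ?case by simp
next
  case (Suc n)
  note [measurable] = borel_measurable_mono[OF Suc.prems(1)]
  interpret M: real_distribution M by fact
  have eM: "emeasure M UNIV = 1" using M.emeasure_space_1 by simp
  let ?m = "\<integral>\<^sup>+x. ennreal (max x 0) \<partial>M"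
  have "(\<integral>\<^sup>+x. ennreal (\<phi> x) \<partial>conv_pow M (Suc (Suc n))) =
    (\<integral>\<^sup>+x. \<integral>\<^sup>+y. ennreal (\<phi> (x + y)) \<partial>conv_pow M (Suc n) \<partial>M)"
    unfolding conv_pow.simps(2)[of M "Suc n"]
    by (intro nn_integral_convolution_distr M real_distribution_conv_pow) simp
  also have "\<dots> \<le> (\<integral>\<^sup>+x. ((\<integral>\<^sup>+y. ennreal (\<phi> (max y 0)) \<partial>M) + ennreal (max x 0)) + of_nat n * ?m \<partial>M)"
  proof (rule nn_integral_mono)
    fix x
    have "(\<integral>\<^sup>+y. ennreal (\<phi> (x + y)) \<partial>conv_pow M (Suc n)) \<le>
      (\<integral>\<^sup>+y. ennreal (\<phi> (x + max y 0)) \<partial>M) + of_nat n * ?m"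
    proof (rule Suc.IH)
      show "mono (\<lambda>y. \<phi> (x + y))" using Suc.prems(1) by (auto simp: mono_def)
      fix a b :: real assume "a \<le> b"
      then show "\<phi> (x + b) \<le> \<phi> (x + a) + (b - a)"
        using Suc.prems(3)[of "x + a" "x + b"] by simp
    qed (use Suc.prems in auto)
    also have "(\<integral>\<^sup>+y. ennreal (\<phi> (x + max y 0)) \<partial>M) \<le>
       (\<integral>\<^sup>+y. ennreal (\<phi> (max y 0)) + ennreal (max x 0) \<partial>M)"
    proof (rule nn_integral_mono)
      fix y :: real
      have "\<phi> (x + max y 0) \<le> \<phi> (max x 0 + max y 0)"
        using Suc.prems(1) by (auto simp: mono_def)
      also have "\<dots> \<le> \<phi> (max y 0) + max x 0"
        using Suc.prems(3)[of "max y 0" "max x 0 + max y 0"] by simp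
      finally show "ennreal (\<phi> (x + max y 0)) \<le> ennreal (\<phi> (max y 0)) + ennreal (max x 0)"
        using Suc.prems(2) ennreal_plus[of "\<phi> (max y 0)" "max x 0"] by (metis ennreal_leI max.cobounded2)
    qed
    also have "\<dots> = (\<integral>\<^sup>+y. ennreal (\<phi> (max y 0)) \<partial>M) + ennreal (max x 0)"
      by (subst nn_integral_add) (simp_all add: eM)
    finally show "(\<integral>\<^sup>+y. ennreal (\<phi> (x + y)) \<partial>conv_pow M (Suc n)) \<le>
       ((\<integral>\<^sup>+y. ennreal (\<phi> (max y 0)) \<partial>M) + ennreal (max x 0)) + of_nat n * ?m"
      by (simp add: add_right_mono)
  qed
  also have "\<dots> = (\<integral>\<^sup>+y. ennreal (\<phi> (max y 0)) \<partial>M) + ?m + of_nat n * ?m"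
    by (simp add: nn_integral_add eM)
  finally show ?case by (simp add: distrib_right add.assoc)
qed

section \<open>Poisson mixtures of convolution powers\<close>

definition poisson_mixture :: "real \<Rightarrow> real measure \<Rightarrow> real measure" where
  "poisson_mixture l M = measure_pmf (poisson_pmf l) \<bind> conv_pow M"

lemma measurable_conv_pow:
  assumes "real_distribution M"
  shows "conv_pow M \<in> measurable (measure_pmf p) (subprob_algebra borel)"
proof -
  have "conv_pow M n \<in> space (subprob_algebra borel)" for n
  proof -
    interpret Q: real_distribution "conv_pow M n" using assms by (rule real_distribution_conv_pow)
    show ?thesis by (auto simp: space_subprob_algebra intro: Q.subprob_space_axioms)
  qed
  then show ?thesis by auto
qed

lemma real_distribution_poisson_mixture:
  assumes "real_distribution M"
  shows "real_distribution (poisson_mixture l M)"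
proof -
  have 1: "prob_space (poisson_mixture l M)"
    unfolding poisson_mixture_def
  proof (rule measure_pmf.prob_space_bind[OF _ measurable_conv_pow[OF assms]])
    show "AE x in measure_pmf (poisson_pmf l). prob_space (conv_pow M x)"
      using real_distribution_conv_pow[OF assms] by (auto simp: real_distribution_def)
  qed
  have 2: "sets (poisson_mixture l M) = sets borel"
    unfolding poisson_mixture_def
    by (intro sets_bind) (use real_distribution_conv_pow[OF assms] in \<open>auto simp: real_distribution_def real_distribution_axioms_def\<close>)
  show ?thesis using 1 2
    by (simp add: real_distribution_def real_distribution_axioms_def)
qed

lemma nn_integral_poisson_mixture:
  assumes "real_distribution M" "0 < l" and [measurable]: "f \<in> borel_measurable borel"
  shows "(\<integral>\<^sup>+x. f x \<partial>poisson_mixture l M) =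
    (\<Sum>n. ennreal (l ^ n / fact n * exp (- l)) * (\<integral>\<^sup>+x. f x \<partial>conv_pow M n))"
  unfolding poisson_mixture_def
  by (subst nn_integral_bind[OF assms(3) measurable_conv_pow[OF assms(1)]])
     (simp add: nn_integral_measure_pmf nn_integral_count_space_nat assms)

text \<open>The generating function of the Poisson law: \<open>x = 1\<close> gives total mass 1, and
  a moment in place of \<open>x\<close> gives the corresponding moment of the mixture.\<close>

lemma poisson_sums: "(\<lambda>n. (l::real) ^ n / fact n * exp (- l) * x ^ n) sums exp (l * (x - 1))"
proof -
  have "(\<lambda>n. exp (- l) * ((l * x) ^ n /\<^sub>R fact n)) sums (exp (- l) * exp (l * x))"
    by (intro sums_mult exp_converges)
  then show ?thesis
    by (simp add: power_mult_distrib algebra_simps divide_inverse mult_exp_exp)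
qed

lemma char_poisson_mixture:
  assumes M: "real_distribution M" and l: "0 < l"
  shows "char (poisson_mixture l M) u = exp (of_real l * (char M u - 1))"
proof -
  interpret M: real_distribution M by fact
  interpret P: real_distribution "poisson_mixture l M" using M by (rule real_distribution_poisson_mixture)
  interpret Q: real_distribution "conv_pow M n" for n using M by (rule real_distribution_conv_pow)
  \<comment> \<open>The exchange is stated for real integrands bounded by 1, so the complex
    exponential is treated through its cosine and sine parts.\<close>
  have bind: "(\<integral>x. f x \<partial>poisson_mixture l M) = (\<integral>n. (\<integral>x. f x \<partial>conv_pow M n) \<partial>measure_pmf (poisson_pmf l))"
    if "f \<in> borel_measurable borel" "\<And>x. \<bar>f x\<bar> \<le> 1" for f :: "real \<Rightarrow> real"
    unfolding poisson_mixture_def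
    by (rule integral_bind[where K=borel and B=1 and B'=1])
       (use measurable_conv_pow[OF M] that Q.emeasure_space_1 in \<open>auto simp: measure_pmf.finite_measure_axioms\<close>)
  have iP: "integrable (poisson_mixture l M) (\<lambda>x. iexp (u * x))"
    by (intro P.integrable_const_bound[where B=1]) auto
  have iQ: "integrable (conv_pow M n) (\<lambda>x. iexp (u * x))" for n
    by (intro Q.integrable_const_bound[where B=1]) auto
  have iN: "integrable (measure_pmf (poisson_pmf l)) (\<lambda>n. char (conv_pow M n) u)"
    by (intro measure_pmf.integrable_const_bound[where B=1]) (auto intro: Q.cmod_char_le_1)
  have "char (poisson_mixture l M) u = (\<integral>n. char (conv_pow M n) u \<partial>measure_pmf (poisson_pmf l))"
  proof (rule complex_eqI)
    have "Re (char (poisson_mixture l M) u) = (\<integral>x. cos (u * x) \<partial>poisson_mixture l M)"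
      unfolding char_def integral_Re[OF iP, symmetric] by (simp add: Re_exp)
    also have "\<dots> = (\<integral>n. (\<integral>x. cos (u * x) \<partial>conv_pow M n) \<partial>measure_pmf (poisson_pmf l))"
      by (rule bind) auto
    also have "\<dots> = (\<integral>n. Re (char (conv_pow M n) u) \<partial>measure_pmf (poisson_pmf l))"
      unfolding char_def integral_Re[OF iQ, symmetric] by (simp add: Re_exp)
    finally show "Re (char (poisson_mixture l M) u) = Re (\<integral>n. char (conv_pow M n) u \<partial>measure_pmf (poisson_pmf l))"
      using integral_Re[OF iN] by simp
    have "Im (char (poisson_mixture l M) u) = (\<integral>x. sin (u * x) \<partial>poisson_mixture l M)"
      unfolding char_def integral_Im[OF iP, symmetric] by (simp add: Im_exp)
    also have "\<dots> = (\<integral>n. (\<integral>x. sin (u * x) \<partial>conv_pow M n) \<partial>measure_pmf (poisson_pmf l))"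
      by (rule bind) auto
    also have "\<dots> = (\<integral>n. Im (char (conv_pow M n) u) \<partial>measure_pmf (poisson_pmf l))"
      unfolding char_def integral_Im[OF iQ, symmetric] by (simp add: Im_exp)
    finally show "Im (char (poisson_mixture l M) u) = Im (\<integral>n. char (conv_pow M n) u \<partial>measure_pmf (poisson_pmf l))"
      using integral_Im[OF iN] by simp
  qed
  also have "\<dots> = (\<integral>n. char M u ^ n \<partial>measure_pmf (poisson_pmf l))"
    by (simp add: char_conv_pow M)
  also have "\<dots> = (\<integral>n. pmf (poisson_pmf l) n *\<^sub>R char M u ^ n \<partial>count_space UNIV)"
    by (subst measure_pmf_eq_density) (subst integral_density, auto)
  also have "\<dots> = (\<Sum>n. pmf (poisson_pmf l) n *\<^sub>R char M u ^ n)"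
  proof (intro integral_count_space_nat)
    have "summable (\<lambda>n. pmf (poisson_pmf l) n)"
      using poisson_sums[of l 1] l by (simp add: sums_iff)
    then show "integrable (count_space UNIV) (\<lambda>n. pmf (poisson_pmf l) n *\<^sub>R char M u ^ n)"
      unfolding integrable_count_space_nat_iff
      by (rule summable_comparison_test'[where N=0])
         (use M.cmod_char_le_1[of u] l in \<open>simp_all add: norm_power norm_mult power_le_one divide_right_mono mult_left_le\<close>)
  qed
  also have "\<dots> = exp (of_real l * (char M u - 1))"
  proof (rule sums_unique[symmetric])
    have "(\<lambda>n. of_real (exp (- l)) * ((of_real l * char M u) ^ n /\<^sub>R fact n)) sums (of_real (exp (- l)) * exp (of_real l * char M u))"
      by (intro sums_mult exp_converges)
    then show "(\<lambda>n. pmf (poisson_pmf l) n *\<^sub>R char M u ^ n) sums exp (of_real l * (char M u - 1))"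
      using l by (simp add: scaleR_conv_of_real power_mult_distrib algebra_simps divide_inverse mult_exp_exp
          exp_of_real[symmetric])
  qed
  finally show ?thesis .
qed

lemma nn_integral_exp_poisson_mixture:
  assumes M: "real_distribution M" and l: "0 < l" and m: "mgf M \<theta> = ennreal m" "0 \<le> m"
  shows "mgf (poisson_mixture l M) \<theta> = ennreal (exp (l * (m - 1)))"
proof -
  have "mgf (poisson_mixture l M) \<theta> =
     (\<Sum>n. ennreal (l ^ n / fact n * exp (- l) * m ^ n))"
    using M l m by (subst nn_integral_poisson_mixture)
      (auto simp: nn_integral_exp_conv_pow ennreal_power ennreal_mult[symmetric])
  also have "\<dots> = ennreal (\<Sum>n. l ^ n / fact n * exp (- l) * m ^ n)"
    using poisson_sums[of l m] l m by (intro suminf_ennreal2) (auto simp: sums_iff)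
  also have "\<dots> = ennreal (exp (l * (m - 1)))"
    using poisson_sums[of l m] by (simp add: sums_iff)
  finally show ?thesis .
qed

text \<open>Only the terms with no jump and with exactly one jump are kept; the rest of the Poisson
  series is nonnegative.\<close>

lemma poisson_mixture_lower:
  assumes M: "real_distribution M" and l: "0 < l" and [measurable]: "f \<in> borel_measurable borel"
  shows "ennreal (exp (- l)) * (f 0 + ennreal l * (\<integral>\<^sup>+x. f x \<partial>M)) \<le> (\<integral>\<^sup>+x. f x \<partial>poisson_mixture l M)"
proof -
  interpret M: real_distribution M by fact
  have 1: "(\<integral>\<^sup>+x. f x \<partial>conv_pow M (Suc 0)) = (\<integral>\<^sup>+x. f x \<partial>M)"
    using M by (simp add: nn_integral_convolution_distr real_distribution_return nn_integral_return)
  let ?g = "\<lambda>n. ennreal (l ^ n / fact n * exp (- l)) * (\<integral>\<^sup>+x. f x \<partial>conv_pow M n)"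
  have "sum ?g {..<2} \<le> suminf ?g" by (rule sum_le_suminf) auto
  moreover have "sum ?g {..<2} = ennreal (exp (- l)) * (f 0 + ennreal l * (\<integral>\<^sup>+x. f x \<partial>M))"
    using l 1 by (simp add: numeral_2_eq_2 nn_integral_return ennreal_mult distrib_left mult_ac del: conv_pow.simps(2))
  ultimately show ?thesis
    using M l by (simp add: nn_integral_poisson_mixture)
qed

text \<open>An upper bound in which only a single positive jump enters to first order: the remaining
  jumps are absorbed by the Lipschitz bound at the cost of the second-order term.\<close>

lemma poisson_mixture_upper:
  fixes \<phi> :: "real \<Rightarrow> real"
  assumes M: "real_distribution M" and l: "0 < l"
    and mono: "mono \<phi>" and nn: "\<And>x. 0 \<le> \<phi> x" and lip: "\<And>x y. x \<le> y \<Longrightarrow> \<phi> y \<le> \<phi> x + (y - x)"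
  shows "(\<integral>\<^sup>+x. ennreal (\<phi> x) \<partial>poisson_mixture l M) \<le>
    ennreal (\<phi> 0) + ennreal l * (\<integral>\<^sup>+x. ennreal (\<phi> x) * indicator {0<..} x \<partial>M)
      + ennreal (l ^ 2) * (\<integral>\<^sup>+x. ennreal (max x 0) \<partial>M)"
proof -
  interpret M: real_distribution M by fact
  note [measurable] = borel_measurable_mono[OF mono]
  define p where "p n = l ^ n / fact n * exp (- l)" for n
  define D where "D = (\<integral>\<^sup>+x. ennreal (\<phi> x) * indicator {0<..} x \<partial>M)"
  define m where "m = (\<integral>\<^sup>+x. ennreal (max x 0) \<partial>M)"
  have p0: "0 \<le> p n" for n using l by (simp add: p_def)
  have psum: "p sums 1" using poisson_sums[of l 1] by (simp add: p_def[abs_def])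
  have pS: "p (Suc n) \<le> l * p n" for n
  proof -
    have "p (Suc n) = l * p n / real (Suc n)" by (simp add: p_def field_simps)
    also have "\<dots> \<le> l * p n" using p0[of n] l by (simp add: field_simps)
    finally show ?thesis .
  qed
  \<comment> \<open>The index \<open>n - 1\<close> is truncated subtraction; at \<open>n = 0\<close>
    the left-hand side vanishes, so this does no harm.\<close>
  have pS2: "real n * p (Suc n) \<le> l\<^sup>2 * p (n - 1)" for n
  proof (cases n)
    case (Suc k)
    have "p (Suc k) = l * p k / real (Suc k)" "p (Suc (Suc k)) = l * p (Suc k) / real (Suc (Suc k))"
      by (simp_all add: p_def field_simps)
    then have "real (Suc k) * p (Suc (Suc k)) = l\<^sup>2 * p k / real (Suc (Suc k))"
      by (simp add: field_simps power2_eq_square del: of_nat_Suc)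
    also have "\<dots> \<le> l\<^sup>2 * p k"
      using p0[of k] l by (simp add: field_simps)
    finally show ?thesis by (simp add: Suc)
  qed (use p0 in simp)
  have sums: "(\<Sum>n. ennreal (p n)) = 1"
    using psum p0 by (subst suminf_ennreal2) (auto simp: sums_iff)
  have S1: "ennreal (p 0) + (\<Sum>n. ennreal (p (Suc n))) = 1"
  proof -
    have "(\<Sum>n. ennreal (p n)) = (\<Sum>n. ennreal (p (Suc n))) + ennreal (p 0)"
      by (subst suminf_offset[where i=1]) simp_all
    with sums show ?thesis by (metis add.commute)
  qed
  \<comment> \<open>The probability of at least one jump.\<close>
  have S2: "(\<Sum>n. ennreal (p (Suc n))) \<le> ennreal l"
  proof -
    have "(\<Sum>n. ennreal (p (Suc n))) \<le> (\<Sum>n. ennreal l * ennreal (p n))"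
      using pS p0 l by (intro suminf_le) (auto simp flip: ennreal_mult intro!: ennreal_leI)
    then show ?thesis by (simp add: sums)
  qed
  \<comment> \<open>The expected number of jumps beyond the first, which is of second order in the
    intensity.\<close>
  have S3: "(\<Sum>n. ennreal (p (Suc n)) * of_nat n) \<le> ennreal (l\<^sup>2)"
  proof -
    have "(\<Sum>n. ennreal (p (Suc n)) * of_nat n) = (\<Sum>n. ennreal (p (Suc (Suc n))) * of_nat (Suc n))"
      using suminf_offset[of "\<lambda>n. ennreal (p (Suc n)) * of_nat n" 1] by simp
    also have "\<dots> \<le> (\<Sum>n. ennreal (l\<^sup>2) * ennreal (p n))"
    proof (intro suminf_le)
      fix n
      show "ennreal (p (Suc (Suc n))) * of_nat (Suc n) \<le> ennreal (l\<^sup>2) * ennreal (p n)"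
        unfolding ennreal_of_nat_eq_real_of_nat
        using pS2[of "Suc n"] p0
        by (subst (1 2) ennreal_mult[symmetric]) (simp_all add: ennreal_leI mult.commute del: of_nat_Suc)
    qed auto
    finally show ?thesis by (simp add: sums)
  qed
  have A: "(\<integral>\<^sup>+x. ennreal (\<phi> (max x 0)) \<partial>M) \<le> ennreal (\<phi> 0) + D"
  proof -
    have "(\<integral>\<^sup>+x. ennreal (\<phi> (max x 0)) \<partial>M) \<le> (\<integral>\<^sup>+x. ennreal (\<phi> 0) + ennreal (\<phi> x) * indicator {0<..} x \<partial>M)"
      by (intro nn_integral_mono) (auto split: split_indicator simp: max_def)
    then show ?thesis using M.emeasure_space_1 by (simp add: D_def nn_integral_add)
  qed
  have "(\<integral>\<^sup>+x. ennreal (\<phi> x) \<partial>poisson_mixture l M) =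
      (\<Sum>n. ennreal (p n) * (\<integral>\<^sup>+x. ennreal (\<phi> x) \<partial>conv_pow M n))"
    unfolding p_def by (rule nn_integral_poisson_mixture[OF M l]) simp
  also have "\<dots> = ennreal (p 0) * ennreal (\<phi> 0) +
      (\<Sum>n. ennreal (p (Suc n)) * (\<integral>\<^sup>+x. ennreal (\<phi> x) \<partial>conv_pow M (Suc n)))"
    by (subst suminf_offset[where i=1]) (simp_all add: nn_integral_return del: conv_pow.simps(2))
  also have "\<dots> \<le> ennreal (p 0) * ennreal (\<phi> 0) +
      (\<Sum>n. ennreal (p (Suc n)) * (ennreal (\<phi> 0) + D) + (ennreal (p (Suc n)) * of_nat n) * m)"
  proof (intro add_left_mono suminf_le)
    fix n
    have "(\<integral>\<^sup>+x. ennreal (\<phi> x) \<partial>conv_pow M (Suc n)) \<le> (ennreal (\<phi> 0) + D) + of_nat n * m"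
      using nn_integral_conv_pow_Suc_le[OF M mono nn lip, of n] A unfolding m_def
      by (meson add_right_mono order_trans)
    then show "ennreal (p (Suc n)) * (\<integral>\<^sup>+x. ennreal (\<phi> x) \<partial>conv_pow M (Suc n)) \<le>
       ennreal (p (Suc n)) * (ennreal (\<phi> 0) + D) + (ennreal (p (Suc n)) * of_nat n) * m"
      by (metis distrib_left mult.assoc mult_left_mono zero_le)
  qed auto
  also have "\<dots> = ennreal (p 0) * ennreal (\<phi> 0) + ((\<Sum>n. ennreal (p (Suc n))) * (ennreal (\<phi> 0) + D)
       + (\<Sum>n. ennreal (p (Suc n)) * of_nat n) * m)"
    by (subst suminf_add[symmetric]) (simp_all add: ennreal_suminf_multc)
  also have "\<dots> = (ennreal (p 0) + (\<Sum>n. ennreal (p (Suc n)))) * ennreal (\<phi> 0) +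
      (\<Sum>n. ennreal (p (Suc n))) * D + (\<Sum>n. ennreal (p (Suc n)) * of_nat n) * m"
    by (simp add: distrib_left distrib_right add_ac)
  also have "\<dots> \<le> ennreal (\<phi> 0) + ennreal l * D + ennreal (l\<^sup>2) * m"
    unfolding S1 using S2 S3 by (intro add_mono mult_right_mono) auto
  finally show ?thesis unfolding D_def m_def .
qed


section \<open>Compound Poisson laws of a finite jump intensity\<close>

text \<open>Here \<open>\<kappa>\<close> is the jump intensity measure, not a probability measure.\<close>

definition compound_poisson :: "real measure \<Rightarrow> real measure" where
  "compound_poisson \<kappa> = (if measure \<kappa> UNIV = 0 then return borel 0
     else poisson_mixture (measure \<kappa> UNIV) (density \<kappa> (\<lambda>_. ennreal (1 / measure \<kappa> UNIV))))"

locale jump_intensity = finite_measure \<kappa> for \<kappa> :: "real measure" +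
  assumes sets_eq [simp, measurable_cong]: "sets \<kappa> = sets borel"
begin

lemma space_eq [simp]: "space \<kappa> = UNIV"
  using sets_eq_imp_space_eq[OF sets_eq] by simp

lemma AE_null: "measure \<kappa> UNIV = 0 \<Longrightarrow> AE x in \<kappa>. P x"
  by (rule AE_I[where N=UNIV]) (auto simp: emeasure_eq_measure)

lemma nn_integral_null: "measure \<kappa> UNIV = 0 \<Longrightarrow> (\<integral>\<^sup>+x. f x \<partial>\<kappa>) = 0"
  using nn_integral_cong_AE[OF AE_null, of f "\<lambda>_. 0"] by simp

lemma
  assumes "measure \<kappa> UNIV \<noteq> 0"
  shows normalized_pos: "0 < measure \<kappa> UNIV"
    and real_distribution_normalized: "real_distribution (density \<kappa> (\<lambda>_. ennreal (1 / measure \<kappa> UNIV)))"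
    and nn_integral_normalized: "f \<in> borel_measurable borel \<Longrightarrow>
      ennreal (measure \<kappa> UNIV) * (\<integral>\<^sup>+x. f x \<partial>density \<kappa> (\<lambda>_. ennreal (1 / measure \<kappa> UNIV))) = (\<integral>\<^sup>+x. f x \<partial>\<kappa>)"
proof -
  show l: "0 < measure \<kappa> UNIV" using assms by (simp add: zero_less_measure_iff measure_nonneg order_less_le)
  let ?l = "measure \<kappa> UNIV"
  have "emeasure (density \<kappa> (\<lambda>_. ennreal (1 / ?l))) UNIV = ennreal (1 / ?l) * emeasure \<kappa> UNIV"
    by (subst emeasure_density) auto
  also have "\<dots> = 1" using l by (simp add: emeasure_eq_measure flip: ennreal_mult)
  finally show "real_distribution (density \<kappa> (\<lambda>_. ennreal (1 / ?l)))"
    by (auto simp: real_distribution_def real_distribution_axioms_def intro!: prob_spaceI)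
  assume f: "f \<in> borel_measurable borel"
  then have "(\<integral>\<^sup>+x. f x \<partial>density \<kappa> (\<lambda>_. ennreal (1 / ?l))) = ennreal (1 / ?l) * (\<integral>\<^sup>+x. f x \<partial>\<kappa>)"
    by (subst nn_integral_density) (auto simp: nn_integral_cmult)
  then show "ennreal ?l * (\<integral>\<^sup>+x. f x \<partial>density \<kappa> (\<lambda>_. ennreal (1 / ?l))) = (\<integral>\<^sup>+x. f x \<partial>\<kappa>)"
    using l by (simp add: mult.assoc[symmetric] flip: ennreal_mult)
qed

lemma real_distribution_compound_poisson: "real_distribution (compound_poisson \<kappa>)"
  unfolding compound_poisson_def
  by (simp add: real_distribution_return real_distribution_poisson_mixture real_distribution_normalized)

lemma char_compound_poisson:
  "char (compound_poisson \<kappa>) u = exp (\<integral>z. (iexp (u * z) - 1) \<partial>\<kappa>)"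
proof (cases "measure \<kappa> UNIV = 0")
  case True
  then have "(\<integral>z. (iexp (u * z) - 1) \<partial>\<kappa>) = 0"
    by (intro integral_eq_zero_AE) (rule AE_null)
  with True show ?thesis by (simp add: compound_poisson_def char_def integral_return)
next
  case False
  let ?l = "measure \<kappa> UNIV"
  have int: "integrable \<kappa> (\<lambda>z. iexp (u * z))"
    by (intro integrable_const_bound[where B=1]) auto
  have "char (density \<kappa> (\<lambda>_. ennreal (1 / ?l))) u = (\<integral>z. iexp (u * z) \<partial>\<kappa>) / of_real ?l"
    unfolding char_def by (subst integral_density) (auto simp: scaleR_conv_of_real divide_inverse mult.commute)
  then have "of_real ?l * (char (density \<kappa> (\<lambda>_. ennreal (1 / ?l))) u - 1) = (\<integral>z. iexp (u * z) \<partial>\<kappa>) - of_real ?l"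
    using False by (simp add: field_simps)
  also have "\<dots> = (\<integral>z. (iexp (u * z) - 1) \<partial>\<kappa>)"
    using int by (subst Bochner_Integration.integral_diff) (auto simp: scaleR_conv_of_real)
  finally show ?thesis
    using False by (simp add: compound_poisson_def char_poisson_mixture real_distribution_normalized normalized_pos)
qed

lemma nn_integral_exp_compound_poisson:
  assumes int: "integrable \<kappa> (\<lambda>z. exp (\<theta> * z))"
  shows "mgf (compound_poisson \<kappa>) \<theta> = ennreal (exp (\<integral>z. (exp (\<theta> * z) - 1) \<partial>\<kappa>))"
proof (cases "measure \<kappa> UNIV = 0")
  case True
  then have "(\<integral>z. (exp (\<theta> * z) - 1) \<partial>\<kappa>) = 0"
    by (intro integral_eq_zero_AE) (rule AE_null)
  with True show ?thesis by (simp add: compound_poisson_def nn_integral_return)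
next
  case False
  let ?l = "measure \<kappa> UNIV" and ?I = "\<integral>z. exp (\<theta> * z) \<partial>\<kappa>"
  have "(\<integral>\<^sup>+z. ennreal (exp (\<theta> * z)) \<partial>density \<kappa> (\<lambda>_. ennreal (1 / ?l))) =
     ennreal (1 / ?l) * (\<integral>\<^sup>+z. ennreal (exp (\<theta> * z)) \<partial>\<kappa>)"
    by (subst nn_integral_density) (auto simp: nn_integral_cmult)
  also have "\<dots> = ennreal (?I / ?l)"
    using int by (subst nn_integral_eq_integral) (auto simp flip: ennreal_mult)
  finally have 1: "(\<integral>\<^sup>+z. ennreal (exp (\<theta> * z)) \<partial>density \<kappa> (\<lambda>_. ennreal (1 / ?l))) = ennreal (?I / ?l)" .
  have "?l * (?I / ?l - 1) = ?I - ?l" using False by (simp add: field_simps)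
  also have "\<dots> = (\<integral>z. (exp (\<theta> * z) - 1) \<partial>\<kappa>)"
    using int by (subst Bochner_Integration.integral_diff) auto
  finally have 2: "?l * (?I / ?l - 1) = (\<integral>z. (exp (\<theta> * z) - 1) \<partial>\<kappa>)" .
  show ?thesis
    using False nn_integral_exp_poisson_mixture[OF real_distribution_normalized normalized_pos 1]
    unfolding 2 by (simp add: compound_poisson_def)
qed

lemma compound_poisson_lower:
  assumes [measurable]: "f \<in> borel_measurable borel"
  shows "ennreal (exp (- measure \<kappa> UNIV)) * (f 0 + (\<integral>\<^sup>+x. f x \<partial>\<kappa>)) \<le> (\<integral>\<^sup>+x. f x \<partial>compound_poisson \<kappa>)"
proof (cases "measure \<kappa> UNIV = 0")
  case True
  then show ?thesis by (simp add: compound_poisson_def nn_integral_return nn_integral_null)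
next
  case False
  then show ?thesis
    using poisson_mixture_lower[OF real_distribution_normalized normalized_pos assms]
    by (simp add: compound_poisson_def nn_integral_normalized)
qed

text \<open>One factor of the total mass turns the normalised jump law back into
  \<open>\<kappa>\<close>. The second-order term of the mixture bound therefore keeps a single
  factor of the total mass in front of an integral against \<open>\<kappa>\<close>.\<close>

lemma compound_poisson_upper:
  fixes \<phi> :: "real \<Rightarrow> real"
  assumes "mono \<phi>" "\<And>x. 0 \<le> \<phi> x" "\<And>x y. x \<le> y \<Longrightarrow> \<phi> y \<le> \<phi> x + (y - x)"
  shows "(\<integral>\<^sup>+x. ennreal (\<phi> x) \<partial>compound_poisson \<kappa>) \<le>
    ennreal (\<phi> 0) + (\<integral>\<^sup>+x. ennreal (\<phi> x) * indicator {0<..} x \<partial>\<kappa>)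
      + ennreal (measure \<kappa> UNIV) * (\<integral>\<^sup>+x. ennreal (max x 0) \<partial>\<kappa>)"
proof (cases "measure \<kappa> UNIV = 0")
  case True
  then show ?thesis
    using borel_measurable_mono[OF assms(1)] by (simp add: compound_poisson_def nn_integral_return)
next
  case False
  note [measurable] = borel_measurable_mono[OF assms(1)]
  show ?thesis
    using False poisson_mixture_upper[OF real_distribution_normalized normalized_pos assms]
    by (simp add: compound_poisson_def nn_integral_normalized power2_eq_square ennreal_mult mult.assoc)
qed

end

section \<open>Compensated small jumps\<close>

lemma exp_minus_one_minus_bounds:
  fixes y :: real
  shows "0 \<le> exp y - 1 - y" "exp y - 1 - y \<le> y\<^sup>2 * exp \<bar>y\<bar>"
proof -
  show "0 \<le> exp y - 1 - y" using exp_ge_add_one_self[of y] by linarith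
  obtain t where t: "\<bar>t\<bar> \<le> \<bar>y\<bar>" "exp y = (\<Sum>m<2. y ^ m / fact m) + exp t / fact 2 * y ^ 2"
    using Maclaurin_exp_le[of y 2] by auto
  then have "exp y - 1 - y = exp t / 2 * y\<^sup>2"
    by (simp add: numeral_2_eq_2)
  also have "\<dots> \<le> exp \<bar>y\<bar> * y\<^sup>2"
  proof (intro mult_right_mono)
    have "exp t \<le> exp \<bar>y\<bar>" using t(1) by simp
    then show "exp t / 2 \<le> exp \<bar>y\<bar>" using exp_gt_zero[of "\<bar>y\<bar>"] by linarith
  qed simp
  finally show "exp y - 1 - y \<le> y\<^sup>2 * exp \<bar>y\<bar>" by (simp add: mult.commute)
qed

lemma norm_iexp_compensated_le: "norm (iexp x - 1 - \<i> * complex_of_real x) \<le> x\<^sup>2"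
  using iexp_approx1[of x 1] by (simp add: numeral_2_eq_2) (smt (verit) mult_nonneg_nonneg zero_le_square diff_diff_eq)

section \<open>Shifts, weak limits and tightness\<close>

lemma real_distribution_shift:
  assumes "real_distribution M"
  shows "real_distribution (distr M borel (\<lambda>x. x + a))"
proof -
  interpret real_distribution M by fact
  show ?thesis by (intro real_distribution_distr) auto
qed

lemma char_shift:
  assumes "real_distribution M"
  shows "char (distr M borel (\<lambda>x. x + a)) u = iexp (u * a) * char M u"
proof -
  interpret real_distribution M by fact
  show ?thesis
    unfolding char_def by (subst integral_distr) (auto simp: distrib_left exp_add algebra_simps)
qed

text \<open>Fatou's lemma along a weak limit: truncation at level \<open>k\<close> makes the
  integrand bounded and continuous, so the bound passes to the limit law, and then the truncation is
  lifted.\<close>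

lemma weak_conv_nn_integral_le:
  assumes M: "\<And>n. real_distribution (M n)" "real_distribution S" and wc: "weak_conv_m M S"
    and c: "continuous_on UNIV f" and nn: "\<And>x::real. 0 \<le> f x" and K: "\<And>n. (\<integral>\<^sup>+x. ennreal (f x) \<partial>M n) \<le> ennreal K"
  shows "(\<integral>\<^sup>+x. ennreal (f x) \<partial>S) \<le> ennreal K"
proof -
  interpret M: real_distribution "M n" for n by fact
  interpret S: real_distribution S by fact
  have [measurable]: "f \<in> borel_measurable borel" using c by (rule borel_measurable_continuous_onI)
  have bnd: "(\<integral>\<^sup>+x. ennreal (min (f x) (real k)) \<partial>S) \<le> ennreal K" for k :: nat
  proof -
    have intM: "integrable (M n) (\<lambda>x. min (f x) (real k))" for n
      using nn by (intro M.integrable_const_bound[where B="real k"]) (auto simp: min_def)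
    have intS: "integrable S (\<lambda>x. min (f x) (real k))"
      using nn by (intro S.integrable_const_bound[where B="real k"]) (auto simp: min_def)
    have "(\<lambda>n. \<integral>x. min (f x) (real k) \<partial>M n) \<longlonglongrightarrow> (\<integral>x. min (f x) (real k) \<partial>S)"
      using c nn
      by (intro weak_conv_imp_integral_bdd_continuous_conv[OF M wc, where B="real k"])
         (auto simp: continuous_on_eq_continuous_at abs_of_nonneg intro!: continuous_min)
    then have "(\<lambda>n. ennreal (\<integral>x. min (f x) (real k) \<partial>M n)) \<longlonglongrightarrow> ennreal (\<integral>x. min (f x) (real k) \<partial>S)"
      by (rule tendsto_ennrealI)
    moreover have "ennreal (\<integral>x. min (f x) (real k) \<partial>M n) \<le> ennreal K" for n
    proof -
      have "ennreal (\<integral>x. min (f x) (real k) \<partial>M n) = (\<integral>\<^sup>+x. ennreal (min (f x) (real k)) \<partial>M n)"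
        using intM nn by (subst nn_integral_eq_integral) auto
      also have "\<dots> \<le> (\<integral>\<^sup>+x. ennreal (f x) \<partial>M n)"
        by (intro nn_integral_mono ennreal_leI) auto
      finally show ?thesis using K[of n] by simp
    qed
    ultimately have "ennreal (\<integral>x. min (f x) (real k) \<partial>S) \<le> ennreal K"
      by (intro LIMSEQ_le_const2) auto
    then show ?thesis using intS nn by (subst nn_integral_eq_integral) auto
  qed
  have "(\<integral>\<^sup>+x. ennreal (f x) \<partial>S) = (\<integral>\<^sup>+x. liminf (\<lambda>k. ennreal (min (f x) (real k))) \<partial>S)"
  proof (intro nn_integral_cong)
    fix x
    have "eventually (\<lambda>k. f x \<le> real k) sequentially"
      using filterlim_real_sequentially by (simp add: filterlim_at_top)
    then have "eventually (\<lambda>k. ennreal (min (f x) (real k)) = ennreal (f x)) sequentially"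
      by eventually_elim (simp add: min_def)
    then have "(\<lambda>k. ennreal (min (f x) (real k))) \<longlonglongrightarrow> ennreal (f x)"
      by (rule tendsto_eventually)
    then show "ennreal (f x) = liminf (\<lambda>k. ennreal (min (f x) (real k)))"
      using lim_imp_Liminf[OF sequentially_bot] by metis
  qed
  also have "\<dots> \<le> liminf (\<lambda>k. \<integral>\<^sup>+x. ennreal (min (f x) (real k)) \<partial>S)"
    by (intro nn_integral_liminf) auto
  also have "\<dots> \<le> ennreal K"
  proof -
    have "liminf (\<lambda>k. \<integral>\<^sup>+x. ennreal (min (f x) (real k)) \<partial>S) \<le> liminf (\<lambda>k::nat. ennreal K)"
      using bnd by (intro Liminf_mono always_eventually) auto
    then show ?thesis by (simp add: Liminf_const)
  qed
  finally show ?thesis .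
qed

text \<open>Markov's inequality for \<open>exp x + exp (- x)\<close>, which is at least
  \<open>exp b\<close> off the interval from \<open>- b\<close> to \<open>b\<close>.\<close>

lemma tight_exp_moments:
  assumes M: "\<And>n. real_distribution (M n)"
    and K: "\<And>n. (\<integral>\<^sup>+x. ennreal (exp x) \<partial>M n) \<le> ennreal K" "\<And>n. (\<integral>\<^sup>+x. ennreal (exp (- x)) \<partial>M n) \<le> ennreal K"
    and K0: "0 \<le> K"
  shows "tight M"
  unfolding tight_def
proof (intro conjI allI impI)
  fix e :: real assume e: "0 < e"
  \<comment> \<open>The summand 1 keeps the argument of the logarithm positive when
    \<open>K = 0\<close>; passing from \<open>a\<close> to \<open>b\<close> makes the interval
    nondegenerate and the final inequality strict.\<close>
  define a where "a = ln ((2 * K + 1) / e)"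
  have ea: "exp a = (2 * K + 1) / e" using e K0 by (simp add: a_def)
  define b where "b = max a 0 + 1"
  have b: "b > 0" "exp b * e > 2 * K"
  proof -
    have "exp b > exp a" by (simp add: b_def)
    then have "exp b * e > exp a * e" using e by simp
    then show "exp b * e > 2 * K" using e by (simp add: ea)
  qed (simp add: b_def)
  show "\<exists>a b. a < b \<and> (\<forall>n. 1 - e < measure (M n) {a<..b})"
  proof (intro exI conjI allI)
    show "- b < b" using b by simp
    fix n
    interpret M: real_distribution "M n" by fact
    have "emeasure (M n) (- {- b<..b}) * ennreal (exp b) = (\<integral>\<^sup>+x. ennreal (exp b) * indicator (- {- b<..b}) x \<partial>M n)"
      by (subst nn_integral_cmult_indicator) (auto simp: mult.commute)
    also have "\<dots> \<le> (\<integral>\<^sup>+x. ennreal (exp x) + ennreal (exp (- x)) \<partial>M n)"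
    proof (intro nn_integral_mono)
      fix x
      show "ennreal (exp b) * indicator (- {- b<..b}) x \<le> ennreal (exp x) + ennreal (exp (- x))"
      proof (cases "x \<in> {- b<..b}")
        case False
        then have "exp b \<le> exp x \<or> exp b \<le> exp (- x)" by auto
        then have "exp b \<le> exp x + exp (- x)"
          using exp_gt_zero[of x] exp_gt_zero[of "- x"] by linarith
        then show ?thesis using False by (simp add: ennreal_leI flip: ennreal_plus)
      qed simp
    qed
    also have "\<dots> \<le> ennreal K + ennreal K"
      using K[of n] by (simp add: nn_integral_add add_mono)
    finally have "ennreal (measure (M n) (- {- b<..b}) * exp b) \<le> ennreal (2 * K)"
      using K0 by (simp add: M.emeasure_eq_measure ennreal_mult flip: ennreal_plus)
    then have "measure (M n) (- {- b<..b}) * exp b \<le> 2 * K"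
      using K0 by simp
    also have "\<dots> < e * exp b" using b by (simp add: mult.commute)
    finally have "measure (M n) (- {- b<..b}) < e" by simp
    moreover have "measure (M n) (- {- b<..b}) = 1 - measure (M n) {- b<..b}"
      using M.prob_compl[of "{- b<..b}"] by (simp add: Compl_eq_Diff_UNIV)
    ultimately show "1 - e < measure (M n) {- b<..b}" by simp
  qed
qed fact

text \<open>The intensity may have infinite mass near 0, so no compound Poisson law is available.
  Jumps up to size \<open>1 / (n + 1)\<close> are discarded, the resulting compound Poisson laws are
  centred, and a weak limit is taken. The characteristic function converges by dominated
  convergence, since the compensated integrand is of order \<open>z\<^sup>2\<close>; exponential
  moments are only bounded from above, because they pass to a weak limit as inequalities.\<close>

lemma compensated_jumps_exist:
  fixes \<kappa> :: "real measure"
  assumes sets [simp, measurable_cong]: "sets \<kappa> = sets borel" and int2: "integrable \<kappa> (\<lambda>z. z\<^sup>2)"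
    and bdd: "AE z in \<kappa>. \<bar>z\<bar> \<le> h"
  obtains S where "real_distribution S"
    "\<And>u. char S u = exp (\<integral>z. comp_iexp u z \<partial>\<kappa>)"
    "\<And>\<theta>. mgf S \<theta> \<le> ennreal (exp (\<integral>z. (exp (\<theta> * z) - 1 - \<theta> * z) \<partial>\<kappa>))"
proof -
  have [simp]: "space \<kappa> = UNIV" using sets_eq_imp_space_eq[OF sets] by simp
  define J where "J n = {z. 1 / real (Suc n) < \<bar>z\<bar>}" for n
  have J [measurable]: "J n \<in> sets borel" for n unfolding J_def by measurable
  define \<kappa>' where "\<kappa>' n = density \<kappa> (indicator (J n))" for n
  have emJ: "emeasure (\<kappa>' n) UNIV < \<infinity>" for n
  proof -
    have "emeasure (\<kappa>' n) UNIV = (\<integral>\<^sup>+z. indicator (J n) z \<partial>\<kappa>)"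
      unfolding \<kappa>'_def by (subst emeasure_density) auto
    also have "\<dots> \<le> (\<integral>\<^sup>+z. ennreal ((real (Suc n))\<^sup>2 * z\<^sup>2) \<partial>\<kappa>)"
    proof (intro nn_integral_mono)
      fix z
      show "indicator (J n) z \<le> ennreal ((real (Suc n))\<^sup>2 * z\<^sup>2)"
      proof (cases "z \<in> J n")
        case True
        then have "1 \<le> real (Suc n) * \<bar>z\<bar>" by (simp add: J_def field_simps)
        then have "1 \<le> (real (Suc n) * \<bar>z\<bar>)\<^sup>2" by (rule one_le_power)
        then show ?thesis using True by (simp add: power_mult_distrib)
      qed simp
    qed
    also have "\<dots> < \<infinity>" using int2
      by (subst nn_integral_eq_integral) auto
    finally show ?thesis .
  qed
  interpret K: jump_intensity "\<kappa>' n" for n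
    using emJ[of n]
    by (intro jump_intensity.intro finite_measureI jump_intensity_axioms.intro) (auto simp: \<kappa>'_def)
  have bdd': "AE z in \<kappa>' n. \<bar>z\<bar> \<le> h" for n
    unfolding \<kappa>'_def using bdd by (subst AE_density) auto
  have int_id: "integrable (\<kappa>' n) (\<lambda>z. z)" for n
    using bdd'[of n] by (intro K.integrable_const_bound[where B=h]) auto
  have int_iexp: "integrable (\<kappa>' n) (\<lambda>z. iexp (u * z))" for n u
    by (intro K.integrable_const_bound[where B=1]) auto
  have int_exp: "integrable (\<kappa>' n) (\<lambda>z. exp (\<theta> * z))" for n \<theta>
  proof (intro K.integrable_const_bound[where B="exp (\<bar>\<theta>\<bar> * h)"])
    show "AE z in \<kappa>' n. norm (exp (\<theta> * z)) \<le> exp (\<bar>\<theta>\<bar> * h)"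
      using bdd'[of n]
    proof eventually_elim
      case (elim z)
      have "\<theta> * z \<le> \<bar>\<theta>\<bar> * \<bar>z\<bar>" by (metis abs_ge_self abs_mult)
      also have "\<dots> \<le> \<bar>\<theta>\<bar> * h" using elim by (intro mult_left_mono) auto
      finally show ?case by simp
    qed
  qed simp
  define c where "c n = (\<integral>z. z \<partial>\<kappa>' n)" for n
  \<comment> \<open>Subtracting the mean \<open>c n\<close> is the compensation: it turns the
    integrand \<open>iexp (u * z) - 1\<close> of the compound Poisson exponent into
    \<open>comp_iexp u z\<close>.\<close>
  define S where "S n = distr (compound_poisson (\<kappa>' n)) borel (\<lambda>x. x + - c n)" for n
  have rdS: "real_distribution (S n)" for n
    unfolding S_def by (intro real_distribution_shift K.real_distribution_compound_poisson)
  have charS: "char (S n) u = exp (\<integral>z. indicator (J n) z *\<^sub>R comp_iexp u z \<partial>\<kappa>)" for n u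
  proof -
    have "(\<integral>z. comp_iexp u z \<partial>\<kappa>' n) =
       (\<integral>z. (iexp (u * z) - 1) \<partial>\<kappa>' n) - (\<integral>z. (\<i> * complex_of_real u) * complex_of_real z \<partial>\<kappa>' n)"
      using int_id[of n] int_iexp
      by (subst Bochner_Integration.integral_diff[symmetric]) (auto simp: mult.assoc)
    also have "(\<integral>z. (\<i> * complex_of_real u) * complex_of_real z \<partial>\<kappa>' n) = \<i> * of_real (u * c n)"
      unfolding c_def by (subst integral_mult_right_zero) (simp add: mult.assoc)
    finally have "(\<integral>z. comp_iexp u z \<partial>\<kappa>' n) =
       (\<integral>z. (iexp (u * z) - 1) \<partial>\<kappa>' n) - \<i> * of_real (u * c n)" .
    then have "char (S n) u = exp (\<integral>z. comp_iexp u z \<partial>\<kappa>' n)"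
      unfolding S_def
      by (subst char_shift) (simp_all add: K.real_distribution_compound_poisson K.char_compound_poisson mult_exp_exp)
    also have "(\<integral>z. comp_iexp u z \<partial>\<kappa>' n) =
       (\<integral>z. indicator (J n) z *\<^sub>R comp_iexp u z \<partial>\<kappa>)"
      unfolding \<kappa>'_def ennreal_indicator[symmetric] by (subst integral_density) auto
    finally show ?thesis .
  qed
  have int_comp: "integrable \<kappa> (\<lambda>z. exp (\<theta> * z) - 1 - \<theta> * z)" for \<theta>
  proof (rule Bochner_Integration.integrable_bound)
    show "integrable \<kappa> (\<lambda>z. (\<theta>\<^sup>2 * exp (\<bar>\<theta>\<bar> * h)) * z\<^sup>2)" using int2 by simp
    show "AE z in \<kappa>. norm (exp (\<theta> * z) - 1 - \<theta> * z) \<le> norm ((\<theta>\<^sup>2 * exp (\<bar>\<theta>\<bar> * h)) * z\<^sup>2)"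
      using bdd
    proof eventually_elim
      case (elim z)
      have "exp (\<theta> * z) - 1 - \<theta> * z \<le> (\<theta> * z)\<^sup>2 * exp \<bar>\<theta> * z\<bar>"
        by (rule exp_minus_one_minus_bounds)
      also have "\<dots> \<le> (\<theta> * z)\<^sup>2 * exp (\<bar>\<theta>\<bar> * h)"
        using elim by (intro mult_left_mono) (auto simp: abs_mult mult_left_mono)
      finally show ?case
        using exp_minus_one_minus_bounds(1)[of "\<theta> * z"] by (simp add: power_mult_distrib mult_ac)
    qed
  qed simp
  define w where "w \<theta> = (\<integral>z. (exp (\<theta> * z) - 1 - \<theta> * z) \<partial>\<kappa>)" for \<theta>
  have mgfS: "mgf (S n) \<theta> \<le> ennreal (exp (w \<theta>))" for n \<theta>
  proof -
    interpret P: real_distribution "compound_poisson (\<kappa>' n)" by (rule K.real_distribution_compound_poisson)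
    have "mgf (S n) \<theta> =
        (\<integral>\<^sup>+x. ennreal (exp (- \<theta> * c n)) * ennreal (exp (\<theta> * x)) \<partial>compound_poisson (\<kappa>' n))"
      unfolding S_def
      by (subst nn_integral_distr) (auto simp: algebra_simps mult_exp_exp simp flip: ennreal_mult)
    also have "\<dots> = ennreal (exp (- \<theta> * c n)) * ennreal (exp (\<integral>z. (exp (\<theta> * z) - 1) \<partial>\<kappa>' n))"
      by (subst nn_integral_cmult) (simp_all only: K.nn_integral_exp_compound_poisson[OF int_exp], simp)
    also have "\<dots> = ennreal (exp ((\<integral>z. (exp (\<theta> * z) - 1) \<partial>\<kappa>' n) - \<theta> * c n))"
      by (subst ennreal_mult[symmetric]) (simp_all only: mult_exp_exp exp_ge_zero, simp only: minus_mult_left[symmetric] uminus_add_conv_diff)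
    also have "(\<integral>z. (exp (\<theta> * z) - 1) \<partial>\<kappa>' n) - \<theta> * c n = (\<integral>z. (exp (\<theta> * z) - 1 - \<theta> * z) \<partial>\<kappa>' n)"
      using int_exp[of n \<theta>] int_id[of n] by (simp add: c_def)
    also have "\<dots> = (\<integral>z. indicator (J n) z * (exp (\<theta> * z) - 1 - \<theta> * z) \<partial>\<kappa>)"
      unfolding \<kappa>'_def ennreal_indicator[symmetric] by (subst integral_density) auto
    \<comment> \<open>The integrand is nonnegative, so discarding small jumps only lowers the
      exponent. The bound is uniform in \<open>n\<close>, which is what tightness asks for.\<close>
    also have "\<dots> \<le> w \<theta>"
      unfolding w_def
    proof (intro integral_mono int_comp)
      show "integrable \<kappa> (\<lambda>z. indicator (J n) z * (exp (\<theta> * z) - 1 - \<theta> * z))"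
        by (rule Bochner_Integration.integrable_bound[OF int_comp[of \<theta>]]) (auto simp: indicator_def)
    qed (use exp_minus_one_minus_bounds(1) in \<open>auto simp: indicator_def\<close>)
    finally show ?thesis by (simp add: ennreal_leI)
  qed
  have "tight S"
  proof (rule tight_exp_moments[OF rdS])
    show "(\<integral>\<^sup>+x. ennreal (exp x) \<partial>S n) \<le> ennreal (exp (w 1) + exp (w (- 1)))" for n
      using mgfS[of n 1] by (auto intro: order_trans ennreal_leI)
    show "(\<integral>\<^sup>+x. ennreal (exp (- x)) \<partial>S n) \<le> ennreal (exp (w 1) + exp (w (- 1)))" for n
      using mgfS[of n "- 1"] by (auto intro: order_trans ennreal_leI)
  qed (simp add: add_nonneg_nonneg)
  \<comment> \<open>A subsequence suffices: the characteristic functions of the whole sequence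
    converge to the required one, which identifies every subsequential limit.\<close>
  from tight_imp_convergent_subsubsequence[OF this, of id]
  obtain r S' where r: "strict_mono (r :: nat \<Rightarrow> nat)" and S': "real_distribution S'" and wc: "weak_conv_m (S \<circ> r) S'"
    by (auto simp: strict_mono_def)
  show thesis
  proof (rule that[OF S'])
    fix \<theta>
    show "mgf S' \<theta> \<le> ennreal (exp (\<integral>z. (exp (\<theta> * z) - 1 - \<theta> * z) \<partial>\<kappa>))"
      unfolding w_def[symmetric]
      by (rule weak_conv_nn_integral_le[OF _ S' wc]) (use rdS mgfS in \<open>auto intro!: continuous_intros\<close>)
  next
    fix u
    have "(\<lambda>n. (\<integral>z. indicator (J n) z *\<^sub>R comp_iexp u z \<partial>\<kappa>))
       \<longlonglongrightarrow> (\<integral>z. comp_iexp u z \<partial>\<kappa>)"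
    proof (rule integral_dominated_convergence)
      show "integrable \<kappa> (\<lambda>z. u\<^sup>2 * z\<^sup>2)" using int2 by simp
      show "AE z in \<kappa>. norm (indicator (J n) z *\<^sub>R comp_iexp u z) \<le> u\<^sup>2 * z\<^sup>2" for n
        using norm_iexp_compensated_le[of "u * z" for z] by (auto simp: indicator_def power_mult_distrib simp del: of_real_mult)
      show "AE z in \<kappa>. (\<lambda>n. indicator (J n) z *\<^sub>R comp_iexp u z)
          \<longlonglongrightarrow> comp_iexp u z"
      proof (rule AE_I2)
        fix z
        show "(\<lambda>n. indicator (J n) z *\<^sub>R comp_iexp u z)
          \<longlonglongrightarrow> comp_iexp u z"
        proof (cases "z = 0")
          case False
          have "(\<lambda>n. 1 / real (Suc n)) \<longlonglongrightarrow> 0" using LIMSEQ_inverse_real_of_nat by (simp add: divide_inverse)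
          then have "eventually (\<lambda>n. 1 / real (Suc n) < \<bar>z\<bar>) sequentially"
            using False by (intro order_tendstoD) auto
          then have "eventually (\<lambda>n. indicator (J n) z *\<^sub>R comp_iexp u z =
              comp_iexp u z) sequentially"
            by eventually_elim (simp add: J_def)
          then show ?thesis by (rule tendsto_eventually)
        qed simp
      qed
    qed auto
    then have "(\<lambda>n. char (S n) u) \<longlonglongrightarrow> exp (\<integral>z. comp_iexp u z \<partial>\<kappa>)"
      unfolding charS by (rule tendsto_exp)
    then have "(\<lambda>n. char ((S \<circ> r) n) u) \<longlonglongrightarrow> exp (\<integral>z. comp_iexp u z \<partial>\<kappa>)"
      using LIMSEQ_subseq_LIMSEQ[OF _ r] by (fastforce simp: o_def)
    moreover have "(\<lambda>n. char ((S \<circ> r) n) u) \<longlonglongrightarrow> char S' u"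
      by (rule levy_continuity1[OF _ S' wc]) (use rdS in auto)
    ultimately show "char S' u = exp (\<integral>z. comp_iexp u z \<partial>\<kappa>)"
      using LIMSEQ_unique by blast
  qed
qed

section \<open>Gaussian call prices\<close>

interpretation std_normal: real_distribution std_normal_distribution
  by (rule real_dist_normal_dist)

lemma std_normal_abs_moment:
  shows integrable_std_normal_id: "integrable std_normal_distribution (\<lambda>x. x)"
    and std_normal_abs_le_1: "(\<integral>x. \<bar>x\<bar> \<partial>std_normal_distribution) \<le> 1"
proof -
  show 1: "integrable std_normal_distribution (\<lambda>x. x)"
    using integrable_std_normal_distribution_moment[of 1] by simp
  have 2: "integrable std_normal_distribution (\<lambda>x. x\<^sup>2)"
    using integrable_std_normal_distribution_moment[of 2] by simp
  have "(\<integral>x. \<bar>x\<bar> \<partial>std_normal_distribution) \<le> (\<integral>x. 1/2 + x\<^sup>2 / 2 \<partial>std_normal_distribution)"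
  proof (rule integral_mono)
    fix x :: real
    show "\<bar>x\<bar> \<le> 1/2 + x\<^sup>2 / 2"
      using zero_le_power2[of "\<bar>x\<bar> - 1"] by (simp add: power2_eq_square algebra_simps abs_if split: if_splits)
  qed (use 1 2 in auto)
  also have "\<dots> = 1/2 + (\<integral>x. x\<^sup>2 \<partial>std_normal_distribution) / 2"
    using 2 std_normal.prob_space by (subst Bochner_Integration.integral_add) auto
  also have "(\<integral>x. x\<^sup>2 \<partial>std_normal_distribution) = 1"
    using std_normal_distribution_even_moments(1)[of 1] by (simp add: fact_numeral)
  finally show "(\<integral>x. \<bar>x\<bar> \<partial>std_normal_distribution) \<le> 1" by simp
qed

text \<open>The Bachelier price with standard deviation \<open>s\<close> and strike
  \<open>y\<close>, that is, with a payoff linear in the Gaussian variable. The value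
  \<open>s = 0\<close> is allowed and yields the positive part of \<open>- y\<close>.\<close>

definition gauss_call :: "real \<Rightarrow> real \<Rightarrow> real" where
  "gauss_call s y = (\<integral>x. max (s * x - y) 0 \<partial>std_normal_distribution)"

lemma integrable_gauss_call [simp]: "integrable std_normal_distribution (\<lambda>x. max (s * x - y) 0)"
proof (rule Bochner_Integration.integrable_bound)
  show "integrable std_normal_distribution (\<lambda>x. \<bar>s\<bar> * \<bar>x\<bar> + \<bar>y\<bar>)"
    using integrable_std_normal_id by (intro Bochner_Integration.integrable_add integrable_mult_right integrable_abs) auto
  show "AE x in std_normal_distribution. norm (max (s * x - y) 0) \<le> norm (\<bar>s\<bar> * \<bar>x\<bar> + \<bar>y\<bar>)"
  proof (rule AE_I2)
    fix x
    have "s * x \<le> \<bar>s\<bar> * \<bar>x\<bar>" by (metis abs_ge_self abs_mult)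
    then show "norm (max (s * x - y) 0) \<le> norm (\<bar>s\<bar> * \<bar>x\<bar> + \<bar>y\<bar>)" by auto
  qed
qed simp

lemma gauss_call_nonneg: "0 \<le> gauss_call s y"
  unfolding gauss_call_def by (rule integral_nonneg_AE) auto

lemma gauss_call_antimono: "y \<le> z \<Longrightarrow> gauss_call s z \<le> gauss_call s y"
  unfolding gauss_call_def by (intro integral_mono) auto

lemma gauss_call_lipschitz: "\<bar>gauss_call s y - gauss_call s z\<bar> \<le> \<bar>y - z\<bar>"
proof -
  have "\<bar>gauss_call s y - gauss_call s z\<bar> = \<bar>\<integral>x. (max (s * x - y) 0 - max (s * x - z) 0) \<partial>std_normal_distribution\<bar>"
    unfolding gauss_call_def by simp
  also have "\<dots> \<le> (\<integral>x. \<bar>max (s * x - y) 0 - max (s * x - z) 0\<bar> \<partial>std_normal_distribution)"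
    by (rule integral_abs_bound)
  also have "\<dots> \<le> (\<integral>x. \<bar>y - z\<bar> \<partial>std_normal_distribution)"
    by (intro integral_mono integrable_abs Bochner_Integration.integrable_diff integrable_gauss_call) auto
  also have "\<dots> = \<bar>y - z\<bar>" using std_normal.prob_space by simp
  finally show ?thesis .
qed

lemma gauss_call_0: "gauss_call 0 y = max (- y) 0"
  using std_normal.prob_space by (simp add: gauss_call_def)

lemma nn_integral_gauss_call:
  "(\<integral>\<^sup>+x. ennreal (max (s * x - y) 0) \<partial>std_normal_distribution) = ennreal (gauss_call s y)"
  unfolding gauss_call_def by (subst nn_integral_eq_integral) auto

text \<open>What is left of the unit-variance call price at strike \<open>u\<close> once the normal
  density at \<open>u\<close> is factored out: an analogue, for the integrated tail, of the Mills
  ratio. It varies only polynomially in \<open>u\<close>, so the exponential decay of the price sits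
  in the density.\<close>

definition mills :: "real \<Rightarrow> ennreal" where
  "mills u = (\<integral>\<^sup>+y. ennreal (max y 0 * exp (- u * y - y\<^sup>2 / 2)) \<partial>lborel)"

lemma gauss_call_eq_mills: "ennreal (gauss_call 1 u) = ennreal (std_normal_density u) * mills u"
proof -
  have "ennreal (gauss_call 1 u) = (\<integral>\<^sup>+x. ennreal (std_normal_density x) * ennreal (max (x - u) 0) \<partial>lborel)"
    unfolding nn_integral_gauss_call[symmetric] by (subst nn_integral_density) auto
  also have "\<dots> = (\<integral>\<^sup>+y. ennreal (std_normal_density (u + y)) * ennreal (max y 0) \<partial>lborel)"
    using nn_integral_real_affine[of "\<lambda>x. ennreal (std_normal_density x) * ennreal (max (x - u) 0)" 1 u]
    by simp
  also have "\<dots> = (\<integral>\<^sup>+y. ennreal (std_normal_density u) * ennreal (max y 0 * exp (- u * y - y\<^sup>2 / 2)) \<partial>lborel)"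
  proof (intro nn_integral_cong)
    fix y
    have "std_normal_density (u + y) = std_normal_density u * exp (- u * y - y\<^sup>2 / 2)"
      unfolding std_normal_density_def mult.assoc mult_exp_exp
      by (rule arg_cong[where f="\<lambda>a. 1 / sqrt (2 * pi) * exp a"]) (simp add: power2_eq_square field_simps)
    then have "std_normal_density (u + y) * max y 0 = std_normal_density u * (max y 0 * exp (- u * y - y\<^sup>2 / 2))"
      by (simp only: mult_ac)
    moreover have "ennreal (std_normal_density (u + y)) * ennreal (max y 0) = ennreal (std_normal_density (u + y) * max y 0)"
      by (rule ennreal_mult[symmetric]) auto
    moreover have "ennreal (std_normal_density u) * ennreal (max y 0 * exp (- u * y - y\<^sup>2 / 2)) =
        ennreal (std_normal_density u * (max y 0 * exp (- u * y - y\<^sup>2 / 2)))"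
      by (rule ennreal_mult[symmetric]) auto
    ultimately show "ennreal (std_normal_density (u + y)) * ennreal (max y 0) =
       ennreal (std_normal_density u) * ennreal (max y 0 * exp (- u * y - y\<^sup>2 / 2))"
      by (simp only:)
  qed
  also have "\<dots> = ennreal (std_normal_density u) * mills u"
    unfolding mills_def by (rule nn_integral_cmult) simp
  finally show ?thesis .
qed

lemma mills_antimono: "u \<le> v \<Longrightarrow> mills v \<le> mills u"
  unfolding mills_def
  by (intro nn_integral_mono ennreal_leI) (auto simp: max_def mult_right_mono intro!: mult_left_mono)

text \<open>Substitute \<open>y\<close> by \<open>(u / v) * y\<close>. One factor
  \<open>u / v\<close> comes from the change of variable and one from the linear weight; the linear
  exponent becomes \<open>u * y\<close> exactly, and the quadratic one only improves.\<close>

lemma mills_scale: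
  assumes "0 < u" "u \<le> v"
  shows "ennreal ((u / v)\<^sup>2) * mills u \<le> mills v"
proof -
  define r where "r = u / v"
  have r: "0 < r" "r \<le> 1" "v * r = u" using assms by (auto simp: r_def)
  have "mills v = ennreal r * (\<integral>\<^sup>+y. ennreal (max (r * y) 0 * exp (- v * (r * y) - (r * y)\<^sup>2 / 2)) \<partial>lborel)"
    unfolding mills_def
    using nn_integral_real_affine[of "\<lambda>y. ennreal (max y 0 * exp (- v * y - y\<^sup>2 / 2))" r 0] r by simp
  also have "\<dots> \<ge> ennreal r * (\<integral>\<^sup>+y. ennreal r * ennreal (max y 0 * exp (- u * y - y\<^sup>2 / 2)) \<partial>lborel)"
  proof (intro mult_left_mono nn_integral_mono)
    fix y :: real
    have "(r * y)\<^sup>2 \<le> y\<^sup>2"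
      using r by (auto simp: power_mult_distrib intro!: mult_left_le_one_le power_le_one)
    then have "r * (max y 0 * exp (- u * y - y\<^sup>2 / 2)) \<le> r * (max y 0 * exp (- v * (r * y) - (r * y)\<^sup>2 / 2))"
      using r by (intro mult_left_mono) (auto simp: mult.assoc[symmetric])
    also have "\<dots> = max (r * y) 0 * exp (- v * (r * y) - (r * y)\<^sup>2 / 2)"
      using r by (auto simp: max_def mult_le_0_iff zero_le_mult_iff)
    finally show "ennreal r * ennreal (max y 0 * exp (- u * y - y\<^sup>2 / 2)) \<le>
       ennreal (max (r * y) 0 * exp (- v * (r * y) - (r * y)\<^sup>2 / 2))"
      using r by (simp add: ennreal_leI flip: ennreal_mult)
  qed simp
  also have "ennreal r * (\<integral>\<^sup>+y. ennreal r * ennreal (max y 0 * exp (- u * y - y\<^sup>2 / 2)) \<partial>lborel) =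
     ennreal (r\<^sup>2) * mills u"
    unfolding mills_def using r
    by (subst nn_integral_cmult) (auto simp: power2_eq_square ennreal_mult mult.assoc)
  finally show ?thesis unfolding r_def .
qed

text \<open>Since \<open>mills\<close> decreases, the price at \<open>u\<close> is at most the price
  at 0 times the ratio of densities, and the price at 0 is at most the first absolute
  moment.\<close>

lemma gauss_call_le_exp_1:
  assumes "0 \<le> u"
  shows "gauss_call 1 u \<le> exp (- u\<^sup>2 / 2)"
proof -
  have 0: "gauss_call 1 0 \<le> 1"
  proof -
    have "gauss_call 1 0 \<le> (\<integral>x. \<bar>x\<bar> \<partial>std_normal_distribution)"
      unfolding gauss_call_def using integrable_std_normal_id
      by (intro integral_mono integrable_abs integrable_gauss_call) auto
    then show ?thesis using std_normal_abs_le_1 by simp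
  qed
  have "ennreal (gauss_call 1 u) \<le> ennreal (std_normal_density u) * mills 0"
    unfolding gauss_call_eq_mills using mills_antimono[of 0 u] assms by (intro mult_left_mono) auto
  also have "std_normal_density u = exp (- u\<^sup>2 / 2) * std_normal_density 0"
    by (simp add: std_normal_density_def)
  also have "ennreal (exp (- u\<^sup>2 / 2) * std_normal_density 0) * mills 0 = ennreal (exp (- u\<^sup>2 / 2)) * ennreal (gauss_call 1 0)"
    unfolding gauss_call_eq_mills by (subst ennreal_mult) (auto simp: mult.assoc)
  also have "\<dots> \<le> ennreal (exp (- u\<^sup>2 / 2)) * ennreal 1"
    using 0 by (intro mult_left_mono ennreal_leI) auto
  finally show ?thesis by simp
qed

lemma gauss_call_ratio_1:
  assumes "0 < u" "u \<le> v"
  shows "gauss_call 1 u \<le> exp ((v\<^sup>2 - u\<^sup>2) / 2) * (v / u)\<^sup>2 * gauss_call 1 v"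
proof -
  have "ennreal ((u / v)\<^sup>2 * gauss_call 1 u) = ennreal (std_normal_density u) * (ennreal ((u / v)\<^sup>2) * mills u)"
    using gauss_call_nonneg[of 1 u] by (subst ennreal_mult) (auto simp: gauss_call_eq_mills mult_ac)
  also have "\<dots> \<le> ennreal (std_normal_density u) * mills v"
    using mills_scale[OF assms] by (intro mult_left_mono) auto
  also have "std_normal_density u = exp ((v\<^sup>2 - u\<^sup>2) / 2) * std_normal_density v"
    by (simp add: std_normal_density_def mult_exp_exp diff_divide_distrib)
  also have "ennreal (exp ((v\<^sup>2 - u\<^sup>2) / 2) * std_normal_density v) * mills v =
      ennreal (exp ((v\<^sup>2 - u\<^sup>2) / 2) * gauss_call 1 v)"
    using gauss_call_nonneg[of 1 v] by (simp add: ennreal_mult gauss_call_eq_mills mult.assoc)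
  finally have "(u / v)\<^sup>2 * gauss_call 1 u \<le> exp ((v\<^sup>2 - u\<^sup>2) / 2) * gauss_call 1 v"
    using gauss_call_nonneg[of 1 v] by simp
  then have "(v / u)\<^sup>2 * ((u / v)\<^sup>2 * gauss_call 1 u) \<le> (v / u)\<^sup>2 * (exp ((v\<^sup>2 - u\<^sup>2) / 2) * gauss_call 1 v)"
    by (intro mult_left_mono) auto
  moreover have "(v / u)\<^sup>2 * ((u / v)\<^sup>2 * gauss_call 1 u) = gauss_call 1 u"
    using assms by (simp add: power_divide)
  ultimately show ?thesis by (simp only: mult_ac)
qed

lemma gauss_call_scale:
  assumes "0 < s"
  shows "gauss_call s y = s * gauss_call 1 (y / s)"
proof -
  have "max (s * x - y) 0 = s * max (1 * x - y / s) 0" for x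
    using assms by (auto simp: max_def field_simps)
  then show ?thesis unfolding gauss_call_def by (simp only: integral_mult_right_zero)
qed

lemma gauss_call_le_exp:
  assumes "0 < s" "0 \<le> y"
  shows "gauss_call s y \<le> s * exp (- (y / s)\<^sup>2 / 2)"
  unfolding gauss_call_scale[OF assms(1)] using assms
  by (intro mult_left_mono gauss_call_le_exp_1) auto

text \<open>The rate \<open>6 * k / s\<^sup>2\<close> is the sum of 2 from the ratio of densities,
  where \<open>(b + a) / 2 \<le> 2 * k\<close>, and 4 from the polynomial factor
  \<open>(b / a)\<^sup>2\<close>. The latter fits the same shape because \<open>s \<le> k\<close>
  gives \<open>1 / a \<le> 2 * k / s\<^sup>2\<close>.\<close>

lemma gauss_call_ratio:
  assumes s: "0 < s" "s \<le> k" and ab: "k / 2 \<le> a" "a \<le> b" "b \<le> 3 * k / 2"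
  shows "gauss_call s a \<le> exp (6 * k * (b - a) / s\<^sup>2) * gauss_call s b"
proof -
  have k: "0 < k" and a: "0 < a" using s ab by auto
  have "(b / a)\<^sup>2 \<le> exp (4 * k * (b - a) / s\<^sup>2)"
  proof -
    have "b / a = 1 + (b - a) / a" using a by (simp add: field_simps)
    also have "\<dots> \<le> exp ((b - a) / a)" by simp
    finally have "(b / a)\<^sup>2 \<le> (exp ((b - a) / a))\<^sup>2"
      using a ab by (intro power_mono) auto
    also have "\<dots> = exp (2 * ((b - a) / a))" by (simp add: power2_eq_square mult_exp_exp)
    also have "\<dots> \<le> exp (4 * k * (b - a) / s\<^sup>2)"
    proof -
      have "s\<^sup>2 \<le> k\<^sup>2" using s by (intro power_mono) auto
      also have "\<dots> \<le> k * (2 * a)" using ab k by (simp add: power2_eq_square)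
      finally have "(b - a) * s\<^sup>2 \<le> (b - a) * (2 * k * a)"
        using ab by (intro mult_left_mono) auto
      then show ?thesis using a s by (simp add: field_simps)
    qed
    finally show ?thesis .
  qed
  moreover have "exp (((b / s)\<^sup>2 - (a / s)\<^sup>2) / 2) \<le> exp (2 * k * (b - a) / s\<^sup>2)"
  proof -
    have "(b / s)\<^sup>2 - (a / s)\<^sup>2 = (b + a) * (b - a) / s\<^sup>2"
      using s by (simp add: field_simps power2_eq_square)
    also have "\<dots> \<le> (4 * k) * (b - a) / s\<^sup>2"
      using ab k by (intro divide_right_mono mult_right_mono) auto
    finally show ?thesis by simp
  qed
  ultimately have "exp (((b / s)\<^sup>2 - (a / s)\<^sup>2) / 2) * (b / a)\<^sup>2 \<le>
      exp (2 * k * (b - a) / s\<^sup>2) * exp (4 * k * (b - a) / s\<^sup>2)"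
    by (intro mult_mono) auto
  also have "\<dots> = exp (6 * k * (b - a) / s\<^sup>2)"
    unfolding mult_exp_exp by (rule arg_cong[where f=exp]) (simp add: algebra_simps flip: add_divide_distrib)
  finally have le: "exp (((b / s)\<^sup>2 - (a / s)\<^sup>2) / 2) * (b / a)\<^sup>2 \<le> exp (6 * k * (b - a) / s\<^sup>2)" .
  have "gauss_call 1 (a / s) \<le> exp (((b / s)\<^sup>2 - (a / s)\<^sup>2) / 2) * ((b / s) / (a / s))\<^sup>2 * gauss_call 1 (b / s)"
    using a s ab by (intro gauss_call_ratio_1) (auto simp: divide_right_mono)
  also have "(b / s) / (a / s) = b / a" using s by simp
  also have "exp (((b / s)\<^sup>2 - (a / s)\<^sup>2) / 2) * (b / a)\<^sup>2 * gauss_call 1 (b / s) \<le>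
      exp (6 * k * (b - a) / s\<^sup>2) * gauss_call 1 (b / s)"
    using le gauss_call_nonneg by (rule mult_right_mono)
  finally show ?thesis
    unfolding gauss_call_scale[OF s(1)] using s by (simp add: mult.left_commute mult_left_mono)
qed

text \<open>The price decreases in the strike, so on either side of \<open>k\<close> one bound is
  monotonicity and the other is the ratio estimate. For negative \<open>x\<close> the estimate runs
  from \<open>k\<close> up to \<open>k - x\<close> and the larger price
  \<open>gauss_call s k\<close> replaces the smaller one.\<close>

lemma gauss_call_diff_le:
  assumes s: "0 < s" "s \<le> k" and x: "\<bar>x\<bar> \<le> k / 2"
  shows "\<bar>gauss_call s (k - x) - gauss_call s k\<bar> \<le> gauss_call s k * (exp (6 * k * \<bar>x\<bar> / s\<^sup>2) - 1)"
proof (cases "x \<ge> 0")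
  case True
  then have "gauss_call s (k - x) \<le> exp (6 * k * \<bar>x\<bar> / s\<^sup>2) * gauss_call s k"
    using gauss_call_ratio[of s k "k - x" k] s x by simp
  moreover have "gauss_call s k \<le> gauss_call s (k - x)"
    using True by (intro gauss_call_antimono) auto
  ultimately show ?thesis by (simp add: algebra_simps)
next
  case False
  let ?E = "exp (6 * k * \<bar>x\<bar> / s\<^sup>2)"
  have E: "1 \<le> ?E" using s by simp
  have "gauss_call s k \<le> ?E * gauss_call s (k - x)"
    using gauss_call_ratio[of s k k "k - x"] s x False by simp
  then have "gauss_call s k - gauss_call s (k - x) \<le> (?E - 1) * gauss_call s (k - x)"
    by (simp add: algebra_simps)
  also have "\<dots> \<le> (?E - 1) * gauss_call s k"
    using E False by (intro mult_left_mono gauss_call_antimono) auto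
  finally show ?thesis
    using gauss_call_antimono[of k "k - x" s] False by (simp add: algebra_simps)
qed

section \<open>Tails of a Levy measure\<close>

lemma sets_levy_measure: "levy_measure \<nu> \<Longrightarrow> sets \<nu> = sets borel"
  by (simp add: levy_measure_def)

lemma space_levy_measure: "levy_measure \<nu> \<Longrightarrow> space \<nu> = UNIV"
  using sets_eq_imp_space_eq[OF sets_levy_measure] by simp

lemma emeasure_levy_measure_finite:
  assumes \<nu>: "levy_measure \<nu>" and x: "0 < x"
  shows "emeasure \<nu> {z. x < \<bar>z\<bar>} < \<infinity>"
proof -
  have [simp, measurable_cong]: "sets \<nu> = sets borel" using \<nu> by (rule sets_levy_measure)
  define r where "r = min 1 (x\<^sup>2)"
  have r: "0 < r" using x by (simp add: r_def)
  have "emeasure \<nu> {z. x < \<bar>z\<bar>} = (\<integral>\<^sup>+z. indicator {z. x < \<bar>z\<bar>} z \<partial>\<nu>)" by simp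
  also have "\<dots> \<le> (\<integral>\<^sup>+z. ennreal ((1 / r) * min 1 (z\<^sup>2)) \<partial>\<nu>)"
  proof (intro nn_integral_mono)
    fix z :: real
    have "1 \<le> (1 / r) * min 1 (z\<^sup>2)" if "x < \<bar>z\<bar>"
    proof -
      have "x\<^sup>2 \<le> z\<^sup>2" using that x by (metis abs_le_square_iff abs_of_pos less_imp_le)
      then have "r \<le> min 1 (z\<^sup>2)" by (auto simp: r_def)
      then show ?thesis using r by (simp add: field_simps)
    qed
    then show "indicator {z. x < \<bar>z\<bar>} z \<le> ennreal ((1 / r) * min 1 (z\<^sup>2))"
      by (auto simp: indicator_def)
  qed
  also have "\<dots> < \<infinity>"
    using \<nu> r by (subst nn_integral_eq_integral) (auto simp: levy_measure_def)
  finally show ?thesis .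
qed

lemma fmeasurable_levy_measure:
  assumes \<nu>: "levy_measure \<nu>" and A: "A \<in> sets borel" "A \<subseteq> {z. x < \<bar>z\<bar>}" and x: "0 < x"
  shows "A \<in> fmeasurable \<nu>"
proof (rule fmeasurableI)
  show "A \<in> sets \<nu>" using A sets_levy_measure[OF \<nu>] by simp
  have "emeasure \<nu> A \<le> emeasure \<nu> {z. x < \<bar>z\<bar>}"
    using A by (intro emeasure_mono) (auto simp: sets_levy_measure[OF \<nu>])
  then show "emeasure \<nu> A < \<infinity>" using emeasure_levy_measure_finite[OF \<nu> x] by (rule le_less_trans)
qed

text \<open>Prepares the interchange of integrals below. The origin is a null set, and away from it
  the measure is finite outside every neighbourhood of 0.\<close>

lemma sigma_finite_levy_measure:
  assumes \<nu>: "levy_measure \<nu>"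
  shows "sigma_finite_measure \<nu>"
proof
  let ?A = "insert {0} (range (\<lambda>n. {z. 1 / real (Suc n) < \<bar>z\<bar>}))"
  have "\<exists>n. 1 / real (Suc n) < \<bar>z\<bar>" if "z \<noteq> 0" for z :: real
    using that reals_Archimedean[of "\<bar>z\<bar>"] by (auto simp: divide_inverse)
  then have "\<Union> ?A = UNIV" by auto
  moreover have "emeasure \<nu> a \<noteq> \<infinity>" if "a \<in> ?A" for a
    using that emeasure_levy_measure_finite[OF \<nu>, of "1 / real (Suc n)" for n] \<nu>
    by (auto simp: levy_measure_def less_top)
  ultimately show "\<exists>A. countable A \<and> A \<subseteq> sets \<nu> \<and> \<Union> A = space \<nu> \<and> (\<forall>a\<in>A. emeasure \<nu> a \<noteq> \<infinity>)"
    using \<nu> by (intro exI[of _ ?A]) (auto simp: sets_levy_measure space_levy_measure)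
qed

text \<open>Tonelli's theorem, after writing the excess of \<open>w z\<close> over \<open>x\<close>
  as the length of the interval between them. Different choices of \<open>w\<close> turn the one
  tail hypothesis into all the moment bounds that follow.\<close>

lemma nn_integral_layer_cake:
  fixes w :: "real \<Rightarrow> real"
  assumes "sigma_finite_measure \<nu>" and [simp, measurable_cong]: "sets \<nu> = sets borel"
    and [measurable]: "w \<in> borel_measurable borel"
  shows "(\<integral>\<^sup>+z. ennreal (max (w z - x) 0) \<partial>\<nu>) = (\<integral>\<^sup>+y. emeasure \<nu> {z. y < w z} * indicator {x<..} y \<partial>lborel)"
proof -
  interpret sigma_finite_measure \<nu> by fact
  interpret pair_sigma_finite \<nu> lborel ..
  have [simp]: "space \<nu> = UNIV" using sets_eq_imp_space_eq[OF assms(2)] by simp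
  have "(\<integral>\<^sup>+z. ennreal (max (w z - x) 0) \<partial>\<nu>) = (\<integral>\<^sup>+z. (\<integral>\<^sup>+y. indicator {p. x < snd p \<and> snd p < w (fst p)} (z, y) \<partial>lborel) \<partial>\<nu>)"
  proof (intro nn_integral_cong)
    fix z
    have "(\<integral>\<^sup>+y. indicator {p. x < snd p \<and> snd p < w (fst p)} (z, y) \<partial>lborel) =
       (\<integral>\<^sup>+y. indicator {x<..<w z} y \<partial>lborel)"
      by (intro nn_integral_cong) (auto simp: indicator_def)
    also have "\<dots> = ennreal (max (w z - x) 0)"
      by (cases "x \<le> w z") (auto simp: max_def ennreal_neg)
    finally show "ennreal (max (w z - x) 0) = (\<integral>\<^sup>+y. indicator {p. x < snd p \<and> snd p < w (fst p)} (z, y) \<partial>lborel)" ..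
  qed
  also have "\<dots> = (\<integral>\<^sup>+y. (\<integral>\<^sup>+z. indicator {p. x < snd p \<and> snd p < w (fst p)} (z, y) \<partial>\<nu>) \<partial>lborel)"
    by (rule Fubini'[symmetric]) measurable
  also have "\<dots> = (\<integral>\<^sup>+y. emeasure \<nu> {z. y < w z} * indicator {x<..} y \<partial>lborel)"
  proof (intro nn_integral_cong)
    fix y
    have "(\<integral>\<^sup>+z. indicator {p. x < snd p \<and> snd p < w (fst p)} (z, y) \<partial>\<nu>) =
      (\<integral>\<^sup>+z. indicator {z. y < w z} z * indicator {x<..} y \<partial>\<nu>)"
      by (intro nn_integral_cong) (auto simp: indicator_def)
    also have "\<dots> = emeasure \<nu> {z. y < w z} * indicator {x<..} y"
      by (subst nn_integral_multc) auto
    finally show "(\<integral>\<^sup>+z. indicator {p. x < snd p \<and> snd p < w (fst p)} (z, y) \<partial>\<nu>) = \<dots>" .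
  qed
  finally show ?thesis .
qed

lemma nn_integral_powr_Ioi:
  assumes "1 < a" "0 < x"
  shows "(\<integral>\<^sup>+y. ennreal (y powr (- a)) * indicator {x<..} y \<partial>lborel) = ennreal (x powr (1 - a) / (a - 1))"
proof -
  have "((\<lambda>y. y powr (- a)) has_integral -(x powr (- a + 1)) / (- a + 1)) {x..}"
    using assms by (intro has_integral_powr_to_inf) auto
  also have "-(x powr (- a + 1)) / (- a + 1) = x powr (1 - a) / (a - 1)"
    using assms by (simp add: field_simps)
  finally have "(\<integral>\<^sup>+y. ennreal (y powr (- a)) * indicator {x..} y \<partial>lborel) = ennreal (x powr (1 - a) / (a - 1))"
    by (intro nn_integral_has_integral_lebesgue') auto
  moreover have "(\<integral>\<^sup>+y. ennreal (y powr (- a)) * indicator {x..} y \<partial>lborel) =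
      (\<integral>\<^sup>+y. ennreal (y powr (- a)) * indicator {x<..} y \<partial>lborel)"
    using AE_lborel_singleton[of x] by (intro nn_integral_cong_AE) (auto simp: indicator_def)
  ultimately show ?thesis by simp
qed

text \<open>Layer cake for the square of \<open>min \<bar>z\<bar> h\<close>: its level
  \<open>y\<close> is the tail at \<open>sqrt y\<close>, and the truncation empties all levels from
  \<open>h\<^sup>2\<close> on. What remains is the integral of \<open>y powr (- a / 2)\<close> near
  0, finite because \<open>a < 2\<close>.\<close>

lemma small_jump_second_moment:
  assumes \<nu>: "levy_measure \<nu>" and a: "a < 2" and h: "0 < h" "h \<le> 1" and C: "0 \<le> C"
    and tail: "\<And>x. 0 < x \<Longrightarrow> x \<le> 1 \<Longrightarrow> emeasure \<nu> {z. x < \<bar>z\<bar>} \<le> ennreal (C * x powr (- a))"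
  shows "(\<integral>\<^sup>+z. ennreal (z\<^sup>2) * indicator {- h..h} z \<partial>\<nu>) \<le> ennreal (2 * C / (2 - a) * h powr (2 - a))"
proof -
  have [simp, measurable_cong]: "sets \<nu> = sets borel" using \<nu> by (rule sets_levy_measure)
  have "(\<integral>\<^sup>+z. ennreal (z\<^sup>2) * indicator {- h..h} z \<partial>\<nu>) \<le> (\<integral>\<^sup>+z. ennreal (max ((min \<bar>z\<bar> h)\<^sup>2 - 0) 0) \<partial>\<nu>)"
    by (intro nn_integral_mono) (auto simp: indicator_def min_def)
  also have "\<dots> = (\<integral>\<^sup>+y. emeasure \<nu> {z. y < (min \<bar>z\<bar> h)\<^sup>2} * indicator {0<..} y \<partial>lborel)"
    by (rule nn_integral_layer_cake) (use sigma_finite_levy_measure[OF \<nu>] in auto)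
  also have "\<dots> \<le> (\<integral>\<^sup>+y. ennreal (C * y powr (- a / 2)) * indicator {0..h\<^sup>2} y \<partial>lborel)"
  proof (intro nn_integral_mono)
    fix y :: real
    show "emeasure \<nu> {z. y < (min \<bar>z\<bar> h)\<^sup>2} * indicator {0<..} y \<le> ennreal (C * y powr (- a / 2)) * indicator {0..h\<^sup>2} y"
    proof (cases "0 < y \<and> y < h\<^sup>2")
      case True
      then have sy: "0 < sqrt y" "sqrt y \<le> h" by (auto simp: real_le_lsqrt h less_imp_le)
      have "{z. y < (min \<bar>z\<bar> h)\<^sup>2} \<subseteq> {z. sqrt y < \<bar>z\<bar>}"
      proof safe
        fix z assume "y < (min \<bar>z\<bar> h)\<^sup>2"
        then have "sqrt y < sqrt ((min \<bar>z\<bar> h)\<^sup>2)" by (rule real_sqrt_less_mono)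
        then show "sqrt y < \<bar>z\<bar>" using h by (simp add: min_def split: if_splits)
      qed
      then have "emeasure \<nu> {z. y < (min \<bar>z\<bar> h)\<^sup>2} \<le> emeasure \<nu> {z. sqrt y < \<bar>z\<bar>}"
        by (intro emeasure_mono) auto
      also have "\<dots> \<le> ennreal (C * sqrt y powr (- a))" using sy h by (intro tail) linarith+
      also have "sqrt y powr (- a) = y powr (- a / 2)"
        using True by (simp add: powr_half_sqrt[symmetric] powr_powr)
      finally show ?thesis using True by simp
    next
      case False
      have *: "{z. y < (min \<bar>z\<bar> h)\<^sup>2} = {}" if "h\<^sup>2 \<le> y"
      proof -
        have "(min \<bar>z\<bar> h)\<^sup>2 \<le> h\<^sup>2" for z using h by (intro power_mono) auto
        then show ?thesis using that by (auto simp: not_less intro: order_trans)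
      qed
      show ?thesis
      proof (cases "0 < y")
        case True
        then show ?thesis using False * by simp
      qed simp
    qed
  qed
  also have "\<dots> = ennreal (C * ((h\<^sup>2) powr (- a / 2 + 1) / (- a / 2 + 1)))"
  proof (rule nn_integral_has_integral_lebesgue')
    show "((\<lambda>y. C * y powr (- a / 2)) has_integral C * ((h\<^sup>2) powr (- a / 2 + 1) / (- a / 2 + 1))) {0..h\<^sup>2}"
      using a by (intro has_integral_mult_right has_integral_powr_from_0) auto
  qed (use C in auto)
  also have "(h\<^sup>2) powr (- a / 2 + 1) = h powr (2 - a)"
  proof -
    have "h\<^sup>2 = h powr 2" using h by (simp add: powr_numeral)
    then show ?thesis by (simp add: powr_powr distrib_left)
  qed
  also have "C * (h powr (2 - a) / (- a / 2 + 1)) = 2 * C / (2 - a) * h powr (2 - a)"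
    using a by (simp add: field_simps)
  finally show ?thesis .
qed

text \<open>On the jumps in question \<open>\<bar>z\<bar>\<close> is \<open>h\<close> plus the
  excess of \<open>min \<bar>z\<bar> 1\<close> over \<open>h\<close>. The first part costs
  \<open>C\<close>, the second, by layer cake, \<open>C / (a - 1)\<close>, both times
  \<open>h powr (1 - a)\<close>; the sum is the stated constant.\<close>

lemma intermediate_jump_first_moment:
  assumes \<nu>: "levy_measure \<nu>" and a: "1 < a" and h: "0 < h" "h \<le> 1" and C: "0 \<le> C"
    and tail: "\<And>x. 0 < x \<Longrightarrow> x \<le> 1 \<Longrightarrow> emeasure \<nu> {z. x < \<bar>z\<bar>} \<le> ennreal (C * x powr (- a))"
  shows "(\<integral>\<^sup>+z. ennreal (\<bar>z\<bar> * indicator ({- 1..1} - {- h..h}) z) \<partial>\<nu>) \<le> ennreal (C * a / (a - 1) * h powr (1 - a))"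
proof -
  have [simp, measurable_cong]: "sets \<nu> = sets borel" using \<nu> by (rule sets_levy_measure)
  have "(\<integral>\<^sup>+z. ennreal (\<bar>z\<bar> * indicator ({- 1..1} - {- h..h}) z) \<partial>\<nu>) \<le>
      (\<integral>\<^sup>+z. ennreal h * indicator {z. h < \<bar>z\<bar>} z + ennreal (max (min \<bar>z\<bar> 1 - h) 0) \<partial>\<nu>)"
  proof (intro nn_integral_mono)
    fix z
    show "ennreal (\<bar>z\<bar> * indicator ({- 1..1} - {- h..h}) z) \<le>
        ennreal h * indicator {z. h < \<bar>z\<bar>} z + ennreal (max (min \<bar>z\<bar> 1 - h) 0)"
    proof (cases "z \<in> {- 1..1} - {- h..h}")
      case True
      then have "h < \<bar>z\<bar>" "\<bar>z\<bar> \<le> 1" by auto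
      then show ?thesis using h True by (simp flip: ennreal_plus)
    qed simp
  qed
  also have "\<dots> = ennreal h * emeasure \<nu> {z. h < \<bar>z\<bar>} + (\<integral>\<^sup>+z. ennreal (max (min \<bar>z\<bar> 1 - h) 0) \<partial>\<nu>)"
    by (subst nn_integral_add) (auto simp: nn_integral_cmult_indicator)
  also have "(\<integral>\<^sup>+z. ennreal (max (min \<bar>z\<bar> 1 - h) 0) \<partial>\<nu>) = (\<integral>\<^sup>+y. emeasure \<nu> {z. y < min \<bar>z\<bar> 1} * indicator {h<..} y \<partial>lborel)"
    by (rule nn_integral_layer_cake) (use sigma_finite_levy_measure[OF \<nu>] in auto)
  also have "\<dots> \<le> (\<integral>\<^sup>+y. ennreal C * (ennreal (y powr (- a)) * indicator {h<..} y) \<partial>lborel)"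
  proof (intro nn_integral_mono)
    fix y :: real
    show "emeasure \<nu> {z. y < min \<bar>z\<bar> 1} * indicator {h<..} y \<le> ennreal C * (ennreal (y powr (- a)) * indicator {h<..} y)"
    proof (cases "h < y \<and> y < 1")
      case True
      have "emeasure \<nu> {z. y < min \<bar>z\<bar> 1} \<le> emeasure \<nu> {z. y < \<bar>z\<bar>}"
        by (intro emeasure_mono) auto
      also have "\<dots> \<le> ennreal (C * y powr (- a))" using True h by (intro tail) auto
      finally show ?thesis using True C by (simp add: ennreal_mult)
    next
      case False
      then show ?thesis by (auto simp: indicator_def not_less)
    qed
  qed
  also have "\<dots> = ennreal C * ennreal (h powr (1 - a) / (a - 1))"
    using a h by (subst nn_integral_cmult) (auto simp: nn_integral_powr_Ioi)
  also have "ennreal h * emeasure \<nu> {z. h < \<bar>z\<bar>} \<le> ennreal h * ennreal (C * h powr (- a))"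
    using tail[of h] h by (intro mult_left_mono) auto
  also have "\<dots> = ennreal (C * h powr (1 - a))"
    using h C by (simp add: powr_diff powr_minus divide_inverse flip: ennreal_mult)
  also have "ennreal (C * h powr (1 - a)) + ennreal C * ennreal (h powr (1 - a) / (a - 1)) =
      ennreal (C * h powr (1 - a) + C * (h powr (1 - a) / (a - 1)))"
  proof -
    have "ennreal C * ennreal (h powr (1 - a) / (a - 1)) = ennreal (C * (h powr (1 - a) / (a - 1)))"
      by (rule ennreal_mult[symmetric]) (use C a in auto)
    then show ?thesis using C a by (simp only:) (rule ennreal_plus[symmetric], auto)
  qed
  also have "C * h powr (1 - a) + C * (h powr (1 - a) / (a - 1)) = C * a / (a - 1) * h powr (1 - a)"
    using a by (simp add: field_simps)
  finally show ?thesis by simp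
qed

text \<open>The easy half of Karamata's theorem: by layer cake \<open>I x\<close> is the integral of
  the tail over \<open>{x<..}\<close>. Near 0 the tail is within a small multiple of
  \<open>y powr (- a)\<close> of its model; away from 0 both the tail and its model integrate to
  constants, which the factor \<open>x powr (a - 1)\<close> kills.\<close>

lemma integrated_tail_asymp:
  assumes \<nu>: "levy_measure \<nu>" and a: "1 < a" and c: "0 \<le> c"
    and tail: "((\<lambda>x. x powr a * measure \<nu> {x<..}) \<longlongrightarrow> c) (at_right 0)"
    and fin: "(\<integral>\<^sup>+z. ennreal \<bar>z\<bar> * indicator {z. 1 < \<bar>z\<bar>} z \<partial>\<nu>) < \<infinity>"
  defines "I \<equiv> \<lambda>x. \<integral>z. max (z - x) 0 \<partial>\<nu>"
  shows "\<And>x. 0 < x \<Longrightarrow> integrable \<nu> (\<lambda>z. max (z - x) 0)"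
    and "((\<lambda>x. x powr (a - 1) * I x) \<longlongrightarrow> c / (a - 1)) (at_right 0)"
proof -
  have [simp, measurable_cong]: "sets \<nu> = sets borel" using \<nu> by (rule sets_levy_measure)
  have fm: "{x<..} \<in> fmeasurable \<nu>" if "0 < x" for x
    by (rule fmeasurable_levy_measure[OF \<nu> _ _ that]) auto
  have em: "emeasure \<nu> {x<..} = ennreal (measure \<nu> {x<..})" if "0 < x" for x
    using fm[OF that] by (rule emeasure_eq_measure2)
  show int: "integrable \<nu> (\<lambda>z. max (z - x) 0)" if x: "0 < x" for x
  proof (rule integrableI_nonneg)
    have "(\<integral>\<^sup>+z. ennreal (max (z - x) 0) \<partial>\<nu>) \<le> (\<integral>\<^sup>+z. indicator {x<..} z + ennreal \<bar>z\<bar> * indicator {z. 1 < \<bar>z\<bar>} z \<partial>\<nu>)"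
    proof (intro nn_integral_mono)
      fix z
      show "ennreal (max (z - x) 0) \<le> indicator {x<..} z + ennreal \<bar>z\<bar> * indicator {z. 1 < \<bar>z\<bar>} z"
      proof (cases "x < z")
        case True
        show ?thesis
        proof (cases "1 < \<bar>z\<bar>")
          case True
          then have "ennreal (max (z - x) 0) \<le> ennreal \<bar>z\<bar>" using x by (intro ennreal_leI) auto
          then show ?thesis using True by (simp add: add_increasing)
        next
          case False
          then have "ennreal (max (z - x) 0) \<le> ennreal 1" using x by (intro ennreal_leI) auto
          then show ?thesis using False \<open>x < z\<close> by simp
        qed
      qed auto
    qed
    also have "\<dots> = emeasure \<nu> {x<..} + (\<integral>\<^sup>+z. ennreal \<bar>z\<bar> * indicator {z. 1 < \<bar>z\<bar>} z \<partial>\<nu>)"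
      by (subst nn_integral_add) auto
    also have "\<dots> < \<infinity>" using fin em[OF x] by simp
    finally show "(\<integral>\<^sup>+z. ennreal (max (z - x) 0) \<partial>\<nu>) < \<infinity>" .
  qed auto
  have lc: "ennreal (I x) = (\<integral>\<^sup>+y. emeasure \<nu> {y<..} * indicator {x<..} y \<partial>lborel)" if "0 < x" for x
  proof -
    have "ennreal (I x) = (\<integral>\<^sup>+z. ennreal (max (z - x) 0) \<partial>\<nu>)"
      unfolding I_def using int[OF that] by (subst nn_integral_eq_integral) auto
    also have "\<dots> = (\<integral>\<^sup>+y. emeasure \<nu> {z. y < z} * indicator {x<..} y \<partial>lborel)"
      by (rule nn_integral_layer_cake) (use sigma_finite_levy_measure[OF \<nu>] in auto)
    also have "\<dots> = (\<integral>\<^sup>+y. emeasure \<nu> {y<..} * indicator {x<..} y \<partial>lborel)"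
      by (simp add: greaterThan_def)
    finally show ?thesis .
  qed
  have [measurable]: "(\<lambda>y. emeasure \<nu> {y<..}) \<in> borel_measurable borel"
  proof -
    interpret sigma_finite_measure \<nu> using \<nu> by (rule sigma_finite_levy_measure)
    have "{p :: real \<times> real. fst p < snd p} \<in> sets (borel \<Otimes>\<^sub>M borel)"
      unfolding borel_prod by (intro borel_open open_Collect_less continuous_intros)
    then have "{p. fst p < snd p} \<in> sets (borel \<Otimes>\<^sub>M \<nu>)"
      by (simp cong: sets_pair_measure_cong)
    then have "(\<lambda>y. emeasure \<nu> (Pair y -` {p. fst p < snd p})) \<in> borel_measurable borel"
      by (rule measurable_emeasure_Pair)
    moreover have "Pair y -` {p. fst p < snd p} = {y<..}" for y :: real by auto
    ultimately show ?thesis by simp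
  qed
  have I0: "0 \<le> I x" for x unfolding I_def by (rule integral_nonneg_AE) auto
  show "((\<lambda>x. x powr (a - 1) * I x) \<longlongrightarrow> c / (a - 1)) (at_right 0)"
  proof (rule tendstoI)
    fix e :: real assume e: "0 < e"
    \<comment> \<open>Integrating the tail divides by \<open>a - 1\<close>, so this choice leaves an
      error of exactly \<open>e / 2\<close>.\<close>
    define \<eta> where "\<eta> = e * (a - 1) / 2"
    have \<eta>: "0 < \<eta>" using e a by (simp add: \<eta>_def)
    from tendstoD[OF tail \<eta>] obtain d where d: "0 < d"
      and dd: "\<And>y. 0 < y \<Longrightarrow> y < d \<Longrightarrow> \<bar>y powr a * measure \<nu> {y<..} - c\<bar> < \<eta>"
      by (auto simp: eventually_at_right_field dist_real_def)
    have up: "measure \<nu> {y<..} \<le> (c + \<eta>) * y powr (- a)" if "0 < y" "y < d" for y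
      using dd[OF that] that by (auto simp: powr_minus field_simps abs_less_iff)
    have lo: "c * y powr (- a) \<le> measure \<nu> {y<..} + \<eta> * y powr (- a)" if "0 < y" "y < d" for y
      using dd[OF that] that by (auto simp: powr_minus field_simps abs_less_iff)
    \<comment> \<open>Strictly inside the range of the tail estimates, so that they still hold at
      \<open>d2\<close> itself.\<close>
    define d2 where "d2 = d / 2"
    have d2: "0 < d2" "d2 < d" using d by (auto simp: d2_def)
    \<comment> \<open>Everything beyond \<open>d2\<close>, the true integral and the model integral
      together; only its independence of \<open>x\<close> matters.\<close>
    define K where "K = I d2 + c * (d2 powr (1 - a) / (a - 1))"
    have K: "0 \<le> K" using I0 c a by (simp add: K_def)
    have main: "\<bar>x powr (a - 1) * I x - c / (a - 1)\<bar> \<le> \<eta> / (a - 1) + K * x powr (a - 1)"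
      if x: "0 < x" "x < d2" for x
    proof -
      have em_mult: "ennreal p * ennreal (y powr (1 - a) / (a - 1)) = ennreal (p * (y powr (1 - a) / (a - 1)))"
        if "0 \<le> p" for p y using that a by (intro ennreal_mult[symmetric]) auto
      have xp: "x powr (a - 1) * x powr (1 - a) = 1" using x by (simp flip: powr_add)
      have "ennreal (I x) \<le> (\<integral>\<^sup>+y. ennreal (c + \<eta>) * (ennreal (y powr (- a)) * indicator {x<..} y)
           + emeasure \<nu> {y<..} * indicator {d2<..} y \<partial>lborel)"
        unfolding lc[OF x(1)]
      proof (intro nn_integral_mono)
        fix y
        show "emeasure \<nu> {y<..} * indicator {x<..} y \<le> ennreal (c + \<eta>) * (ennreal (y powr (- a)) * indicator {x<..} y)
           + emeasure \<nu> {y<..} * indicator {d2<..} y"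
        proof (cases "x < y \<and> y \<le> d2")
          case True
          then have "measure \<nu> {y<..} \<le> (c + \<eta>) * y powr (- a)" using x d2 by (intro up) auto
          then have "ennreal (measure \<nu> {y<..}) \<le> ennreal ((c + \<eta>) * y powr (- a))" by (rule ennreal_leI)
          also have "\<dots> = ennreal (c + \<eta>) * ennreal (y powr (- a))" using c \<eta> by (intro ennreal_mult) auto
          finally show ?thesis using True x em[of y] by (simp del: ennreal_plus)
        next
          case False
          then show ?thesis using x by (auto simp: indicator_def add_increasing)
        qed
      qed
      also have "\<dots> = ennreal (c + \<eta>) * ennreal (x powr (1 - a) / (a - 1)) + ennreal (I d2)"
        using a x by (simp add: nn_integral_add nn_integral_cmult nn_integral_powr_Ioi lc[OF d2(1)])
      also have "ennreal (c + \<eta>) * ennreal (x powr (1 - a) / (a - 1)) = ennreal ((c + \<eta>) * (x powr (1 - a) / (a - 1)))"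
        using c \<eta> a by (intro ennreal_mult[symmetric]) auto
      also have "\<dots> + ennreal (I d2) = ennreal ((c + \<eta>) * (x powr (1 - a) / (a - 1)) + I d2)"
        using c \<eta> a I0 by (intro ennreal_plus[symmetric]) auto
      finally have 1: "I x \<le> (c + \<eta>) * (x powr (1 - a) / (a - 1)) + I d2"
        using c \<eta> a I0[of d2] by (subst (asm) ennreal_le_iff) (auto intro!: add_nonneg_nonneg mult_nonneg_nonneg)
      have "ennreal c * ennreal (x powr (1 - a) / (a - 1)) = (\<integral>\<^sup>+y. ennreal c * (ennreal (y powr (- a)) * indicator {x<..} y) \<partial>lborel)"
        using a x by (simp add: nn_integral_cmult nn_integral_powr_Ioi)
      \<comment> \<open>The lower bound is arranged without subtraction of extended nonnegative
        numbers: the error and the model beyond \<open>d2\<close> stand on the right.\<close>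
      also have "\<dots> \<le> (\<integral>\<^sup>+y. (emeasure \<nu> {y<..} * indicator {x<..} y + ennreal \<eta> * (ennreal (y powr (- a)) * indicator {x<..} y))
          + ennreal c * (ennreal (y powr (- a)) * indicator {d2<..} y) \<partial>lborel)"
      proof (intro nn_integral_mono)
        fix y
        show "ennreal c * (ennreal (y powr (- a)) * indicator {x<..} y) \<le>
          (emeasure \<nu> {y<..} * indicator {x<..} y + ennreal \<eta> * (ennreal (y powr (- a)) * indicator {x<..} y))
          + ennreal c * (ennreal (y powr (- a)) * indicator {d2<..} y)"
        proof (cases "x < y \<and> y \<le> d2")
          case True
          then have "c * y powr (- a) \<le> measure \<nu> {y<..} + \<eta> * y powr (- a)" using x d2 by (intro lo) auto
          then have "ennreal (c * y powr (- a)) \<le> ennreal (measure \<nu> {y<..} + \<eta> * y powr (- a))" by (rule ennreal_leI)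
          then show ?thesis using True x c \<eta> em[of y] by (simp add: ennreal_mult ennreal_plus)
        next
          case False
          then show ?thesis using x by (auto simp: indicator_def add_increasing)
        qed
      qed
      also have "\<dots> = ennreal (I x) + ennreal \<eta> * ennreal (x powr (1 - a) / (a - 1)) + ennreal c * ennreal (d2 powr (1 - a) / (a - 1))"
        using a x d2 by (simp add: nn_integral_add nn_integral_cmult nn_integral_powr_Ioi lc[OF x(1)])
      also have "\<dots> = ennreal (I x + \<eta> * (x powr (1 - a) / (a - 1)) + c * (d2 powr (1 - a) / (a - 1)))"
        using c \<eta> a I0 by (simp add: ennreal_plus em_mult)
      finally have "ennreal (c * (x powr (1 - a) / (a - 1))) \<le> ennreal (I x + \<eta> * (x powr (1 - a) / (a - 1)) + c * (d2 powr (1 - a) / (a - 1)))"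
        using c a by (simp only: em_mult[OF c])
      then have 2: "c * (x powr (1 - a) / (a - 1)) \<le> I x + \<eta> * (x powr (1 - a) / (a - 1)) + c * (d2 powr (1 - a) / (a - 1))"
        using c \<eta> a I0[of x] by (subst (asm) ennreal_le_iff) (auto intro!: add_nonneg_nonneg mult_nonneg_nonneg)
      have "\<bar>I x - c * (x powr (1 - a) / (a - 1))\<bar> \<le> \<eta> * (x powr (1 - a) / (a - 1)) + K"
      proof -
        have "\<bar>i - c * q\<bar> \<le> \<eta> * q + (i2 + c * q2)"
          if "i \<le> (c + \<eta>) * q + i2" "c * q \<le> i + \<eta> * q + c * q2" "0 \<le> i2" "0 \<le> c * q2" for i i2 q q2
          using that by (simp add: abs_le_iff distrib_right)
        from this[OF 1 2 I0] show ?thesis using c a by (simp add: K_def)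
      qed
      then have "x powr (a - 1) * \<bar>I x - c * (x powr (1 - a) / (a - 1))\<bar> \<le> x powr (a - 1) * (\<eta> * (x powr (1 - a) / (a - 1)) + K)"
        by (intro mult_left_mono) auto
      moreover have "x powr (a - 1) * \<bar>I x - c * (x powr (1 - a) / (a - 1))\<bar> =
         \<bar>x powr (a - 1) * (I x - c * (x powr (1 - a) / (a - 1)))\<bar>"
        by (simp only: abs_mult abs_of_nonneg[OF powr_ge_zero])
      moreover have "x powr (a - 1) * (I x - c * (x powr (1 - a) / (a - 1))) =
         x powr (a - 1) * I x - c * (x powr (a - 1) * x powr (1 - a)) / (a - 1)"
        by (simp add: right_diff_distrib)
      moreover have "x powr (a - 1) * (\<eta> * (x powr (1 - a) / (a - 1)) + K) =
         \<eta> * (x powr (a - 1) * x powr (1 - a)) / (a - 1) + K * x powr (a - 1)"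
        by (simp add: distrib_left)
      ultimately show ?thesis by (simp add: xp)
    qed
    have "((\<lambda>x. K * x powr (a - 1)) \<longlongrightarrow> K * 0) (at_right 0)"
    proof (intro tendsto_intros)
      have "((\<lambda>x::real. x powr (a - 1)) \<longlongrightarrow> 0 powr (a - 1)) (at_right 0)"
        using a by (intro tendsto_powr2) (auto intro!: tendsto_intros eventually_at_right_less simp: eventually_at_filter)
      then show "((\<lambda>x::real. x powr (a - 1)) \<longlongrightarrow> 0) (at_right 0)" by simp
    qed
    then have "eventually (\<lambda>x. K * x powr (a - 1) < e / 2) (at_right 0)"
      using e by (intro order_tendstoD) auto
    moreover have "eventually (\<lambda>x. 0 < x \<and> x < d2) (at_right 0)"
      using d2(1) by (auto simp: eventually_at_right_field)
    ultimately show "eventually (\<lambda>x. dist (x powr (a - 1) * I x) (c / (a - 1)) < e) (at_right 0)"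
    proof eventually_elim
      case (elim x)
      have "\<eta> / (a - 1) = e / 2" using a by (simp add: \<eta>_def field_simps)
      then show ?case using main[of x] elim by (simp add: dist_real_def)
    qed
  qed
qed

section \<open>Decomposition at a truncation level\<close>

lemma integrable_levy_indicator:
  assumes \<nu>: "levy_measure \<nu>" and A: "A \<in> sets borel" "A \<subseteq> {z. x < \<bar>z\<bar>}" "0 < x"
  shows "integrable \<nu> (indicator A :: real \<Rightarrow> real)"
  using fmeasurable_levy_measure[OF \<nu> A] by (simp add: integrable_indicator_iff fmeasurable_def)

text \<open>An image of the standard normal law rather than a density, so that \<open>s = 0\<close>
  is the point mass at \<open>d\<close> and negative \<open>s\<close> is allowed too.\<close>

definition gauss_law :: "real \<Rightarrow> real \<Rightarrow> real measure" where
  "gauss_law s d = distr std_normal_distribution borel (\<lambda>x. s * x + d)"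

lemma real_distribution_gauss_law: "real_distribution (gauss_law s d)"
  unfolding gauss_law_def by (intro std_normal.real_distribution_distr) auto

lemma char_gauss_law: "char (gauss_law s d) u = exp (\<i> * of_real (u * d) - of_real (s\<^sup>2 * u\<^sup>2 / 2))"
proof -
  have "char (gauss_law s d) u = (\<integral>x. iexp (u * d) * iexp ((s * u) * x) \<partial>std_normal_distribution)"
    unfolding gauss_law_def char_def
    by (subst integral_distr) (auto intro!: Bochner_Integration.integral_cong simp: algebra_simps mult_exp_exp)
  also have "\<dots> = iexp (u * d) * char std_normal_distribution (s * u)"
    unfolding char_def by (rule integral_mult_right_zero)
  also have "\<dots> = iexp (u * d) * of_real (exp (- ((s * u)\<^sup>2) / 2))"
    by (simp add: char_std_normal_distribution)
  also have "\<dots> = exp (\<i> * of_real (u * d) - of_real (s\<^sup>2 * u\<^sup>2 / 2))"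
    unfolding exp_of_real[symmetric] mult_exp_exp by (simp add: power_mult_distrib)
  finally show ?thesis .
qed

lemma nn_integral_exp_gauss_law:
  "mgf (gauss_law s d) \<theta> = ennreal (exp (\<theta> * d + \<theta>\<^sup>2 * s\<^sup>2 / 2))"
proof -
  have "mgf (gauss_law s d) \<theta> =
     (\<integral>\<^sup>+x. ennreal (std_normal_density x) * ennreal (exp (\<theta> * (s * x + d))) \<partial>lborel)"
    unfolding gauss_law_def by (simp add: nn_integral_distr nn_integral_density)
  also have "\<dots> = (\<integral>\<^sup>+x. ennreal (exp (\<theta> * d + \<theta>\<^sup>2 * s\<^sup>2 / 2)) * ennreal (normal_density (\<theta> * s) 1 x) \<partial>lborel)"
  proof (intro nn_integral_cong)
    fix x
    have "std_normal_density x * exp (\<theta> * (s * x + d)) = exp (\<theta> * d + \<theta>\<^sup>2 * s\<^sup>2 / 2) * normal_density (\<theta> * s) 1 x"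
      unfolding normal_density_def by (simp add: mult_exp_exp) (simp add: power2_eq_square field_simps)
    then show "ennreal (std_normal_density x) * ennreal (exp (\<theta> * (s * x + d))) =
      ennreal (exp (\<theta> * d + \<theta>\<^sup>2 * s\<^sup>2 / 2)) * ennreal (normal_density (\<theta> * s) 1 x)"
      by (simp flip: ennreal_mult)
  qed
  also have "\<dots> = ennreal (exp (\<theta> * d + \<theta>\<^sup>2 * s\<^sup>2 / 2))"
    by (subst nn_integral_cmult) (simp_all add: nn_integral_eq_integral)
  finally show ?thesis .
qed

text \<open>The time \<open>t\<close> is part of the intensity, so that
  \<open>compound_poisson\<close> of it is directly the law at time \<open>t\<close> of the jumps
  beyond \<open>h\<close>.\<close>

definition big_jumps :: "real \<Rightarrow> real \<Rightarrow> real measure \<Rightarrow> real measure" where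
  "big_jumps t h \<nu> = density \<nu> (\<lambda>z. ennreal (t * indicator {z. h < \<bar>z\<bar>} z))"

lemma emeasure_big_jumps:
  assumes \<nu>: "levy_measure \<nu>" and t: "0 \<le> t" and h: "0 < h"
  shows "emeasure (big_jumps t h \<nu>) UNIV = ennreal (t * measure \<nu> {z. h < \<bar>z\<bar>})"
proof -
  have [simp, measurable_cong]: "sets \<nu> = sets borel" using \<nu> by (rule sets_levy_measure)
  have "emeasure (big_jumps t h \<nu>) UNIV = (\<integral>\<^sup>+z. ennreal t * indicator {z. h < \<bar>z\<bar>} z \<partial>\<nu>)"
    unfolding big_jumps_def using t
    by (subst emeasure_density) (auto intro!: nn_integral_cong simp: indicator_def)
  also have "\<dots> = ennreal t * emeasure \<nu> {z. h < \<bar>z\<bar>}"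
    by (rule nn_integral_cmult_indicator) simp
  also have "emeasure \<nu> {z. h < \<bar>z\<bar>} = ennreal (measure \<nu> {z. h < \<bar>z\<bar>})"
    by (intro emeasure_eq_measure2 fmeasurable_levy_measure[OF \<nu> _ _ h]) auto
  finally show ?thesis using t by (simp add: ennreal_mult)
qed

lemma jump_intensity_big_jumps:
  assumes \<nu>: "levy_measure \<nu>" and t: "0 \<le> t" and h: "0 < h"
  shows "jump_intensity (big_jumps t h \<nu>)"
proof (intro jump_intensity.intro finite_measureI jump_intensity_axioms.intro)
  have [simp]: "space (big_jumps t h \<nu>) = UNIV" by (simp add: big_jumps_def space_levy_measure[OF \<nu>])
  show "emeasure (big_jumps t h \<nu>) (space (big_jumps t h \<nu>)) \<noteq> \<infinity>"
    by (simp add: emeasure_big_jumps[OF assms])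
  show "sets (big_jumps t h \<nu>) = sets borel"
    by (simp add: big_jumps_def sets_levy_measure[OF \<nu>])
qed

lemma measure_big_jumps:
  assumes "levy_measure \<nu>" "0 \<le> t" "0 < h"
  shows "measure (big_jumps t h \<nu>) UNIV = t * measure \<nu> {z. h < \<bar>z\<bar>}"
  using emeasure_big_jumps[OF assms] assms(2) by (simp add: measure_def)

text \<open>The compensation is moved from the level 1 to the level \<open>h\<close>. Jumps between
  \<open>h\<close> and 1 thereby lose their compensator, and their mean is subtracted from the
  drift.\<close>

lemma levy_exponent_split:
  assumes \<nu>: "levy_measure \<nu>" and h: "0 < h" "h \<le> 1"
  shows "levy_exponent s2 \<nu> \<gamma> u =
     \<i> * of_real (u * (\<gamma> - (\<integral>z. z * indicator ({- 1..1} - {- h..h}) z \<partial>\<nu>))) - of_real (s2 * u\<^sup>2 / 2)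
     + (\<integral>z. indicator {- h..h} z *\<^sub>R comp_iexp u z \<partial>\<nu>)
     + (\<integral>z. indicator {z. h < \<bar>z\<bar>} z *\<^sub>R (iexp (u * z) - 1) \<partial>\<nu>)"
proof -
  have [simp, measurable_cong]: "sets \<nu> = sets borel" using \<nu> by (rule sets_levy_measure)
  let ?s = "\<lambda>z. indicator {- h..h} z *\<^sub>R comp_iexp u z"
  let ?b = "\<lambda>z. indicator {z. h < \<bar>z\<bar>} z *\<^sub>R (iexp (u * z) - 1)"
  let ?m = "\<lambda>z. z * indicator ({- 1..1} - {- h..h}) z"
  have ind: "integrable \<nu> (indicator {z. h < \<bar>z\<bar>} :: real \<Rightarrow> real)"
    by (rule integrable_levy_indicator[OF \<nu> _ _ h(1)]) auto
  have int_s: "integrable \<nu> ?s"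
  proof (rule Bochner_Integration.integrable_bound)
    show "integrable \<nu> (\<lambda>z. u\<^sup>2 * min 1 (z\<^sup>2))" using \<nu> by (simp add: levy_measure_def)
    have "norm (?s z) \<le> norm (u\<^sup>2 * min 1 (z\<^sup>2))" for z
    proof (cases "z \<in> {- h..h}")
      case True
      then have "\<bar>z\<bar> \<le> 1" using h by auto
      then have "z\<^sup>2 \<le> 1" by (simp add: abs_square_le_1)
      then show ?thesis using norm_iexp_compensated_le[of "u * z"] True
        by (simp add: power_mult_distrib min_def abs_mult del: of_real_mult)
    qed simp
    then show "AE z in \<nu>. norm (?s z) \<le> norm (u\<^sup>2 * min 1 (z\<^sup>2))" by simp
  qed simp
  have ib: "integrable \<nu> ?b"
  proof (rule Bochner_Integration.integrable_bound)
    show "integrable \<nu> (\<lambda>z. 2 * indicator {z. h < \<bar>z\<bar>} z :: real)" using ind by simp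
    have "norm (iexp (u * z) - 1) \<le> 2" for z
      using norm_triangle_ineq4[of "iexp (u * z)" 1] by simp
    then show "AE z in \<nu>. norm (?b z) \<le> norm (2 * indicator {z. h < \<bar>z\<bar>} z :: real)"
      by (auto simp: indicator_def)
  qed simp
  have im: "integrable \<nu> ?m"
  proof (rule Bochner_Integration.integrable_bound[OF ind])
    show "AE z in \<nu>. norm (?m z) \<le> norm (indicator {z. h < \<bar>z\<bar>} z :: real)"
      by (auto simp: indicator_def)
  qed simp
  have "(\<integral>z. iexp (u * z) - 1 - \<i> * complex_of_real (u * z * indicator {-1..1} z) \<partial>\<nu>) =
     (\<integral>z. (?s z + ?b z) - (\<i> * of_real u) * complex_of_real (?m z) \<partial>\<nu>)"
  proof (intro Bochner_Integration.integral_cong refl)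
    fix z
    consider "z \<in> {- h..h}" | "z \<notin> {- h..h}" "z \<in> {- 1..1}" | "z \<notin> {- 1..1}" by blast
    then show "iexp (u * z) - 1 - \<i> * complex_of_real (u * z * indicator {-1..1} z) =
       (?s z + ?b z) - (\<i> * of_real u) * complex_of_real (?m z)"
      by cases (use h in \<open>auto simp: indicator_def\<close>)
  qed
  also have "\<dots> = (\<integral>z. ?s z \<partial>\<nu>) + (\<integral>z. ?b z \<partial>\<nu>) - (\<i> * of_real u) * of_real (\<integral>z. ?m z \<partial>\<nu>)"
    using int_s ib im
    by (subst Bochner_Integration.integral_diff)
       (auto simp: integral_mult_right_zero simp del: of_real_mult)
  finally show ?thesis
    unfolding levy_exponent_def by (simp add: algebra_simps)
qed

text \<open>The Levy-Ito decomposition at the level of a single law: each summand of the split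
  exponent is the logarithm of the characteristic function of an explicit law, and a law is
  determined by its characteristic function. Of the small jumps only a bound on the exponential
  moments is exported, obtained from
  \<open>exp y - 1 - y \<le> y\<^sup>2 * exp \<bar>y\<bar>\<close>.\<close>

lemma levy_decomposition:
  assumes \<nu>: "levy_measure \<nu>" and \<mu>: "real_distribution \<mu>"
    and ch: "\<And>u. char \<mu> u = exp (complex_of_real t * levy_exponent (\<sigma>\<^sup>2) \<nu> \<gamma> u)"
    and t: "0 < t" and h: "0 < h" "h \<le> 1"
  defines "d \<equiv> t * (\<gamma> - (\<integral>z. z * indicator ({- 1..1} - {- h..h}) z \<partial>\<nu>))"
  obtains S where "real_distribution S"
    "\<And>\<theta>. mgf S \<theta> \<le>
        ennreal (exp (t * \<theta>\<^sup>2 * exp (\<bar>\<theta>\<bar> * h) * (\<integral>z. z\<^sup>2 * indicator {- h..h} z \<partial>\<nu>)))"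
    "\<mu> = ((gauss_law (\<sigma> * sqrt t) d \<star> S) \<star> compound_poisson (big_jumps t h \<nu>))"
proof -
  have [simp, measurable_cong]: "sets \<nu> = sets borel" using \<nu> by (rule sets_levy_measure)
  interpret J: jump_intensity "big_jumps t h \<nu>"
    by (rule jump_intensity_big_jumps) (use \<nu> t h in auto)
  define \<kappa> where "\<kappa> = density \<nu> (\<lambda>z. ennreal (t * indicator {- h..h} z))"
  have s\<kappa>: "sets \<kappa> = sets borel" by (simp add: \<kappa>_def)
  have i2: "integrable \<nu> (\<lambda>z. z\<^sup>2 * indicator {- h..h} z)"
  proof (rule Bochner_Integration.integrable_bound)
    show "integrable \<nu> (\<lambda>z. min 1 (z\<^sup>2))" using \<nu> by (simp add: levy_measure_def)
    have "norm (z\<^sup>2 * indicator {- h..h} z) \<le> norm (min 1 (z\<^sup>2))" for z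
    proof (cases "z \<in> {- h..h}")
      case True
      then have "\<bar>z\<bar> \<le> 1" using h by auto
      then have "z\<^sup>2 \<le> 1" by (simp add: abs_square_le_1)
      then show ?thesis using True by simp
    qed simp
    then show "AE z in \<nu>. norm (z\<^sup>2 * indicator {- h..h} z) \<le> norm (min 1 (z\<^sup>2))" by simp
  qed simp
  define V where "V = (\<integral>z. z\<^sup>2 * indicator {- h..h} z \<partial>\<nu>)"
  have i\<kappa>: "integrable \<kappa> (\<lambda>z. z\<^sup>2)"
    unfolding \<kappa>_def using t integrable_mult_right[OF i2, of t]
    by (subst integrable_density) (auto simp: mult_ac)
  have bdd: "AE z in \<kappa>. \<bar>z\<bar> \<le> h"
    unfolding \<kappa>_def by (subst AE_density) (auto simp: indicator_def)
  obtain S where S: "real_distribution S"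
    and chS: "\<And>u. char S u = exp (\<integral>z. comp_iexp u z \<partial>\<kappa>)"
    and mgf: "\<And>\<theta>. mgf S \<theta> \<le> ennreal (exp (\<integral>z. (exp (\<theta> * z) - 1 - \<theta> * z) \<partial>\<kappa>))"
    using compensated_jumps_exist[OF s\<kappa> i\<kappa> bdd] by blast
  have G: "real_distribution (gauss_law (\<sigma> * sqrt t) d)" by (rule real_distribution_gauss_law)
  show thesis
  proof (rule that[OF S])
    fix \<theta>
    have "(\<integral>z. (exp (\<theta> * z) - 1 - \<theta> * z) \<partial>\<kappa>) = (\<integral>z. t * indicator {- h..h} z * (exp (\<theta> * z) - 1 - \<theta> * z) \<partial>\<nu>)"
      unfolding \<kappa>_def using t by (subst integral_density) (auto simp: mult.assoc)
    also have "\<dots> \<le> (\<integral>z. (t * \<theta>\<^sup>2 * exp (\<bar>\<theta>\<bar> * h)) * (z\<^sup>2 * indicator {- h..h} z) \<partial>\<nu>)"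
    proof (rule integral_mono_AE')
      show "integrable \<nu> (\<lambda>z. (t * \<theta>\<^sup>2 * exp (\<bar>\<theta>\<bar> * h)) * (z\<^sup>2 * indicator {- h..h} z))"
        using i2 by (rule integrable_mult_right)
      have "t * indicator {- h..h} z * (exp (\<theta> * z) - 1 - \<theta> * z) \<le> (t * \<theta>\<^sup>2 * exp (\<bar>\<theta>\<bar> * h)) * (z\<^sup>2 * indicator {- h..h} z)" for z
      proof (cases "z \<in> {- h..h}")
        case True
        then have zh: "\<bar>z\<bar> \<le> h" by auto
        have "exp (\<theta> * z) - 1 - \<theta> * z \<le> (\<theta> * z)\<^sup>2 * exp \<bar>\<theta> * z\<bar>"
          by (rule exp_minus_one_minus_bounds)
        also have "\<dots> \<le> (\<theta> * z)\<^sup>2 * exp (\<bar>\<theta>\<bar> * h)"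
          using zh by (intro mult_left_mono) (auto simp: abs_mult mult_left_mono)
        finally have "t * (exp (\<theta> * z) - 1 - \<theta> * z) \<le> t * ((\<theta> * z)\<^sup>2 * exp (\<bar>\<theta>\<bar> * h))"
          using t by (intro mult_left_mono) auto
        then show ?thesis using True by (simp add: power_mult_distrib mult_ac)
      qed simp
      then show "AE z in \<nu>. t * indicator {- h..h} z * (exp (\<theta> * z) - 1 - \<theta> * z) \<le> (t * \<theta>\<^sup>2 * exp (\<bar>\<theta>\<bar> * h)) * (z\<^sup>2 * indicator {- h..h} z)"
        by simp
      show "AE z in \<nu>. 0 \<le> (t * \<theta>\<^sup>2 * exp (\<bar>\<theta>\<bar> * h)) * (z\<^sup>2 * indicator {- h..h} z)"
        using t by simp
    qed
    also have "\<dots> = t * \<theta>\<^sup>2 * exp (\<bar>\<theta>\<bar> * h) * V" unfolding V_def by (rule integral_mult_right_zero)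
    finally show "mgf S \<theta> \<le>
        ennreal (exp (t * \<theta>\<^sup>2 * exp (\<bar>\<theta>\<bar> * h) * (\<integral>z. z\<^sup>2 * indicator {- h..h} z \<partial>\<nu>)))"
      using mgf[of \<theta>] unfolding V_def by (auto intro: order_trans ennreal_leI)
  next
    show "\<mu> = ((gauss_law (\<sigma> * sqrt t) d \<star> S) \<star> compound_poisson (big_jumps t h \<nu>))"
    proof (rule Levy_uniqueness[OF \<mu>])
      show "real_distribution ((gauss_law (\<sigma> * sqrt t) d \<star> S) \<star> compound_poisson (big_jumps t h \<nu>))"
        by (intro real_distribution_convolution G S J.real_distribution_compound_poisson)
      show "char \<mu> = char ((gauss_law (\<sigma> * sqrt t) d \<star> S) \<star> compound_poisson (big_jumps t h \<nu>))"
      proof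
        fix u
        have 1: "(\<integral>z. comp_iexp u z \<partial>\<kappa>) =
          of_real t * (\<integral>z. indicator {- h..h} z *\<^sub>R comp_iexp u z \<partial>\<nu>)"
          unfolding \<kappa>_def using t
          by (subst integral_density) (auto simp flip: integral_mult_right_zero simp: scaleR_conv_of_real mult.assoc)
        have 2: "(\<integral>z. (iexp (u * z) - 1) \<partial>big_jumps t h \<nu>) =
          of_real t * (\<integral>z. indicator {z. h < \<bar>z\<bar>} z *\<^sub>R (iexp (u * z) - 1) \<partial>\<nu>)"
          unfolding big_jumps_def using t
          by (subst integral_density) (auto simp flip: integral_mult_right_zero simp: scaleR_conv_of_real mult.assoc)
        have "char ((gauss_law (\<sigma> * sqrt t) d \<star> S) \<star> compound_poisson (big_jumps t h \<nu>)) u =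
          exp (\<i> * of_real (u * d) - of_real ((\<sigma> * sqrt t)\<^sup>2 * u\<^sup>2 / 2)) *
          exp (of_real t * (\<integral>z. indicator {- h..h} z *\<^sub>R comp_iexp u z \<partial>\<nu>)) *
          exp (of_real t * (\<integral>z. indicator {z. h < \<bar>z\<bar>} z *\<^sub>R (iexp (u * z) - 1) \<partial>\<nu>))"
          by (simp only: char_convolution G S real_distribution_convolution J.real_distribution_compound_poisson
              char_gauss_law chS J.char_compound_poisson 1 2)
        also have "\<dots> = char \<mu> u"
          unfolding ch levy_exponent_split[OF \<nu> h] mult_exp_exp d_def using t
          by (intro arg_cong[where f=exp]) (simp add: algebra_simps power_mult_distrib)
        finally show "char \<mu> u = char ((gauss_law (\<sigma> * sqrt t) d \<star> S) \<star> compound_poisson (big_jumps t h \<nu>)) u" ..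
      qed
    qed
  qed
qed

section \<open>Splitting off one big jump\<close>

lemma convolution_commutative_distr:
  assumes "real_distribution M" "real_distribution N"
  shows "(M \<star> N) = (N \<star> M)"
proof -
  interpret M: real_distribution M by fact
  interpret N: real_distribution N by fact
  show ?thesis
    by (rule convolution_commutative) (auto intro: M.finite_measure_axioms N.finite_measure_axioms)
qed

lemma measurable_gauss_call [measurable]: "gauss_call s \<in> borel_measurable borel"
proof -
  have "mono (\<lambda>y. gauss_call s (- y))" by (auto simp: mono_def intro: gauss_call_antimono)
  then have "(\<lambda>y. gauss_call s (- y)) \<in> borel_measurable borel" by (rule borel_measurable_mono)
  then have "(\<lambda>y. gauss_call s (- (- y))) \<in> borel_measurable borel" by measurable
  then show ?thesis by simp
qed

lemma integrable_gauss_call_shift: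
  assumes S: "real_distribution S" and iS: "integrable S (\<lambda>x. x)"
  shows "integrable S (\<lambda>x. gauss_call s (a - x))"
proof -
  interpret S: real_distribution S by fact
  show ?thesis
  proof (rule Bochner_Integration.integrable_bound)
    show "integrable S (\<lambda>x. gauss_call s a + \<bar>x\<bar>)" using iS by auto
    have "norm (gauss_call s (a - x)) \<le> norm (gauss_call s a + \<bar>x\<bar>)" for x
      using gauss_call_lipschitz[of s "a - x" a] gauss_call_nonneg[of s] by (smt (verit) real_norm_def)
    then show "AE x in S. norm (gauss_call s (a - x)) \<le> norm (gauss_call s a + \<bar>x\<bar>)" by simp
  qed simp
qed

lemma gauss_call_approx:
  assumes "0 \<le> s"
  shows "\<bar>gauss_call s y - max (- y) 0\<bar> \<le> s"
proof -
  have "\<bar>gauss_call s y - max (- y) 0\<bar> = \<bar>\<integral>x. (max (s * x - y) 0 - max (- y) 0) \<partial>std_normal_distribution\<bar>"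
    unfolding gauss_call_def using std_normal.prob_space by simp
  also have "\<dots> \<le> (\<integral>x. \<bar>max (s * x - y) 0 - max (- y) 0\<bar> \<partial>std_normal_distribution)"
    by (rule integral_abs_bound)
  also have "\<dots> \<le> (\<integral>x. s * \<bar>x\<bar> \<partial>std_normal_distribution)"
  proof (rule integral_mono)
    fix x :: real
    have "\<bar>s * x\<bar> = s * \<bar>x\<bar>" using assms by (simp add: abs_mult)
    then show "\<bar>max (s * x - y) 0 - max (- y) 0\<bar> \<le> s * \<bar>x\<bar>" by auto
  qed (use integrable_std_normal_id in \<open>auto intro!: integrable_abs Bochner_Integration.integrable_diff\<close>)
  also have "\<dots> \<le> s * 1" using mult_left_mono[OF std_normal_abs_le_1 assms] by simp
  finally show ?thesis by simp
qed

text \<open>The order of integration is chosen with the big jumps outermost and the Gaussian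
  variable innermost: the innermost integral is then a Gaussian price at a shifted strike.\<close>

lemma nn_integral_call_convolution:
  assumes S: "real_distribution S" and P: "real_distribution P" and iS: "integrable S (\<lambda>x. x)"
  shows "(\<integral>\<^sup>+x. ennreal (max (x - k) 0) \<partial>((gauss_law s d \<star> S) \<star> P)) =
    (\<integral>\<^sup>+y. ennreal (\<integral>x. gauss_call s (k - d - y - x) \<partial>S) \<partial>P)"
proof -
  note G = real_distribution_gauss_law[of s d]
  have "((gauss_law s d \<star> S) \<star> P) = (P \<star> (S \<star> gauss_law s d))"
    using convolution_commutative_distr real_distribution_convolution G S P by metis
  then have "(\<integral>\<^sup>+x. ennreal (max (x - k) 0) \<partial>((gauss_law s d \<star> S) \<star> P)) =
     (\<integral>\<^sup>+y. (\<integral>\<^sup>+r. ennreal (max (y + r - k) 0) \<partial>(S \<star> gauss_law s d)) \<partial>P)"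
    by (simp add: nn_integral_convolution_distr P S G real_distribution_convolution)
  also have "\<dots> = (\<integral>\<^sup>+y. ennreal (\<integral>x. gauss_call s (k - d - y - x) \<partial>S) \<partial>P)"
  proof (intro nn_integral_cong)
    fix y
    have "(\<integral>\<^sup>+r. ennreal (max (y + r - k) 0) \<partial>(S \<star> gauss_law s d)) =
       (\<integral>\<^sup>+x. (\<integral>\<^sup>+g. ennreal (max (y + (x + g) - k) 0) \<partial>gauss_law s d) \<partial>S)"
      by (simp add: nn_integral_convolution_distr S G)
    also have "\<dots> = (\<integral>\<^sup>+x. ennreal (gauss_call s (k - d - y - x)) \<partial>S)"
    proof (intro nn_integral_cong)
      fix x
      show "(\<integral>\<^sup>+g. ennreal (max (y + (x + g) - k) 0) \<partial>gauss_law s d) = ennreal (gauss_call s (k - d - y - x))"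
        unfolding gauss_law_def nn_integral_gauss_call[symmetric]
        by (subst nn_integral_distr) (auto simp: algebra_simps)
    qed
    also have "\<dots> = ennreal (\<integral>x. gauss_call s (k - d - y - x) \<partial>S)"
      by (rule nn_integral_eq_integral) (auto intro: integrable_gauss_call_shift S iS gauss_call_nonneg)
    finally show "(\<integral>\<^sup>+r. ennreal (max (y + r - k) 0) \<partial>(S \<star> gauss_law s d)) = \<dots>" .
  qed
  finally show ?thesis .
qed

text \<open>Given that the big jumps sum to \<open>y\<close>, the price is a monotone 1-Lipschitz
  function \<open>\<phi> y\<close>, so the one-jump bounds for compound Poisson laws apply to
  \<open>\<phi>\<close>. Without big jumps it is \<open>U\<close>. After a jump \<open>z\<close> it
  differs from the intrinsic value \<open>max (z - k) 0\<close> by at most \<open>r\<close>, a bound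
  for the mean absolute size of everything else; this is paid once for each positive big jump, which
  gives \<open>t * (r * m)\<close>. The last term of the upper bound accounts for further jumps, the
  factor \<open>exp (- l)\<close> of the lower one for their absence.\<close>

lemma call_price_sandwich:
  assumes \<nu>: "levy_measure \<nu>" and S: "real_distribution S" and iS: "integrable S (\<lambda>x. x)"
    and t: "0 \<le> t" and h: "0 < h" "h \<le> k" and s: "0 \<le> s"
    and fin: "\<And>x. 0 < x \<Longrightarrow> integrable \<nu> (\<lambda>z. max (z - x) 0)"
    and \<mu>: "\<mu> = ((gauss_law s d \<star> S) \<star> compound_poisson (big_jumps t h \<nu>))"
  defines "U \<equiv> (\<integral>x. gauss_call s (k - d - x) \<partial>S)" and "r \<equiv> s + \<bar>d\<bar> + (\<integral>x. \<bar>x\<bar> \<partial>S)"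
    and "I \<equiv> \<lambda>x. \<integral>z. max (z - x) 0 \<partial>\<nu>" and "l \<equiv> t * measure \<nu> {z. h < \<bar>z\<bar>}" and "m \<equiv> measure \<nu> {h<..}"
    and "T \<equiv> \<integral>x. max (x - k) 0 \<partial>\<mu>"
  shows "T \<le> U + t * (I k + r * m) + l * (t * (I h + h * m))"
    and "exp (- l) * (U + t * I k) \<le> T + t * (r * m)"
proof -
  have [simp, measurable_cong]: "sets \<nu> = sets borel" using \<nu> by (rule sets_levy_measure)
  interpret S: real_distribution S by fact
  interpret J: jump_intensity "big_jumps t h \<nu>"
    by (rule jump_intensity_big_jumps) (use \<nu> t h in auto)
  interpret P: real_distribution "compound_poisson (big_jumps t h \<nu>)" by (rule J.real_distribution_compound_poisson)
  have rd\<mu>: "real_distribution \<mu>" unfolding \<mu>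
    by (intro real_distribution_convolution real_distribution_gauss_law S P.real_distribution_axioms)
  interpret \<mu>: real_distribution \<mu> by fact
  define \<phi> where "\<phi> y = (\<integral>x. gauss_call s (k - d - y - x) \<partial>S)" for y
  have int\<phi>: "integrable S (\<lambda>x. gauss_call s (k - d - y - x))" for y
    by (rule integrable_gauss_call_shift[OF S iS])
  have \<phi>0: "\<phi> 0 = U" by (simp add: \<phi>_def U_def)
  have \<phi>nn: "0 \<le> \<phi> y" for y unfolding \<phi>_def by (rule integral_nonneg_AE) (simp add: gauss_call_nonneg)
  have \<phi>mono: "mono \<phi>"
    unfolding mono_def \<phi>_def by (intro allI impI integral_mono int\<phi> gauss_call_antimono) auto
  note [measurable] = borel_measurable_mono[OF \<phi>mono]
  have \<phi>lip: "\<phi> y \<le> \<phi> x + (y - x)" if "x \<le> y" for x y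
  proof -
    have "\<phi> y \<le> (\<integral>z. gauss_call s (k - d - x - z) + (y - x) \<partial>S)"
      unfolding \<phi>_def
    proof (intro integral_mono int\<phi> Bochner_Integration.integrable_add)
      fix z
      show "gauss_call s (k - d - y - z) \<le> gauss_call s (k - d - x - z) + (y - x)"
        using gauss_call_lipschitz[of s "k - d - y - z" "k - d - x - z"] that by simp
    qed auto
    also have "\<dots> = \<phi> x + (y - x)"
      unfolding \<phi>_def using int\<phi> S.prob_space by (subst Bochner_Integration.integral_add) auto
    finally show ?thesis .
  qed
  \<comment> \<open>The Gaussian variable contributes at most \<open>s\<close>, since its first
    absolute moment is at most \<open>s\<close>; drift and small jumps enter through the Lipschitz
    property.\<close>
  have \<phi>approx: "\<bar>\<phi> z - max (z - k) 0\<bar> \<le> r" for z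
  proof -
    have "\<phi> z - max (z - k) 0 = (\<integral>x. (gauss_call s (k - d - z - x) - max (z - k) 0) \<partial>S)"
      unfolding \<phi>_def using int\<phi> S.prob_space by (subst Bochner_Integration.integral_diff) auto
    also have "\<bar>\<dots>\<bar> \<le> (\<integral>x. \<bar>gauss_call s (k - d - z - x) - max (z - k) 0\<bar> \<partial>S)"
      by (rule integral_abs_bound)
    also have "\<dots> \<le> (\<integral>x. (s + \<bar>d\<bar>) + \<bar>x\<bar> \<partial>S)"
    proof (rule integral_mono)
      fix x
      show "\<bar>gauss_call s (k - d - z - x) - max (z - k) 0\<bar> \<le> (s + \<bar>d\<bar>) + \<bar>x\<bar>"
        using gauss_call_approx[OF s, of "k - d - z - x"] by (auto simp: abs_le_iff)
    qed (use int\<phi> iS in auto)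
    also have "\<dots> = r"
      unfolding r_def using iS S.prob_space by (subst Bochner_Integration.integral_add) auto
    finally show ?thesis .
  qed
  have r0: "0 \<le> r" using \<phi>approx[of 0] by linarith
  have em: "emeasure \<nu> {h<..} = ennreal m"
    unfolding m_def by (intro emeasure_eq_measure2 fmeasurable_levy_measure[OF \<nu> _ _ h(1)]) auto
  have I: "(\<integral>\<^sup>+z. ennreal (max (z - x) 0) \<partial>\<nu>) = ennreal (I x)" if "0 < x" for x
    unfolding I_def using fin[OF that] by (subst nn_integral_eq_integral) auto
  have I0: "0 \<le> I x" for x unfolding I_def by (rule integral_nonneg_AE) auto
  have m0: "0 \<le> m" by (simp add: m_def)
  have l0: "0 \<le> l" using t by (simp add: l_def)
  have lin: "(\<integral>\<^sup>+z. ennreal t * (ennreal (max (z - x) 0) + ennreal q * indicator {h<..} z) \<partial>\<nu>) = ennreal (t * (I x + q * m))"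
    if "0 < x" "0 \<le> q" for x q
  proof -
    have "(\<integral>\<^sup>+z. ennreal t * (ennreal (max (z - x) 0) + ennreal q * indicator {h<..} z) \<partial>\<nu>) =
        ennreal t * (ennreal (I x) + ennreal q * ennreal m)"
      using that by (simp add: nn_integral_cmult nn_integral_add I em nn_integral_cmult_indicator del: ennreal_max_0 ennreal_max_0')
    also have "ennreal (I x) + ennreal q * ennreal m = ennreal (I x + q * m)"
      using that m0 I0 by (simp add: ennreal_mult)
    finally show ?thesis using t that m0 I0 by (simp add: ennreal_mult)
  qed
  have bj: "(\<integral>\<^sup>+z. f z \<partial>big_jumps t h \<nu>) = (\<integral>\<^sup>+z. ennreal (t * indicator {z. h < \<bar>z\<bar>} z) * f z \<partial>\<nu>)"
    if "f \<in> borel_measurable borel" for f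
    unfolding big_jumps_def using that by (subst nn_integral_density) auto
  have T1: "(\<integral>\<^sup>+x. ennreal (max (x - k) 0) \<partial>\<mu>) = (\<integral>\<^sup>+y. ennreal (\<phi> y) \<partial>compound_poisson (big_jumps t h \<nu>))"
    unfolding \<mu> \<phi>_def by (rule nn_integral_call_convolution[OF S P.real_distribution_axioms iS])
  have D1: "(\<integral>\<^sup>+x. ennreal (\<phi> x) * indicator {0<..} x \<partial>big_jumps t h \<nu>) \<le> ennreal (t * (I k + r * m))"
  proof -
    have meas: "(\<lambda>x. ennreal (\<phi> x) * indicator {0<..} x) \<in> borel_measurable borel" by measurable
    have "(\<integral>\<^sup>+x. ennreal (\<phi> x) * indicator {0<..} x \<partial>big_jumps t h \<nu>) \<le>
        (\<integral>\<^sup>+z. ennreal t * (ennreal (max (z - k) 0) + ennreal r * indicator {h<..} z) \<partial>\<nu>)"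
      unfolding bj[OF meas]
    proof (intro nn_integral_mono)
      fix z
      show "ennreal (t * indicator {z. h < \<bar>z\<bar>} z) * (ennreal (\<phi> z) * indicator {0<..} z) \<le>
        ennreal t * (ennreal (max (z - k) 0) + ennreal r * indicator {h<..} z)"
      proof (cases "h < z")
        case True
        have "\<phi> z \<le> max (z - k) 0 + r" using \<phi>approx[of z] by linarith
        then have "ennreal (\<phi> z) \<le> ennreal (max (z - k) 0 + r)" by (rule ennreal_leI)
        also have "\<dots> = ennreal (max (z - k) 0) + ennreal r" using r0 by (intro ennreal_plus) auto
        finally show ?thesis using True h by (auto intro: mult_left_mono)
      next
        case False
        then show ?thesis by (auto simp: indicator_def)
      qed
    qed
    also have "\<dots> = ennreal (t * (I k + r * m))" using h r0 by (intro lin) auto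
    finally show ?thesis .
  qed
  have D2: "(\<integral>\<^sup>+x. ennreal (max x 0) \<partial>big_jumps t h \<nu>) \<le> ennreal (t * (I h + h * m))"
  proof -
    have "(\<integral>\<^sup>+x. ennreal (max x 0) \<partial>big_jumps t h \<nu>) = (\<integral>\<^sup>+z. ennreal (t * indicator {z. h < \<bar>z\<bar>} z) * ennreal (max z 0) \<partial>\<nu>)"
      by (rule bj) measurable
    also have "\<dots> \<le> (\<integral>\<^sup>+z. ennreal t * (ennreal (max (z - h) 0) + ennreal h * indicator {h<..} z) \<partial>\<nu>)"
    proof (intro nn_integral_mono)
      fix z :: real
      show "ennreal (t * indicator {z. h < \<bar>z\<bar>} z) * ennreal (max z 0) \<le>
        ennreal t * (ennreal (max (z - h) 0) + ennreal h * indicator {h<..} z)"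
      proof (cases "h < z")
        case True
        have "ennreal (max z 0) = ennreal (max (z - h) 0 + h)" using True h by simp
        also have "\<dots> = ennreal (max (z - h) 0) + ennreal h" using h by (intro ennreal_plus) auto
        finally show ?thesis using True h by simp
      next
        case False
        then have "z < 0 \<or> \<not> h < \<bar>z\<bar>" using h by auto
        then show ?thesis by (auto simp: indicator_def ennreal_neg)
      qed
    qed
    also have "\<dots> = ennreal (t * (I h + h * m))" using h by (intro lin) auto
    finally show ?thesis .
  qed
  define R where "R = U + t * (I k + r * m) + l * (t * (I h + h * m))"
  have R0: "0 \<le> U" "0 \<le> t * (I k + r * m)" "0 \<le> l * (t * (I h + h * m))"
    using \<phi>nn[of 0] t I0 r0 m0 l0 h by (auto simp: \<phi>0 intro!: mult_nonneg_nonneg add_nonneg_nonneg)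
  have "(\<integral>\<^sup>+x. ennreal (max (x - k) 0) \<partial>\<mu>) \<le> ennreal (\<phi> 0) + (\<integral>\<^sup>+x. ennreal (\<phi> x) * indicator {0<..} x \<partial>big_jumps t h \<nu>)
      + ennreal (measure (big_jumps t h \<nu>) UNIV) * (\<integral>\<^sup>+x. ennreal (max x 0) \<partial>big_jumps t h \<nu>)"
    unfolding T1 by (rule J.compound_poisson_upper[OF \<phi>mono \<phi>nn \<phi>lip])
  also have "\<dots> \<le> ennreal U + ennreal (t * (I k + r * m)) + ennreal l * ennreal (t * (I h + h * m))"
    unfolding \<phi>0 measure_big_jumps[OF \<nu> t h(1)] l_def[symmetric]
    by (intro add_mono mult_left_mono D1 D2) auto
  also have "ennreal l * ennreal (t * (I h + h * m)) = ennreal (l * (t * (I h + h * m)))"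
    using l0 t I0 m0 h by (intro ennreal_mult[symmetric]) auto
  also have "ennreal U + ennreal (t * (I k + r * m)) + ennreal (l * (t * (I h + h * m))) = ennreal R"
    unfolding R_def using R0 by (simp only: ennreal_plus add_nonneg_nonneg)
  finally have up: "(\<integral>\<^sup>+x. ennreal (max (x - k) 0) \<partial>\<mu>) \<le> ennreal R" .
  have intT: "integrable \<mu> (\<lambda>x. max (x - k) 0)"
    by (rule integrableI_nonneg) (use up in \<open>auto simp: less_top[symmetric] top_unique\<close>)
  have T2: "(\<integral>\<^sup>+x. ennreal (max (x - k) 0) \<partial>\<mu>) = ennreal T"
    unfolding T_def using intT by (subst nn_integral_eq_integral) auto
  have T0: "0 \<le> T" unfolding T_def by (rule integral_nonneg_AE) auto
  show "T \<le> U + t * (I k + r * m) + l * (t * (I h + h * m))"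
    using up R0 unfolding T2 R_def[symmetric] by (subst (asm) ennreal_le_iff) (auto simp: R_def)
  define F where "F = (\<integral>\<^sup>+x. ennreal (\<phi> x) \<partial>big_jumps t h \<nu>)"
  have low: "ennreal (exp (- l)) * (ennreal U + F) \<le> ennreal T"
    using J.compound_poisson_lower[of "\<lambda>x. ennreal (\<phi> x)"]
    unfolding T2[symmetric] T1 F_def \<phi>0 measure_big_jumps[OF \<nu> t h(1)] l_def by simp
  have "ennreal (t * (I k + 0 * m)) \<le> F + ennreal (t * (r * m))"
  proof -
    have "ennreal (t * (I k + 0 * m)) = (\<integral>\<^sup>+z. ennreal t * (ennreal (max (z - k) 0) + ennreal 0 * indicator {h<..} z) \<partial>\<nu>)"
      using h by (intro lin[symmetric]) auto
    also have "\<dots> \<le> (\<integral>\<^sup>+z. ennreal (t * indicator {z. h < \<bar>z\<bar>} z) * ennreal (\<phi> z) + ennreal (t * r) * indicator {h<..} z \<partial>\<nu>)"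
    proof (intro nn_integral_mono)
      fix z
      show "ennreal t * (ennreal (max (z - k) 0) + ennreal 0 * indicator {h<..} z) \<le>
         ennreal (t * indicator {z. h < \<bar>z\<bar>} z) * ennreal (\<phi> z) + ennreal (t * r) * indicator {h<..} z"
      proof (cases "h < z")
        case True
        have "max (z - k) 0 \<le> \<phi> z + r" using \<phi>approx[of z] by linarith
        then have "t * max (z - k) 0 \<le> t * \<phi> z + t * r" using t by (simp add: mult_left_mono flip: distrib_left)
        then have "ennreal (t * max (z - k) 0) \<le> ennreal (t * \<phi> z + t * r)" by (rule ennreal_leI)
        also have "\<dots> = ennreal (t * \<phi> z) + ennreal (t * r)" using t r0 \<phi>nn by (intro ennreal_plus) auto
        also have "ennreal (t * \<phi> z) = ennreal t * ennreal (\<phi> z)" using t \<phi>nn by (intro ennreal_mult) auto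
        also have "ennreal (t * max (z - k) 0) = ennreal t * ennreal (max (z - k) 0)" using t by (intro ennreal_mult) auto
        finally show ?thesis using True h by simp
      next
        case False
        \<comment> \<open>Since \<open>h \<le> k\<close>, the jumps that the truncation leaves out
          never reach the strike.\<close>
        then have "max (z - k) 0 = 0" using h by simp
        then show ?thesis by (simp only:) simp
      qed
    qed
    also have "\<dots> = F + ennreal (t * r) * ennreal m"
      unfolding F_def by (subst nn_integral_add) (auto simp: bj nn_integral_cmult_indicator em)
    also have "ennreal (t * r) * ennreal m = ennreal (t * (r * m))"
      using t r0 m0 by (simp add: mult.assoc flip: ennreal_mult)
    finally show ?thesis .
  qed
  then have "ennreal (exp (- l)) * (ennreal U + ennreal (t * I k)) \<le>
     ennreal (exp (- l)) * ((ennreal U + F) + ennreal (t * (r * m)))"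
    by (intro mult_left_mono) (auto simp: add.assoc add_left_mono)
  also have "\<dots> = ennreal (exp (- l)) * (ennreal U + F) + ennreal (exp (- l)) * ennreal (t * (r * m))"
    by (rule distrib_left)
  also have "\<dots> \<le> ennreal T + 1 * ennreal (t * (r * m))"
    using l0 by (intro add_mono low mult_right_mono) auto
  also have "\<dots> = ennreal (T + t * (r * m))"
    using T0 t r0 m0 by simp
  also have "ennreal (exp (- l)) * (ennreal U + ennreal (t * I k)) = ennreal (exp (- l) * (U + t * I k))"
    using R0 t I0 by (simp add: ennreal_mult)
  finally show "exp (- l) * (U + t * I k) \<le> T + t * (r * m)"
    using T0 t r0 m0 by (subst (asm) ennreal_le_iff) auto
qed

section \<open>Exponential against linear payoffs\<close>

lemma exp_le_cosh:
  fixes x :: real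
  assumes "0 < e" "e \<le> x"
  shows "exp x \<le> (1 / (1 - exp (- e))\<^sup>2) * (exp x + exp (- x) - 2)"
proof -
  have "exp x + exp (- x) - 2 = exp x * (1 - exp (- x))\<^sup>2"
    by (simp add: power2_eq_square algebra_simps flip: exp_add)
  moreover have "(1 - exp (- e))\<^sup>2 \<le> (1 - exp (- x))\<^sup>2"
    using assms by (intro power_mono) auto
  moreover have "0 < (1 - exp (- e))\<^sup>2" using assms by simp
  ultimately show ?thesis by (simp add: field_simps)
qed

lemma cosh_ge: "0 \<le> exp x + exp (- x) - (2::real)"
  using exp_minus_one_minus_bounds(1)[of x] exp_minus_one_minus_bounds(1)[of "- x"] by linarith

text \<open>Bounding \<open>exp \<bar>y\<bar>\<close> by \<open>exp y + exp (- y)\<close> would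
  leave an integral near 2. Here the leading constant is close to 1: for small
  \<open>\<bar>y\<bar>\<close> the value is at most \<open>1 + e\<close>, and beyond
  \<open>ln (1 + e)\<close> the cosh term dominates.\<close>

lemma exp_abs_le_cosh:
  fixes e :: real
  assumes "0 < e"
  obtains C where "0 \<le> C" "\<And>y::real. exp \<bar>y\<bar> \<le> 1 + e + C * (exp y + exp (- y) - 2)"
proof (rule that)
  let ?C = "1 / (1 - exp (- ln (1 + e)))\<^sup>2"
  show "0 \<le> ?C" by simp
  fix y :: real
  have l: "0 < ln (1 + e)" using assms by simp
  show "exp \<bar>y\<bar> \<le> 1 + e + ?C * (exp y + exp (- y) - 2)"
  proof (cases "ln (1 + e) \<le> \<bar>y\<bar>")
    case True
    have "exp \<bar>y\<bar> \<le> ?C * (exp \<bar>y\<bar> + exp (- \<bar>y\<bar>) - 2)" using l True by (rule exp_le_cosh)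
    also have "exp \<bar>y\<bar> + exp (- \<bar>y\<bar>) - 2 = exp y + exp (- y) - 2" by (simp add: abs_if)
    finally show ?thesis using assms by linarith
  next
    case False
    then have "exp \<bar>y\<bar> \<le> exp (ln (1 + e))" by simp
    also have "\<dots> = 1 + e" using assms by simp
    finally show ?thesis using mult_nonneg_nonneg[OF \<open>0 \<le> ?C\<close> cosh_ge[of y]] by linarith
  qed
qed

text \<open>The payoff with \<open>j = 1\<close> is the call; with \<open>j = - 1\<close> it is the put written in terms of \<open>- X\<close>.\<close>

definition payoff :: "real \<Rightarrow> real \<Rightarrow> real \<Rightarrow> real" where
  "payoff j k x = max (j * (exp (j * x) - exp (j * k))) 0"

text \<open>Up to \<open>ln (1 + e)\<close> the exponential function has slope within
  \<open>e\<close> of 1 (also after reflection), so the two payoffs agree up to the factor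
  \<open>e\<close>; further out both are at most \<open>exp x\<close>, which the cosh term absorbs.
  It is essential that \<open>C\<close> depends on \<open>e\<close> only, because the strike will
  tend to 0.\<close>

lemma payoff_approx:
  assumes e: "0 < e" "e \<le> 1" and j: "j = 1 \<or> j = - 1"
  obtains C where "0 \<le> C"
    "\<And>k x. 0 < k \<Longrightarrow> \<bar>payoff j k x - max (x - k) 0\<bar> \<le> e * max (x - k) 0 + C * (exp x + exp (- x) - 2)"
proof (rule that)
  let ?C = "1 / (1 - exp (- ln (1 + e)))\<^sup>2"
  show C: "0 \<le> ?C" by simp
  have l: "0 < ln (1 + e)" using e by simp
  fix k x :: real assume k: "0 < k"
  have nn: "0 \<le> ?C * (exp x + exp (- x) - 2)" by (intro mult_nonneg_nonneg C cosh_ge)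
  consider "x \<le> k" | "k < x" "x \<le> ln (1 + e)" | "k < x" "ln (1 + e) < x" by linarith
  then show "\<bar>payoff j k x - max (x - k) 0\<bar> \<le> e * max (x - k) 0 + ?C * (exp x + exp (- x) - 2)"
  proof cases
    case 1
    then have "payoff j k x = 0" using j by (auto simp: payoff_def)
    then show ?thesis using 1 nn by simp
  next
    case 2
    have ex: "exp x \<le> 1 + e" using 2 e by (metis exp_le_cancel_iff exp_ln add_pos_pos zero_less_one)
    have a: "1 - exp (- (x - k)) \<le> x - k" using exp_ge_add_one_self[of "- (x - k)"] by linarith
    have b: "x - k \<le> exp (x - k) - 1" using exp_ge_add_one_self[of "x - k"] by linarith
    have "\<bar>payoff j k x - (x - k)\<bar> \<le> e * (x - k)"
      using j
    proof
      assume [simp]: "j = 1"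
      have p: "payoff j k x = exp x - exp k" using 2 by (simp add: payoff_def)
      have "exp x - exp k = exp x * (1 - exp (- (x - k)))" by (simp add: right_diff_distrib flip: exp_add)
      also have "\<dots> \<le> exp x * (x - k)" using a by (intro mult_left_mono) auto
      also have "\<dots> \<le> (1 + e) * (x - k)" using ex 2 by (intro mult_right_mono) auto
      finally have u: "exp x - exp k \<le> (1 + e) * (x - k)" .
      have "1 * (exp (x - k) - 1) \<le> exp k * (exp (x - k) - 1)" using k 2 by (intro mult_right_mono) auto
      also have "\<dots> = exp x - exp k" by (simp add: right_diff_distrib flip: exp_add)
      finally have "x - k \<le> exp x - exp k" using b by simp
      moreover have "0 \<le> e * (x - k)" using e 2 by simp
      moreover have "(1 + e) * (x - k) = (x - k) + e * (x - k)" by (simp add: distrib_right)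
      ultimately show ?thesis using u unfolding p abs_le_iff by linarith
    next
      assume [simp]: "j = - 1"
      have p: "payoff j k x = exp (- k) - exp (- x)" using 2 by (simp add: payoff_def)
      have "exp (- k) - exp (- x) = exp (- k) * (1 - exp (- (x - k)))" by (simp add: right_diff_distrib flip: exp_add)
      also have "\<dots> \<le> 1 * (x - k)" using a k 2 by (intro mult_mono) auto
      finally have u: "exp (- k) - exp (- x) \<le> x - k" by simp
      have "(1 - e) * (1 + e) \<le> 1" using e by (simp add: algebra_simps)
      then have "1 - e \<le> 1 / (1 + e)" using e by (simp add: field_simps)
      also have "\<dots> \<le> exp (- x)" using ex e by (simp add: exp_minus field_simps)
      finally have ee: "1 - e \<le> exp (- x)" .
      have "(1 - e) * (x - k) \<le> exp (- x) * (x - k)" using ee 2 by (intro mult_right_mono) auto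
      also have "\<dots> \<le> exp (- x) * (exp (x - k) - 1)" using b by (intro mult_left_mono) auto
      also have "\<dots> = exp (- k) - exp (- x)" by (simp add: right_diff_distrib flip: exp_add)
      finally have v: "(1 - e) * (x - k) \<le> exp (- k) - exp (- x)" .
      have "0 \<le> e * (x - k)" using e 2 by simp
      moreover have "(1 - e) * (x - k) = (x - k) - e * (x - k)" by (simp add: left_diff_distrib)
      ultimately show ?thesis using u v unfolding p abs_le_iff by linarith
    qed
    then show ?thesis using 2 nn by simp
  next
    case 3
    have x: "0 < x" using 3 k by linarith
    have "exp (- k) \<le> 1" "1 \<le> exp x" "0 < exp k" "0 < exp (- x)" using k x by auto
    then have "exp x - exp k \<le> exp x" "exp (- k) - exp (- x) \<le> exp x" "0 \<le> exp x" by linarith+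
    then have "0 \<le> payoff j k x" "payoff j k x \<le> exp x" using j
      by (auto simp: payoff_def)
    moreover have "0 \<le> x - k" "x - k \<le> exp x" using 3 k exp_ge_add_one_self[of x] by linarith+
    ultimately have "\<bar>payoff j k x - max (x - k) 0\<bar> \<le> exp x" unfolding abs_le_iff by linarith
    also have "\<dots> \<le> ?C * (exp x + exp (- x) - 2)" using l 3 by (intro exp_le_cosh) auto
    moreover have "0 \<le> e * max (x - k) 0" using e by simp
    ultimately show ?thesis by linarith
  qed
qed

lemma payoff_integral_approx:
  assumes e: "0 < e" "e \<le> 1" and j: "j = 1 \<or> j = - 1"
  obtains C where "0 \<le> C"
    "\<And>k \<mu>. 0 < k \<Longrightarrow> real_distribution \<mu> \<Longrightarrow> integrable \<mu> exp \<Longrightarrow> integrable \<mu> (\<lambda>x. exp (- x)) \<Longrightarrow>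
      \<bar>(\<integral>x. payoff j k x \<partial>\<mu>) - (\<integral>x. max (x - k) 0 \<partial>\<mu>)\<bar> \<le>
       e * (\<integral>x. max (x - k) 0 \<partial>\<mu>) + C * (\<integral>x. (exp x + exp (- x) - 2) \<partial>\<mu>)"
proof -
  obtain C where C: "0 \<le> C"
    "\<And>k x. 0 < k \<Longrightarrow> \<bar>payoff j k x - max (x - k) 0\<bar> \<le> e * max (x - k) 0 + C * (exp x + exp (- x) - 2)"
    by (rule payoff_approx[OF e j]) blast
  show thesis
  proof (rule that[OF C(1)])
    fix k :: real and \<mu> :: "real measure"
    assume k: "0 < k" and \<mu>: "real_distribution \<mu>" and i1: "integrable \<mu> exp" and i2: "integrable \<mu> (\<lambda>x. exp (- x))"
    interpret real_distribution \<mu> by fact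
    have im: "integrable \<mu> (\<lambda>x. max (x - k) 0)"
    proof (rule Bochner_Integration.integrable_bound[OF i1])
      have "norm (max (x - k) 0) \<le> norm (exp x)" for x
      proof -
        have "x - k \<le> exp x" using k exp_ge_add_one_self[of x] by linarith
        then show ?thesis by simp
      qed
      then show "AE x in \<mu>. norm (max (x - k) 0) \<le> norm (exp x)" by simp
    qed simp
    have ic: "integrable \<mu> (\<lambda>x. exp x + exp (- x) - 2)" using i1 i2 by simp
    have ib: "integrable \<mu> (\<lambda>x. e * max (x - k) 0 + C * (exp x + exp (- x) - 2))"
      using im ic by simp
    have idiff: "integrable \<mu> (\<lambda>x. payoff j k x - max (x - k) 0)"
      by (rule Bochner_Integration.integrable_bound[OF ib])
        (use C(2)[OF k] in \<open>auto simp: payoff_def intro!: order_trans[OF _ abs_ge_self]\<close>)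
    have ip: "integrable \<mu> (payoff j k)"
      using Bochner_Integration.integrable_add[OF idiff im] by (simp cong: Bochner_Integration.integrable_cong)
    have "\<bar>(\<integral>x. payoff j k x \<partial>\<mu>) - (\<integral>x. max (x - k) 0 \<partial>\<mu>)\<bar> = \<bar>\<integral>x. payoff j k x - max (x - k) 0 \<partial>\<mu>\<bar>"
      using ip im by simp
    also have "\<dots> \<le> (\<integral>x. \<bar>payoff j k x - max (x - k) 0\<bar> \<partial>\<mu>)" by (rule integral_abs_bound)
    also have "\<dots> \<le> (\<integral>x. e * max (x - k) 0 + C * (exp x + exp (- x) - 2) \<partial>\<mu>)"
      using idiff by (intro integral_mono ib C(2)[OF k]) auto
    also have "\<dots> = e * (\<integral>x. max (x - k) 0 \<partial>\<mu>) + C * (\<integral>x. (exp x + exp (- x) - 2) \<partial>\<mu>)"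
      using im ic by (subst Bochner_Integration.integral_add) (simp_all only: integrable_mult_right integral_mult_right_zero)
    finally show "\<bar>(\<integral>x. payoff j k x \<partial>\<mu>) - (\<integral>x. max (x - k) 0 \<partial>\<mu>)\<bar> \<le>
       e * (\<integral>x. max (x - k) 0 \<partial>\<mu>) + C * (\<integral>x. (exp x + exp (- x) - 2) \<partial>\<mu>)" .
  qed
qed

text \<open>Each of the two exponential moments is \<open>1 + O(t)\<close>, and the subtracted 2
  cancels their leading parts; \<open>t \<le> 1\<close> turns \<open>exp (K * t)\<close> into a
  constant.\<close>

lemma cosh_integral_bound:
  assumes \<mu>: "real_distribution \<mu>" and K: "0 \<le> K" and t: "0 \<le> t" "t \<le> 1"
    and p: "(\<integral>\<^sup>+x. ennreal (exp x) \<partial>\<mu>) \<le> ennreal (exp (K * t))"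
    and n: "(\<integral>\<^sup>+x. ennreal (exp (- x)) \<partial>\<mu>) \<le> ennreal (exp (K * t))"
  shows "integrable \<mu> exp" "integrable \<mu> (\<lambda>x. exp (- x))"
    "(\<integral>x. (exp x + exp (- x) - 2) \<partial>\<mu>) \<le> 2 * K * exp K * t"
proof -
  interpret real_distribution \<mu> by fact
  show i1: "integrable \<mu> exp"
    by (rule integrableI_nonneg) (use p in \<open>auto simp: less_top[symmetric] top_unique\<close>)
  show i2: "integrable \<mu> (\<lambda>x. exp (- x))"
    by (rule integrableI_nonneg) (use n in \<open>auto simp: less_top[symmetric] top_unique\<close>)
  have 1: "(\<integral>x. exp x \<partial>\<mu>) \<le> exp (K * t)"
    using p by (subst (asm) nn_integral_eq_integral[OF i1]) auto
  have 2: "(\<integral>x. exp (- x) \<partial>\<mu>) \<le> exp (K * t)"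
    using n by (subst (asm) nn_integral_eq_integral[OF i2]) auto
  have "exp (K * t) - 1 \<le> K * t * exp (K * t)"
    using exp_ge_add_one_self[of "- (K * t)"] exp_gt_zero[of "K * t"]
    by (simp add: exp_minus field_simps)
  also have "\<dots> \<le> K * t * exp K"
    using K t by (intro mult_left_mono) (auto simp: mult_left_le)
  finally have 3: "exp (K * t) - 1 \<le> K * t * exp K" .
  have "(\<integral>x. (exp x + exp (- x) - 2) \<partial>\<mu>) = (\<integral>x. exp x \<partial>\<mu>) + (\<integral>x. exp (- x) \<partial>\<mu>) - 2"
    using i1 i2 prob_space by simp
  then show "(\<integral>x. (exp x + exp (- x) - 2) \<partial>\<mu>) \<le> 2 * K * exp K * t"
    using 1 2 3 by (simp add: mult_ac)
qed

text \<open>The decomposition is used once at the fixed level 1, where each of the three factors has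
  an exponential moment whose logarithm is bounded linearly in \<open>t\<close>. The point is that
  \<open>K\<close> serves all times simultaneously.\<close>

lemma levy_exp_moment:
  assumes \<nu>: "levy_measure \<nu>" and \<theta>: "\<bar>\<theta>\<bar> \<le> 1"
    and fin: "(\<integral>\<^sup>+z. ennreal (exp \<bar>z\<bar>) * indicator {z. 1 < \<bar>z\<bar>} z \<partial>\<nu>) < \<infinity>"
  obtains K where "0 \<le> K" "\<And>t \<mu>. 0 < t \<Longrightarrow> real_distribution \<mu> \<Longrightarrow>
    (\<And>u. char \<mu> u = exp (complex_of_real t * levy_exponent (\<sigma>\<^sup>2) \<nu> \<gamma> u)) \<Longrightarrow>
    mgf \<mu> \<theta> \<le> ennreal (exp (K * t))"
proof -
  have [simp, measurable_cong]: "sets \<nu> = sets borel" using \<nu> by (rule sets_levy_measure)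
  \<comment> \<open>The integral is over the empty set; it is written out so that \<open>b\<close>
    matches the drift of the decomposition at level 1.\<close>
  define b where "b = \<gamma> - (\<integral>z. z * indicator ({- 1..1} - {- 1..1}) z \<partial>\<nu>)"
  define V where "V = (\<integral>z. z\<^sup>2 * indicator {- 1..1} z \<partial>\<nu>)"
  define E where "E = (\<integral>z. indicator {z. 1 < \<bar>z\<bar>} z * (exp (\<theta> * z) - 1) \<partial>\<nu>)"
  define K0 where "K0 = \<theta> * b + \<theta>\<^sup>2 * \<sigma>\<^sup>2 / 2 + \<theta>\<^sup>2 * exp \<bar>\<theta>\<bar> * V + E"
  have ind: "integrable \<nu> (indicator {z. 1 < \<bar>z\<bar>} :: real \<Rightarrow> real)"
    by (rule integrable_levy_indicator[OF \<nu>, of _ 1]) auto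
  have iexp: "integrable \<nu> (\<lambda>z. indicator {z. 1 < \<bar>z\<bar>} z * exp (\<theta> * z))"
  proof (rule integrableI_nonneg)
    have "(\<integral>\<^sup>+z. ennreal (indicator {z. 1 < \<bar>z\<bar>} z * exp (\<theta> * z)) \<partial>\<nu>) \<le>
       (\<integral>\<^sup>+z. ennreal (exp \<bar>z\<bar>) * indicator {z. 1 < \<bar>z\<bar>} z \<partial>\<nu>)"
    proof (intro nn_integral_mono)
      fix z
      have "\<theta> * z \<le> \<bar>\<theta>\<bar> * \<bar>z\<bar>" by (metis abs_ge_self abs_mult)
      also have "\<dots> \<le> \<bar>z\<bar>" using \<theta> by (simp add: mult_left_le_one_le)
      finally show "ennreal (indicator {z. 1 < \<bar>z\<bar>} z * exp (\<theta> * z)) \<le> ennreal (exp \<bar>z\<bar>) * indicator {z. 1 < \<bar>z\<bar>} z"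
        by (auto simp: indicator_def ennreal_leI)
    qed
    then show "(\<integral>\<^sup>+z. ennreal (indicator {z. 1 < \<bar>z\<bar>} z * exp (\<theta> * z)) \<partial>\<nu>) < \<infinity>"
      using fin by (rule le_less_trans)
  qed auto
  show thesis
  proof (rule that[of "max K0 0"])
    fix t :: real and \<mu> :: "real measure"
    assume t: "0 < t" and \<mu>: "real_distribution \<mu>"
      and ch: "\<And>u. char \<mu> u = exp (complex_of_real t * levy_exponent (\<sigma>\<^sup>2) \<nu> \<gamma> u)"
    obtain S where S: "real_distribution S"
      and mgf: "\<And>\<theta>. mgf S \<theta> \<le> ennreal (exp (t * \<theta>\<^sup>2 * exp (\<bar>\<theta>\<bar> * 1) * V))"
      and \<mu>eq: "\<mu> = ((gauss_law (\<sigma> * sqrt t) (t * b) \<star> S) \<star> compound_poisson (big_jumps t 1 \<nu>))"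
      by (rule levy_decomposition[OF \<nu> \<mu> ch t zero_less_one order_refl, folded b_def V_def]) (rule that)
    interpret J: jump_intensity "big_jumps t 1 \<nu>"
      by (rule jump_intensity_big_jumps) (use \<nu> t in auto)
    have iJ: "integrable (big_jumps t 1 \<nu>) (\<lambda>z. exp (\<theta> * z))"
      unfolding big_jumps_def using t integrable_mult_right[OF iexp, of t]
      by (subst integrable_density) (auto simp: mult.assoc)
    have EJ: "(\<integral>z. (exp (\<theta> * z) - 1) \<partial>big_jumps t 1 \<nu>) = t * E"
      unfolding big_jumps_def E_def using t
      by (subst integral_density) (auto simp: mult.assoc simp flip: integral_mult_right_zero)
    note rd = real_distribution_gauss_law S J.real_distribution_compound_poisson
    have mult: "mgf (M \<star> N) \<theta> = mgf M \<theta> * mgf N \<theta>"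
      if "real_distribution M" "real_distribution N" for M N
    proof -
      interpret M: real_distribution M by fact
      interpret N: real_distribution N by fact
      show ?thesis using that
        by (simp add: nn_integral_convolution_distr distrib_left exp_add ennreal_mult nn_integral_cmult nn_integral_multc)
    qed
    have "mgf \<mu> \<theta> = ennreal (exp (\<theta> * (t * b) + \<theta>\<^sup>2 * (\<sigma> * sqrt t)\<^sup>2 / 2)) *
       mgf S \<theta> * ennreal (exp (t * E))"
      unfolding \<mu>eq EJ[symmetric]
      by (simp only: mult rd real_distribution_convolution nn_integral_exp_gauss_law J.nn_integral_exp_compound_poisson[OF iJ])
    also have "\<dots> \<le> ennreal (exp (\<theta> * (t * b) + \<theta>\<^sup>2 * (\<sigma> * sqrt t)\<^sup>2 / 2)) *
       ennreal (exp (t * \<theta>\<^sup>2 * exp (\<bar>\<theta>\<bar> * 1) * V)) * ennreal (exp (t * E))"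
      by (intro mult_left_mono mult_right_mono mgf) auto
    also have "\<dots> = ennreal (exp (K0 * t))"
    proof -
      have "exp (\<theta> * (t * b) + \<theta>\<^sup>2 * (\<sigma> * sqrt t)\<^sup>2 / 2) * exp (t * \<theta>\<^sup>2 * exp (\<bar>\<theta>\<bar> * 1) * V) * exp (t * E) = exp (K0 * t)"
        unfolding mult_exp_exp K0_def using t
        by (intro arg_cong[where f=exp]) (simp add: algebra_simps power_mult_distrib)
      then show ?thesis by (simp only: ennreal_mult[symmetric] exp_ge_zero mult_nonneg_nonneg)
    qed
    also have "\<dots> \<le> ennreal (exp (max K0 0 * t))"
      using t by (intro ennreal_leI) (auto intro: mult_right_mono)
    finally show "mgf \<mu> \<theta> \<le> ennreal (exp (max K0 0 * t))" .
  qed simp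
qed

section \<open>The effect of the small jumps\<close>

text \<open>Two bounds for one moment. The crude one, from
  \<open>exp (\<theta> * x) + exp (- \<theta> * x)\<close>, serves where the moment is multiplied by
  a small factor; the refined one tends to \<open>1 + e\<close> as \<open>W\<close> tends to 0 and
  serves where the deviation from 1 counts.\<close>

lemma small_jumps_exp_abs:
  assumes S: "real_distribution S" and W: "\<And>\<theta>. \<bar>\<theta>\<bar> \<le> q \<Longrightarrow> mgf S \<theta> \<le> ennreal (exp W)"
    and \<theta>: "0 \<le> \<theta>" "\<theta> \<le> q"
    and C: "0 \<le> C" "\<And>y::real. exp \<bar>y\<bar> \<le> 1 + e + C * (exp y + exp (- y) - 2)"
  shows "integrable S (\<lambda>x. exp (\<theta> * \<bar>x\<bar>))" "(\<integral>x. exp (\<theta> * \<bar>x\<bar>) \<partial>S) \<le> 2 * exp W"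
    "(\<integral>x. exp (\<theta> * \<bar>x\<bar>) \<partial>S) \<le> 1 + e + 2 * C * (exp W - 1)"
proof -
  interpret real_distribution S by fact
  have i: "integrable S (\<lambda>x. exp (\<theta>' * x))" and b: "(\<integral>x. exp (\<theta>' * x) \<partial>S) \<le> exp W" if "\<bar>\<theta>'\<bar> \<le> q" for \<theta>'
  proof -
    show i: "integrable S (\<lambda>x. exp (\<theta>' * x))"
      by (rule integrableI_nonneg) (use W[OF that] in \<open>auto simp: less_top[symmetric] top_unique\<close>)
    show "(\<integral>x. exp (\<theta>' * x) \<partial>S) \<le> exp W"
      using W[OF that] by (subst (asm) nn_integral_eq_integral[OF i]) auto
  qed
  have i1: "integrable S (\<lambda>x. exp (\<theta> * x))" and i2: "integrable S (\<lambda>x. exp (- \<theta> * x))"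
    using \<theta> by (auto intro!: i[of \<theta>] i[of "- \<theta>", simplified])
  have b1: "(\<integral>x. exp (\<theta> * x) \<partial>S) \<le> exp W" and b2: "(\<integral>x. exp (- \<theta> * x) \<partial>S) \<le> exp W"
    using \<theta> b[of \<theta>] b[of "- \<theta>"] by auto
  have le: "exp (\<theta> * \<bar>x\<bar>) \<le> exp (\<theta> * x) + exp (- \<theta> * x)" for x
    by (cases "0 \<le> x") auto
  show i3: "integrable S (\<lambda>x. exp (\<theta> * \<bar>x\<bar>))"
    by (rule Bochner_Integration.integrable_bound[OF Bochner_Integration.integrable_add[OF i1 i2]])
      (use le in \<open>auto intro: order_trans[OF _ abs_ge_self]\<close>)
  have "(\<integral>x. exp (\<theta> * \<bar>x\<bar>) \<partial>S) \<le> (\<integral>x. exp (\<theta> * x) + exp (- \<theta> * x) \<partial>S)"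
    using le by (intro integral_mono i3 Bochner_Integration.integrable_add i1 i2)
  also have "\<dots> \<le> 2 * exp W" using i1 i2 b1 b2 by simp
  finally show "(\<integral>x. exp (\<theta> * \<bar>x\<bar>) \<partial>S) \<le> 2 * exp W" .
  have "(\<integral>x. exp (\<theta> * \<bar>x\<bar>) \<partial>S) \<le> (\<integral>x. (1 + e) + C * (exp (\<theta> * x) + exp (- \<theta> * x) - 2) \<partial>S)"
  proof (intro integral_mono i3)
    show "integrable S (\<lambda>x. (1 + e) + C * (exp (\<theta> * x) + exp (- \<theta> * x) - 2))"
      using i1 i2 by simp
    show "exp (\<theta> * \<bar>x\<bar>) \<le> (1 + e) + C * (exp (\<theta> * x) + exp (- \<theta> * x) - 2)" for x
      using C(2)[of "\<theta> * x"] \<theta> by (simp add: abs_mult)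
  qed
  also have "\<dots> = (1 + e) + C * ((\<integral>x. exp (\<theta> * x) \<partial>S) + (\<integral>x. exp (- \<theta> * x) \<partial>S) - 2)"
    using i1 i2 prob_space by simp
  also have "\<dots> \<le> (1 + e) + C * (exp W + exp W - 2)"
    using C(1) b1 b2 by (intro add_left_mono mult_left_mono) auto
  finally show "(\<integral>x. exp (\<theta> * \<bar>x\<bar>) \<partial>S) \<le> 1 + e + 2 * C * (exp W - 1)"
    by (simp add: algebra_simps)
qed

text \<open>The small jumps do not move the Gaussian call price. If \<open>k\<^sup>2 \<le> 16 s\<^sup>2 L\<close>, the price is
  log-Lipschitz in the strike at rate \<open>6 k / s\<^sup>2 \<le> 96 L / k\<close>, within the range of exponential moments
  of \<open>S\<close>; for larger strikes the Gaussian price itself is at most \<open>k t\<^sup>2\<close>.\<close>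

lemma gauss_call_small_jumps:
  fixes s k L d t :: real
  assumes S: "real_distribution S"
    and W: "\<And>\<theta>. \<bar>\<theta>\<bar> \<le> 100 * L / k \<Longrightarrow> mgf S \<theta> \<le> ennreal (exp W)"
    and L: "1 \<le> L" "t = exp (- L)" and k: "0 < k" and s: "0 \<le> s" "s \<le> k" and d: "\<bar>d\<bar> \<le> k / 4"
    and e: "0 \<le> e" and C: "0 \<le> C" "\<And>y::real. exp \<bar>y\<bar> \<le> 1 + e + C * (exp y + exp (- y) - 2)"
    and W0: "0 \<le> W"
  shows "integrable S (\<lambda>x. x)"
    and "(\<integral>x. \<bar>x\<bar> \<partial>S) \<le> k * (e + 2 * C * (exp W - 1))"
    and "\<bar>(\<integral>x. gauss_call s (k - d - x) \<partial>S) - gauss_call s k\<bar> \<le>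
      gauss_call s k * (exp (6 * k * \<bar>d\<bar> / s\<^sup>2) * (1 + e + 2 * C * (exp W - 1)) - 1) + k * t\<^sup>2 * (1 + 4 * exp W)"
proof -
  interpret real_distribution S by fact
  have moments: "integrable S (\<lambda>x. exp (\<theta> * \<bar>x\<bar>))" "(\<integral>x. exp (\<theta> * \<bar>x\<bar>) \<partial>S) \<le> 2 * exp W"
    "(\<integral>x. exp (\<theta> * \<bar>x\<bar>) \<partial>S) \<le> 1 + e + 2 * C * (exp W - 1)" if "0 \<le> \<theta>" "\<theta> \<le> 100 * L / k" for \<theta>
    by (rule small_jumps_exp_abs[where q="100 * L / k" and C=C and e=e and W=W]; (fact S that C | erule W))+
  \<comment> \<open>Because \<open>L \<ge> 1\<close>, the moment of order \<open>1 / k\<close> lies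
    in the admissible range; it measures the small jumps on the scale of the strike.\<close>
  have q: "1 / k \<le> 100 * L / k" using L k by (simp add: field_simps)
  have i1: "integrable S (\<lambda>x. exp (1 / k * \<bar>x\<bar>))" using q k by (intro moments) auto
  have x1: "\<bar>x\<bar> \<le> k * (exp (1 / k * \<bar>x\<bar>) - 1)" for x
    using exp_ge_add_one_self[of "1 / k * \<bar>x\<bar>"] k by (simp add: field_simps)
  show iS: "integrable S (\<lambda>x. x)"
  proof (rule Bochner_Integration.integrable_bound)
    show "integrable S (\<lambda>x. k * (exp (1 / k * \<bar>x\<bar>) - 1))" using i1 by simp
    show "AE x in S. norm x \<le> norm (k * (exp (1 / k * \<bar>x\<bar>) - 1))"
      using x1 by (auto intro: order_trans[OF _ abs_ge_self])
  qed simp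
  have "(\<integral>x. \<bar>x\<bar> \<partial>S) \<le> (\<integral>x. k * (exp (1 / k * \<bar>x\<bar>) - 1) \<partial>S)"
    using iS i1 by (intro integral_mono x1) auto
  also have "\<dots> = k * ((\<integral>x. exp (1 / k * \<bar>x\<bar>) \<partial>S) - 1)"
    using i1 prob_space by simp
  also have "\<dots> \<le> k * (e + 2 * C * (exp W - 1))"
    using moments(3)[of "1 / k"] q k by (intro mult_left_mono) auto
  finally show "(\<integral>x. \<bar>x\<bar> \<partial>S) \<le> k * (e + 2 * C * (exp W - 1))" .

  define A where "A = gauss_call s k"
  define E where "E = exp (6 * k * \<bar>d\<bar> / s\<^sup>2)"
  define M where "M = 1 + e + 2 * C * (exp W - 1)"
  define Q where "Q x = \<bar>gauss_call s (k - d - x) - A\<bar>" for x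
  \<comment> \<open>Dominates the price change when \<open>\<bar>x\<bar>\<close> exceeds
    \<open>k / 4\<close> and the shifted strike may leave the range of the ratio estimate. The
    exponent 9 is 8 + 1: eight units are at least \<open>2 * L\<close> there and yield
    \<open>t\<^sup>2\<close>, the last one dominates the linear growth of the price.\<close>
  define far where "far x = 2 * k * t\<^sup>2 * exp (9 * L / k * \<bar>x\<bar>)" for x
  have A0: "0 \<le> A" by (simp add: A_def gauss_call_nonneg)
  have E1: "1 \<le> E" using k by (simp add: E_def)
  have M1: "1 \<le> M" using e C W0 by (simp add: M_def)
  have t: "0 < t" using L by simp
  have far0: "0 \<le> far x" for x using k t by (simp add: far_def)
  have q9: "9 * L / k \<le> 100 * L / k" using L k by (simp add: field_simps)
  have ifar: "integrable S far"
    unfolding far_def using moments(1)[of "9 * L / k"] q9 L k by (intro integrable_mult_right) auto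
  have far_int: "(\<integral>x. far x \<partial>S) \<le> k * t\<^sup>2 * (4 * exp W)"
  proof -
    have "(\<integral>x. far x \<partial>S) = 2 * k * t\<^sup>2 * (\<integral>x. exp (9 * L / k * \<bar>x\<bar>) \<partial>S)"
      unfolding far_def by (rule integral_mult_right_zero)
    also have "\<dots> \<le> 2 * k * t\<^sup>2 * (2 * exp W)"
      using moments(2)[of "9 * L / k"] q9 L k by (intro mult_left_mono) auto
    finally show ?thesis by simp
  qed
  have Q_far: "Q x \<le> far x" if "k / 4 < \<bar>x\<bar>" for x
  proof -
    have "Q x \<le> \<bar>d + x\<bar>" unfolding Q_def A_def using gauss_call_lipschitz[of s "k - d - x" k] by simp
    also have "\<dots> \<le> 2 * \<bar>x\<bar>" using d that by linarith
    also have "\<dots> \<le> 2 * (k * exp (1 / k * \<bar>x\<bar>))"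
      using x1[of x] k by (simp add: right_diff_distrib)
    also have "\<dots> \<le> 2 * (k * (t\<^sup>2 * exp (9 * L / k * \<bar>x\<bar>)))"
    proof -
      have "1 / k * \<bar>x\<bar> \<le> L / k * \<bar>x\<bar>" using L k by (intro mult_right_mono divide_right_mono) auto
      moreover have "2 * L \<le> 8 * L / k * \<bar>x\<bar>"
      proof -
        have "8 * L / k * (k / 4) \<le> 8 * L / k * \<bar>x\<bar>" using that L k by (intro mult_left_mono) auto
        then show ?thesis using k by simp
      qed
      moreover have "L / k * \<bar>x\<bar> + 8 * L / k * \<bar>x\<bar> = 9 * L / k * \<bar>x\<bar>" by (simp add: field_simps)
      ultimately have "1 / k * \<bar>x\<bar> \<le> - (2 * L) + 9 * L / k * \<bar>x\<bar>" by linarith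
      then have "exp (1 / k * \<bar>x\<bar>) \<le> exp (- (2 * L)) * exp (9 * L / k * \<bar>x\<bar>)"
        unfolding mult_exp_exp by simp
      also have "exp (- (2 * L)) = t\<^sup>2" using L by (simp add: power2_eq_square mult_exp_exp)
      finally show ?thesis using k by simp
    qed
    finally show ?thesis by (simp add: far_def)
  qed
  have iQ: "integrable S Q"
    unfolding Q_def by (intro integrable_abs Bochner_Integration.integrable_diff integrable_gauss_call_shift S iS) simp
  have "\<bar>(\<integral>x. gauss_call s (k - d - x) \<partial>S) - gauss_call s k\<bar> = \<bar>\<integral>x. gauss_call s (k - d - x) - A \<partial>S\<bar>"
    using integrable_gauss_call_shift[OF S iS, of s "k - d"] prob_space by (simp add: A_def)
  also have "\<dots> \<le> (\<integral>x. Q x \<partial>S)" unfolding Q_def by (rule integral_abs_bound)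
  also have "\<dots> \<le> A * (E * M - 1) + k * t\<^sup>2 * (1 + 4 * exp W)"
  proof (cases "0 < s \<and> k\<^sup>2 \<le> 16 * s\<^sup>2 * L")
    case True
    define \<theta> where "\<theta> = 6 * k / s\<^sup>2"
    have \<theta>: "0 \<le> \<theta>" "\<theta> \<le> 100 * L / k"
    proof -
      show "0 \<le> \<theta>" using k by (simp add: \<theta>_def)
      have "k\<^sup>2 \<le> 16 * (s\<^sup>2 * L)" "0 \<le> s\<^sup>2 * L" using True L by simp_all
      then have "6 * k\<^sup>2 \<le> 100 * (s\<^sup>2 * L)" by linarith
      then show "\<theta> \<le> 100 * L / k" using True k by (simp add: \<theta>_def field_simps power2_eq_square)
    qed
    have i\<theta>: "integrable S (\<lambda>x. exp (\<theta> * \<bar>x\<bar>))" using \<theta> by (intro moments)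
    have "Q x \<le> A * (E * exp (\<theta> * \<bar>x\<bar>) - 1) + far x" for x
    proof (cases "k / 4 < \<bar>x\<bar>")
      case False
      have "Q x \<le> A * (exp (6 * k * \<bar>d + x\<bar> / s\<^sup>2) - 1)"
      proof -
        have "\<bar>d + x\<bar> \<le> k / 2" using d False by linarith
        then show ?thesis
          unfolding Q_def A_def using gauss_call_diff_le[of s k "d + x"] True s by (simp add: diff_diff_eq)
      qed
      also have "\<dots> \<le> A * (E * exp (\<theta> * \<bar>x\<bar>) - 1)"
      proof -
        have "6 * k * \<bar>d + x\<bar> / s\<^sup>2 \<le> 6 * k * (\<bar>d\<bar> + \<bar>x\<bar>) / s\<^sup>2"
          using k by (intro divide_right_mono mult_left_mono) auto
        also have "\<dots> = 6 * k * \<bar>d\<bar> / s\<^sup>2 + \<theta> * \<bar>x\<bar>" by (simp add: \<theta>_def distrib_left add_divide_distrib)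
        finally have "exp (6 * k * \<bar>d + x\<bar> / s\<^sup>2) \<le> E * exp (\<theta> * \<bar>x\<bar>)"
          unfolding E_def mult_exp_exp by simp
        then show ?thesis using A0 by (intro mult_left_mono) auto
      qed
      finally show ?thesis using far0[of x] by linarith
    next
      case far: True
      have "1 * 1 \<le> E * exp (\<theta> * \<bar>x\<bar>)" using E1 \<theta> by (intro mult_mono) auto
      then have "0 \<le> A * (E * exp (\<theta> * \<bar>x\<bar>) - 1)" using A0 by simp
      then show ?thesis using Q_far[OF far] by linarith
    qed
    then have "(\<integral>x. Q x \<partial>S) \<le> (\<integral>x. A * (E * exp (\<theta> * \<bar>x\<bar>) - 1) + far x \<partial>S)"
      using i\<theta> ifar iQ by (intro integral_mono) auto
    also have "\<dots> = A * (E * (\<integral>x. exp (\<theta> * \<bar>x\<bar>) \<partial>S) - 1) + (\<integral>x. far x \<partial>S)"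
      using i\<theta> ifar prob_space by simp
    also have "\<dots> \<le> A * (E * M - 1) + k * t\<^sup>2 * (4 * exp W)"
      using moments(3)[OF \<theta>] A0 E1 far_int unfolding M_def
      by (intro add_mono mult_left_mono diff_right_mono) auto
    also have "\<dots> \<le> A * (E * M - 1) + k * t\<^sup>2 * (1 + 4 * exp W)" using k by (simp add: distrib_left)
    finally show ?thesis .
  next
    case False
    \<comment> \<open>At strike \<open>k / 2\<close> the Gaussian exponent is
      \<open>k\<^sup>2 / (8 * s\<^sup>2)\<close>; the threshold 16 is chosen so that this exceeds
      \<open>2 * L\<close>. Drift and small jumps up to \<open>k / 4\<close> each leave the strike
      at or above \<open>k / 2\<close>.\<close>
    have half: "gauss_call s (k / 2) \<le> k * t\<^sup>2"
    proof (cases "s = 0")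
      case True
      then show ?thesis using k by (simp add: gauss_call_0)
    next
      case nz: False
      then have s0: "0 < s" and kL: "16 * s\<^sup>2 * L < k\<^sup>2" using s False by auto
      have "gauss_call s (k / 2) \<le> s * exp (- (k / 2 / s)\<^sup>2 / 2)" using s0 k by (intro gauss_call_le_exp) auto
      also have "\<dots> \<le> s * exp (- (2 * L))"
      proof -
        have "2 * L \<le> (k / 2 / s)\<^sup>2 / 2" using kL s0 by (simp add: power_divide field_simps)
        then show ?thesis using s0 by simp
      qed
      also have "exp (- (2 * L)) = t\<^sup>2" using L by (simp add: power2_eq_square mult_exp_exp)
      also have "s * t\<^sup>2 \<le> k * t\<^sup>2" using s by (intro mult_right_mono) auto
      finally show ?thesis .
    qed
    have "Q x \<le> k * t\<^sup>2 + far x" for x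
    proof (cases "k / 4 < \<bar>x\<bar>")
      case False
      have "gauss_call s (k - d - x) \<le> gauss_call s (k / 2)" "A \<le> gauss_call s (k / 2)"
        unfolding A_def using d False k by (auto intro!: gauss_call_antimono simp: abs_if split: if_splits)
      then have "Q x \<le> gauss_call s (k / 2)"
        unfolding Q_def using A0 gauss_call_nonneg[of s "k - d - x"] by linarith
      then show ?thesis using half far0[of x] by linarith
    next
      case True
      have "0 \<le> k * t\<^sup>2" using k by simp
      then show ?thesis using Q_far[OF True] by linarith
    qed
    then have "(\<integral>x. Q x \<partial>S) \<le> (\<integral>x. k * t\<^sup>2 + far x \<partial>S)"
      using ifar iQ by (intro integral_mono) auto
    also have "\<dots> = k * t\<^sup>2 + (\<integral>x. far x \<partial>S)" using ifar prob_space by simp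
    also have "\<dots> \<le> k * t\<^sup>2 * (1 + 4 * exp W)" using far_int by (simp add: distrib_left)
    \<comment> \<open>Here the Gaussian term only has to be nonnegative. For \<open>s = 0\<close>
      the quotient inside \<open>E\<close> is 0 by the convention on division, and
      \<open>E \<ge> 1\<close> still holds.\<close>
    also have "\<dots> \<le> A * (E * M - 1) + k * t\<^sup>2 * (1 + 4 * exp W)"
    proof -
      have "1 * 1 \<le> E * M" using E1 M1 by (intro mult_mono) auto
      then show ?thesis using A0 by simp
    qed
    finally show ?thesis .
  qed
  finally show "\<bar>(\<integral>x. gauss_call s (k - d - x) \<partial>S) - gauss_call s k\<bar> \<le>
      gauss_call s k * (exp (6 * k * \<bar>d\<bar> / s\<^sup>2) * (1 + e + 2 * C * (exp W - 1)) - 1) + k * t\<^sup>2 * (1 + 4 * exp W)"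
    unfolding A_def E_def M_def .
qed

section \<open>Short-time asymptotics\<close>

lemma tendsto_powr_at_right_0: "0 < p \<Longrightarrow> ((\<lambda>x::real. x powr p) \<longlongrightarrow> 0) (at_right 0)"
  by (intro tendsto_zero_powrI[where b=p] tendsto_ident_at tendsto_const)
     (auto simp: eventually_at_filter)

text \<open>The logarithm is bounded by a multiple of \<open>t powr (- p / 4)\<close>, so its square
  uses up one half of the power.\<close>

lemma ln_squared_powr_tendsto_0:
  fixes p :: real
  assumes p: "0 < p"
  shows "((\<lambda>t. (ln t)\<^sup>2 * t powr p) \<longlongrightarrow> 0) (at_right 0)"
proof (rule tendsto_sandwich[OF _ _ tendsto_const])
  have "eventually (\<lambda>t::real. 0 < t \<and> t < 1) (at_right 0)"
    by (auto simp: eventually_at_right_field intro!: exI[of _ 1])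
  then show "eventually (\<lambda>t. (ln t)\<^sup>2 * t powr p \<le> (16 / p\<^sup>2) * t powr (p / 2)) (at_right 0)"
  proof eventually_elim
    case (elim t)
    have "ln (1 / t) \<le> (1 / t) powr (p / 4) / (p / 4)"
      using elim p by (intro ln_powr_bound) auto
    also have "(1 / t) powr (p / 4) = t powr (- (p / 4))"
      using elim by (simp add: powr_def ln_div)
    finally have "- ln t \<le> 4 / p * t powr (- (p / 4))" using elim by (simp add: ln_div mult.commute)
    then have "(- ln t)\<^sup>2 \<le> (4 / p * t powr (- (p / 4)))\<^sup>2"
      using elim by (intro power_mono) auto
    also have "\<dots> = 16 / p\<^sup>2 * (t powr (- (p / 4)) * t powr (- (p / 4)))"
      by (simp add: power2_eq_square)
    also have "t powr (- (p / 4)) * t powr (- (p / 4)) = t powr (- (p / 2))"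
      unfolding powr_add[symmetric] by simp
    finally have "(ln t)\<^sup>2 * t powr p \<le> 16 / p\<^sup>2 * t powr (- (p / 2)) * t powr p"
      by (intro mult_right_mono) auto
    also have "\<dots> = 16 / p\<^sup>2 * t powr (p / 2)"
      unfolding mult.assoc powr_add[symmetric] by simp
    finally show ?case .
  qed
  show "eventually (\<lambda>t. 0 \<le> (ln t)\<^sup>2 * t powr p) (at_right 0)" by (simp add: always_eventually)
  have "((\<lambda>t. 16 / p\<^sup>2 * t powr (p / 2)) \<longlongrightarrow> 16 / p\<^sup>2 * 0) (at_right 0)"
    using p by (intro tendsto_mult_left tendsto_powr_at_right_0) auto
  then show "((\<lambda>t. 16 / p\<^sup>2 * t powr (p / 2)) \<longlongrightarrow> 0) (at_right 0)" by simp
qed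

lemma asymp_equiv_relative_error:
  fixes f g :: "'a \<Rightarrow> real"
  assumes pos: "eventually (\<lambda>x. 0 < g x) F"
    and le: "\<And>e. 0 < e \<Longrightarrow> eventually (\<lambda>x. \<bar>f x - g x\<bar> \<le> e * g x) F"
  shows "f \<sim>[F] g"
proof (rule asymp_equivI')
  show "((\<lambda>x. f x / g x) \<longlongrightarrow> 1) F"
  proof (rule tendstoI)
    fix e :: real assume "0 < e"
    then have "eventually (\<lambda>x. \<bar>f x - g x\<bar> \<le> e / 2 * g x) F" by (intro le) simp
    with pos show "eventually (\<lambda>x. dist (f x / g x) 1 < e) F"
    proof eventually_elim
      case (elim x)
      have "dist (f x / g x) 1 = \<bar>f x - g x\<bar> / g x"
        using elim by (simp add: dist_real_def field_simps)
      also have "\<dots> \<le> e / 2" using elim by (simp add: field_simps)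
      also have "\<dots> < e" using \<open>0 < e\<close> by simp
      finally show ?case .
    qed
  qed
qed

text \<open>A one-sided setting phrased through laws only, so that it can be instantiated both with
  the laws of \<open>X\<close> and with those of \<open>- X\<close>. The pair \<open>a\<close>,
  \<open>c\<close> describes the right tail, the one that produces the power term;
  \<open>\<alpha>\<close> bounds both tails and may exceed \<open>a\<close>. The exponent
  \<open>\<beta>\<close> is the polynomial margin left by the strike condition.\<close>

locale short_time_levy =
  fixes \<mu> :: "real \<Rightarrow> real measure" and \<sigma> \<gamma> a \<alpha> c C \<beta> :: real and \<nu> :: "real measure" and k :: "real \<Rightarrow> real"
  assumes \<sigma>0: "0 \<le> \<sigma>" and \<nu>: "levy_measure \<nu>"
    and rd: "\<And>t. 0 < t \<Longrightarrow> real_distribution (\<mu> t)"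
    and ch: "\<And>t u. 0 < t \<Longrightarrow> char (\<mu> t) u = exp (complex_of_real t * levy_exponent (\<sigma>\<^sup>2) \<nu> \<gamma> u)"
    and fin: "(\<integral>\<^sup>+z. ennreal (exp \<bar>z\<bar>) * indicator {z. 1 < \<bar>z\<bar>} z \<partial>\<nu>) < \<infinity>"
    and tail: "((\<lambda>x. x powr a * measure \<nu> {x<..}) \<longlongrightarrow> c) (at_right 0)"
    and c: "0 < c" and a: "1 < a" "a \<le> \<alpha>" "\<alpha> < 2" and C: "0 \<le> C"
    and abs_tail: "\<And>x. 0 < x \<Longrightarrow> x \<le> 1 \<Longrightarrow> emeasure \<nu> {z. x < \<bar>z\<bar>} \<le> ennreal (C * x powr (- \<alpha>))"
    and \<beta>: "0 < \<beta>" "\<beta> \<le> 1" and k\<beta>: "eventually (\<lambda>t. t * k t powr (- \<alpha>) \<le> t powr \<beta>) (at_right 0)"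
    and kpos: "\<And>t. 0 < t \<Longrightarrow> 0 < k t" and k0: "(k \<longlongrightarrow> 0) (at_right 0)"
    and sk: "((\<lambda>t. \<sigma> * sqrt t / k t) \<longlongrightarrow> 0) (at_right 0)"
begin

text \<open>The factor \<open>\<beta> / 200\<close> makes \<open>exp (\<theta> h) \<le> t powr (- \<beta> / 2)\<close> on the range
  \<open>\<theta> \<le> 100 log (1 / t) / k\<close> needed for the small jumps.\<close>

definition "h t = \<beta> / 200 * k t"
definition "A t = gauss_call (\<sigma> * sqrt t) (k t)"
definition "B t = t * k t powr (1 - a) * c / (a - 1)"
definition "I x = (\<integral>z. max (z - x) 0 \<partial>\<nu>)"
definition "m t = measure \<nu> {h t<..}"
definition "l t = t * measure \<nu> {z. h t < \<bar>z\<bar>}"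
definition "b t = \<gamma> - (\<integral>z. z * indicator ({- 1..1} - {- h t..h t}) z \<partial>\<nu>)"
text \<open>A bound for the logarithm of the exponential moments of the small jumps: 10000 is the
  square of 100 in the range of \<open>\<theta>\<close>, \<open>2 * C / (2 - \<alpha>)\<close> is
  the second-moment constant, and \<open>\<beta> / 2\<close> is the part of the margin not spent on
  \<open>exp (\<bar>\<theta>\<bar> * h t)\<close>.\<close>

definition "W t = 10000 * (2 * C / (2 - \<alpha>)) * ((ln t)\<^sup>2 * t powr (\<beta> / 2))"

lemma sets_\<nu> [simp, measurable_cong]: "sets \<nu> = sets borel"
  using \<nu> by (rule sets_levy_measure)

lemma ev_pos: "eventually (\<lambda>t::real. 0 < t) (at_right 0)"
  by (simp add: eventually_at_filter)

lemma ev_basic: "eventually (\<lambda>t. 0 < t \<and> t < 1 \<and> 1 \<le> - ln t \<and> 0 < k t \<and> k t < 1 \<and> 0 < h t \<and> h t \<le> 1 \<and> h t \<le> k t) (at_right 0)"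
proof -
  have 1: "eventually (\<lambda>t::real. t < exp (- 1)) (at_right 0)"
    by (auto simp: eventually_at_right_field intro!: exI[of _ "exp (- 1)"])
  have 2: "eventually (\<lambda>t. k t < 1) (at_right 0)" using k0 by (intro order_tendstoD) auto
  from ev_pos 1 2 show ?thesis
  proof eventually_elim
    case (elim t)
    have "ln t \<le> ln (exp (- 1))" using elim by (subst ln_le_cancel_iff) auto
    then have "1 \<le> - ln t" by simp
    moreover have "exp (- 1) < (1::real)" by simp
    then have "t < 1" using elim by linarith
    moreover have "\<beta> / 200 * k t \<le> 1 * k t" using \<beta> kpos[of t] elim by (intro mult_right_mono) auto
    moreover from this have "\<beta> / 200 * k t \<le> 1" using elim by linarith
    moreover have "0 < \<beta> / 200 * k t" using \<beta> kpos[of t] elim by simp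
    ultimately show ?case using elim kpos[of t] unfolding h_def by linarith
  qed
qed

lemma k_powr_tendsto_0: "0 < p \<Longrightarrow> ((\<lambda>t. k t powr p) \<longlongrightarrow> 0) (at_right 0)"
  using k0 by (rule tendsto_zero_powrI[OF _ tendsto_const])
     (use ev_basic in \<open>auto elim!: eventually_mono\<close>)

lemma k_at_right: "filterlim k (at_right 0) (at_right 0)"
  using k0 ev_basic by (auto simp: filterlim_at elim!: eventually_mono)

lemma h_at_right: "filterlim h (at_right 0) (at_right 0)"
proof -
  have "((\<lambda>t. \<beta> / 200 * k t) \<longlongrightarrow> \<beta> / 200 * 0) (at_right 0)" by (intro tendsto_mult_left k0)
  then have "(h \<longlongrightarrow> 0) (at_right 0)" by (simp add: h_def[abs_def])
  then show ?thesis using ev_basic by (auto simp: filterlim_at elim!: eventually_mono)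
qed

lemma B_pos: "0 < t \<Longrightarrow> 0 < B t"
  using kpos[of t] c a by (simp add: B_def)

lemma W_tendsto: "(W \<longlongrightarrow> 0) (at_right 0)"
proof -
  have "((\<lambda>t. 10000 * (2 * C / (2 - \<alpha>)) * ((ln t)\<^sup>2 * t powr (\<beta> / 2))) \<longlongrightarrow> 10000 * (2 * C / (2 - \<alpha>)) * 0) (at_right 0)"
    using \<beta> by (intro tendsto_mult_left ln_squared_powr_tendsto_0) auto
  then show ?thesis by (simp add: W_def[abs_def])
qed

lemma W_nonneg: "0 \<le> W t"
  using C a by (simp add: W_def)

text \<open>The second moment of the jumps below \<open>h\<close> is of order
  \<open>k powr (2 - \<alpha>)\<close>, so \<open>\<theta>\<^sup>2\<close> of order
  \<open>(ln t / k)\<^sup>2\<close> leaves \<open>(ln t)\<^sup>2 * t * k powr (- \<alpha>)\<close>.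
  The strike condition bounds \<open>t * k powr (- \<alpha>)\<close> by
  \<open>t powr \<beta>\<close>, half of which compensates the factor
  \<open>exp (\<bar>\<theta>\<bar> * h t)\<close>.\<close>

lemma ev_mgf_exponent: "eventually (\<lambda>t. \<forall>\<theta>. \<bar>\<theta>\<bar> \<le> 100 * (- ln t) / k t \<longrightarrow>
   t * \<theta>\<^sup>2 * exp (\<bar>\<theta>\<bar> * h t) * (\<integral>z. z\<^sup>2 * indicator {- h t..h t} z \<partial>\<nu>) \<le> W t) (at_right 0)"
  using ev_basic k\<beta>
proof eventually_elim
  case (elim t)
  define L where "L = - ln t"
  define V where "V = (\<integral>z. z\<^sup>2 * indicator {- h t..h t} z \<partial>\<nu>)"
  from elim have t: "0 < t" "t < 1" "1 \<le> L" "0 < k t" "k t < 1" "0 < h t" "h t \<le> 1" by (auto simp: L_def)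
  have V0: "0 \<le> V" unfolding V_def by (rule integral_nonneg_AE) auto
  have V: "V \<le> 2 * C / (2 - \<alpha>) * k t powr (2 - \<alpha>)"
  proof -
    have "(\<integral>\<^sup>+z. ennreal (z\<^sup>2 * indicator {- h t..h t} z) \<partial>\<nu>) = (\<integral>\<^sup>+z. ennreal (z\<^sup>2) * indicator {- h t..h t} z \<partial>\<nu>)"
      by (intro nn_integral_cong) (auto simp: indicator_def)
    also have "\<dots> \<le> ennreal (2 * C / (2 - \<alpha>) * h t powr (2 - \<alpha>))"
      by (rule small_jump_second_moment[OF \<nu> _ _ _ C abs_tail]) (use t a in auto)
    finally have "V \<le> 2 * C / (2 - \<alpha>) * h t powr (2 - \<alpha>)"
      unfolding V_def using C a by (intro integral_real_bounded) auto
    also have "\<dots> \<le> 2 * C / (2 - \<alpha>) * k t powr (2 - \<alpha>)"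
      using elim a C by (intro mult_left_mono powr_mono2) auto
    finally show ?thesis .
  qed
  show ?case
  proof (intro allI impI)
    fix \<theta> assume "\<bar>\<theta>\<bar> \<le> 100 * (- ln t) / k t"
    then have \<theta>: "\<bar>\<theta>\<bar> \<le> 100 * L / k t" by (simp add: L_def)
    then have \<theta>2: "\<theta>\<^sup>2 \<le> (100 * L / k t)\<^sup>2" by (rule abs_le_square_iff[THEN iffD1, of \<theta>, OF order_trans[OF _ abs_ge_self]])
    have "\<bar>\<theta>\<bar> * h t \<le> 100 * L / k t * h t" using \<theta> t by (intro mult_right_mono) auto
    also have "\<dots> = \<beta> / 2 * L" using t by (simp add: h_def)
    finally have "exp (\<bar>\<theta>\<bar> * h t) \<le> exp (\<beta> / 2 * L)" by simp
    also have "\<dots> = t powr (- (\<beta> / 2))" using t by (simp add: powr_def L_def)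
    finally have ex: "exp (\<bar>\<theta>\<bar> * h t) \<le> t powr (- (\<beta> / 2))" .
    have "t * \<theta>\<^sup>2 * exp (\<bar>\<theta>\<bar> * h t) * V \<le> t * (100 * L / k t)\<^sup>2 * t powr (- (\<beta> / 2)) * (2 * C / (2 - \<alpha>) * k t powr (2 - \<alpha>))"
      using t V0 by (intro mult_mono V ex \<theta>2 mult_nonneg_nonneg) auto
    also have "\<dots> = 10000 * (2 * C / (2 - \<alpha>)) * L\<^sup>2 * t powr (- (\<beta> / 2)) * (t * (k t powr (2 - \<alpha>) / (k t)\<^sup>2))"
    proof -
      have "t * (100 * L / k t)\<^sup>2 * q * (D * K) = 10000 * D * L\<^sup>2 * q * (t * (K / (k t)\<^sup>2))" for q D K
        by (simp add: power_divide power_mult_distrib)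
      then show ?thesis .
    qed
    also have "k t powr (2 - \<alpha>) / (k t)\<^sup>2 = k t powr (- \<alpha>)"
      using t by (simp add: powr_diff powr_minus powr_numeral field_simps)
    also have "10000 * (2 * C / (2 - \<alpha>)) * L\<^sup>2 * t powr (- (\<beta> / 2)) * (t * k t powr (- \<alpha>)) \<le>
       10000 * (2 * C / (2 - \<alpha>)) * L\<^sup>2 * t powr (- (\<beta> / 2)) * t powr \<beta>"
      using elim C a by (intro mult_left_mono) auto
    also have "\<dots> = W t"
      unfolding W_def L_def by (simp add: mult.assoc flip: powr_add)
    finally show "t * \<theta>\<^sup>2 * exp (\<bar>\<theta>\<bar> * h t) * (\<integral>z. z\<^sup>2 * indicator {- h t..h t} z \<partial>\<nu>) \<le> W t"
      unfolding V_def .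
  qed
qed

definition "D1 = C * \<alpha> / (\<alpha> - 1) * (\<beta> / 200) powr (1 - \<alpha>)"

lemma D1_nonneg: "0 \<le> D1" using C a by (simp add: D1_def)

text \<open>The drift may diverge, since it has taken over the mean of the jumps between
  \<open>h\<close> and 1. As \<open>h\<close> is a fixed fraction of \<open>k\<close>, the constant
  \<open>D1\<close> expresses the rate in terms of \<open>k\<close>.\<close>

lemma ev_drift: "eventually (\<lambda>t. \<bar>b t\<bar> \<le> \<bar>\<gamma>\<bar> + D1 * k t powr (1 - \<alpha>)) (at_right 0)"
  using ev_basic
proof eventually_elim
  case (elim t)
  let ?f = "\<lambda>z. z * indicator ({- 1..1} - {- h t..h t}) z"
  have "\<bar>\<integral>z. ?f z \<partial>\<nu>\<bar> \<le> (\<integral>z. \<bar>?f z\<bar> \<partial>\<nu>)" by (rule integral_abs_bound)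
  also have "\<dots> \<le> C * \<alpha> / (\<alpha> - 1) * h t powr (1 - \<alpha>)"
  proof (rule integral_real_bounded)
    have "(\<integral>\<^sup>+z. ennreal \<bar>?f z\<bar> \<partial>\<nu>) = (\<integral>\<^sup>+z. ennreal (\<bar>z\<bar> * indicator ({- 1..1} - {- h t..h t}) z) \<partial>\<nu>)"
      by (intro nn_integral_cong) (auto simp: abs_mult indicator_def)
    also have "\<dots> \<le> ennreal (C * \<alpha> / (\<alpha> - 1) * h t powr (1 - \<alpha>))"
      by (rule intermediate_jump_first_moment[OF \<nu> _ _ _ C abs_tail]) (use elim a in auto)
    finally show "(\<integral>\<^sup>+z. ennreal \<bar>?f z\<bar> \<partial>\<nu>) \<le> ennreal (C * \<alpha> / (\<alpha> - 1) * h t powr (1 - \<alpha>))" .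
  qed (use C a in auto)
  also have "\<dots> = D1 * k t powr (1 - \<alpha>)"
    using elim \<beta> unfolding D1_def h_def by (subst powr_mult) auto
  finally show ?case unfolding b_def by linarith
qed

lemma t_over_k: "eventually (\<lambda>t. t / k t \<le> t powr \<beta>) (at_right 0)"
  using ev_basic k\<beta>
proof eventually_elim
  case (elim t)
  have "k t powr (- 1) \<le> k t powr (- \<alpha>)" using elim a by (intro powr_mono') auto
  then have "t * (k t powr (- 1)) \<le> t * k t powr (- \<alpha>)" using elim by (intro mult_left_mono) auto
  then have "t * k t powr (- 1) \<le> t powr \<beta>" using elim by linarith
  then show ?case using elim by (simp add: powr_neg_one)
qed

text \<open>The worst part is \<open>t * k powr (1 - \<alpha>) / k\<close>, which is exactly the
  quantity \<open>t * k powr (- \<alpha>)\<close> of the strike condition.\<close>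

lemma drift_over_k: "((\<lambda>t. t * \<bar>b t\<bar> / k t) \<longlongrightarrow> 0) (at_right 0)"
proof (rule tendsto_sandwich[OF _ _ tendsto_const])
  show "eventually (\<lambda>t. 0 \<le> t * \<bar>b t\<bar> / k t) (at_right 0)"
    using ev_basic by eventually_elim auto
  show "eventually (\<lambda>t. t * \<bar>b t\<bar> / k t \<le> (\<bar>\<gamma>\<bar> + D1) * t powr \<beta>) (at_right 0)"
    using ev_basic ev_drift k\<beta> t_over_k
  proof eventually_elim
    case (elim t)
    have "t * \<bar>b t\<bar> / k t \<le> t * (\<bar>\<gamma>\<bar> + D1 * k t powr (1 - \<alpha>)) / k t"
      using elim by (intro divide_right_mono mult_left_mono) auto
    also have "\<dots> = \<bar>\<gamma>\<bar> * (t / k t) + D1 * (t * (k t powr (1 - \<alpha>) / k t))"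
      by (simp add: distrib_left add_divide_distrib mult_ac)
    also have "k t powr (1 - \<alpha>) / k t = k t powr (- \<alpha>)"
      using elim by (simp add: powr_diff powr_minus field_simps)
    also have "\<bar>\<gamma>\<bar> * (t / k t) + D1 * (t * k t powr (- \<alpha>)) \<le> \<bar>\<gamma>\<bar> * t powr \<beta> + D1 * t powr \<beta>"
      using elim D1_nonneg by (intro add_mono mult_left_mono) auto
    finally show ?case by (simp add: distrib_right)
  qed
  have "((\<lambda>t. (\<bar>\<gamma>\<bar> + D1) * t powr \<beta>) \<longlongrightarrow> (\<bar>\<gamma>\<bar> + D1) * 0) (at_right 0)"
    using \<beta> by (intro tendsto_mult_left tendsto_powr_at_right_0)
  then show "((\<lambda>t. (\<bar>\<gamma>\<bar> + D1) * t powr \<beta>) \<longlongrightarrow> 0) (at_right 0)" by simp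
qed

text \<open>The time cancels, and what remains is of order \<open>k * \<bar>b\<bar>\<close>, at most
  \<open>k powr (2 - \<alpha>)\<close> up to constants and a term of order \<open>k\<close>. Hence
  the drift moves the Gaussian price only by a factor tending to 1. For \<sigma> = 0 the quotient is
  0 by convention.\<close>

lemma gauss_shift_exponent: "((\<lambda>t. 6 * k t * \<bar>t * b t\<bar> / (\<sigma> * sqrt t)\<^sup>2) \<longlongrightarrow> 0) (at_right 0)"
proof (rule tendsto_sandwich[OF _ _ tendsto_const])
  show "eventually (\<lambda>t. 0 \<le> 6 * k t * \<bar>t * b t\<bar> / (\<sigma> * sqrt t)\<^sup>2) (at_right 0)"
    using ev_basic by eventually_elim auto
  show "eventually (\<lambda>t. 6 * k t * \<bar>t * b t\<bar> / (\<sigma> * sqrt t)\<^sup>2 \<le> 6 / \<sigma>\<^sup>2 * (\<bar>\<gamma>\<bar> * k t + D1 * k t powr (2 - \<alpha>))) (at_right 0)"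
    using ev_basic ev_drift
  proof eventually_elim
    case (elim t)
    have "6 * k t * \<bar>t * b t\<bar> / (\<sigma> * sqrt t)\<^sup>2 = 6 / \<sigma>\<^sup>2 * (k t * \<bar>b t\<bar>)"
      using elim by (simp add: power_mult_distrib abs_mult)
    also have "\<dots> \<le> 6 / \<sigma>\<^sup>2 * (k t * (\<bar>\<gamma>\<bar> + D1 * k t powr (1 - \<alpha>)))"
      using elim by (intro mult_left_mono) auto
    also have "k t * (\<bar>\<gamma>\<bar> + D1 * k t powr (1 - \<alpha>)) = \<bar>\<gamma>\<bar> * k t + D1 * (k t * k t powr (1 - \<alpha>))"
      by (simp add: distrib_left mult_ac)
    also have "k t * k t powr (1 - \<alpha>) = k t powr (2 - \<alpha>)"
      using elim powr_add[of "k t" 1 "1 - \<alpha>"] by simp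
    finally show ?case .
  qed
  have "((\<lambda>t. 6 / \<sigma>\<^sup>2 * (\<bar>\<gamma>\<bar> * k t + D1 * k t powr (2 - \<alpha>))) \<longlongrightarrow> 6 / \<sigma>\<^sup>2 * (\<bar>\<gamma>\<bar> * 0 + D1 * 0)) (at_right 0)"
    using a by (intro tendsto_mult_left tendsto_add k0 k_powr_tendsto_0) auto
  then show "((\<lambda>t. 6 / \<sigma>\<^sup>2 * (\<bar>\<gamma>\<bar> * k t + D1 * k t powr (2 - \<alpha>))) \<longlongrightarrow> 0) (at_right 0)" by simp
qed

text \<open>This is the room for additive errors: any term of order \<open>t\<close> is negligible
  against \<open>B\<close>, however small the Gaussian price is.\<close>

lemma t_over_B: "((\<lambda>t. t / B t) \<longlongrightarrow> 0) (at_right 0)"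
proof -
  have "((\<lambda>t. k t powr (a - 1) * ((a - 1) / c)) \<longlongrightarrow> 0 * ((a - 1) / c)) (at_right 0)"
    using a by (intro tendsto_mult_right k_powr_tendsto_0) auto
  moreover have "eventually (\<lambda>t. k t powr (a - 1) * ((a - 1) / c) = t / B t) (at_right 0)"
    using ev_basic
  proof eventually_elim
    case (elim t)
    have "k t powr (a - 1) * k t powr (1 - a) = 1" using elim by (simp flip: powr_add)
    then show ?case using elim a c by (simp add: B_def field_simps)
  qed
  ultimately show ?thesis by (simp add: tendsto_cong)
qed

lemma quadratic_remainder: "((\<lambda>t. k t * t\<^sup>2 * (1 + 4 * exp (W t)) / B t) \<longlongrightarrow> 0) (at_right 0)"
proof -
  have "((\<lambda>t. (k t * t * (1 + 4 * exp (W t))) * (t / B t)) \<longlongrightarrow> (0 * 0 * (1 + 4 * exp 0)) * 0) (at_right 0)"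
    by (intro tendsto_mult tendsto_add tendsto_exp tendsto_const k0 tendsto_ident_at W_tendsto t_over_B)
  then show ?thesis by (simp add: power2_eq_square mult_ac)
qed

lemma fin1: "(\<integral>\<^sup>+z. ennreal \<bar>z\<bar> * indicator {z. 1 < \<bar>z\<bar>} z \<partial>\<nu>) < \<infinity>"
proof -
  have "(\<integral>\<^sup>+z. ennreal \<bar>z\<bar> * indicator {z. 1 < \<bar>z\<bar>} z \<partial>\<nu>) \<le> (\<integral>\<^sup>+z. ennreal (exp \<bar>z\<bar>) * indicator {z. 1 < \<bar>z\<bar>} z \<partial>\<nu>)"
  proof (intro nn_integral_mono mult_right_mono ennreal_leI)
    fix z :: real
    show "\<bar>z\<bar> \<le> exp \<bar>z\<bar>" using exp_ge_add_one_self[of "\<bar>z\<bar>"] by linarith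
  qed auto
  then show ?thesis using fin by (rule le_less_trans)
qed

lemma integrable_overshoot: "0 < x \<Longrightarrow> integrable \<nu> (\<lambda>z. max (z - x) 0)"
  by (rule integrated_tail_asymp(1)[OF \<nu> a(1) less_imp_le[OF c] tail fin1])

lemma I_asymp: "((\<lambda>x. x powr (a - 1) * I x) \<longlongrightarrow> c / (a - 1)) (at_right 0)"
  unfolding I_def by (rule integrated_tail_asymp(2)[OF \<nu> a(1) less_imp_le[OF c] tail fin1])

lemma I_nonneg: "0 \<le> I x" unfolding I_def by (rule integral_nonneg_AE) auto

lemma one_jump_asymp: "((\<lambda>t. t * I (k t) / B t) \<longlongrightarrow> 1) (at_right 0)"
proof -
  have "((\<lambda>t. (k t powr (a - 1) * I (k t)) * ((a - 1) / c)) \<longlongrightarrow> (c / (a - 1)) * ((a - 1) / c)) (at_right 0)"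
    by (intro tendsto_mult_right filterlim_compose[OF I_asymp k_at_right])
  moreover have "(c / (a - 1)) * ((a - 1) / c) = 1" using a c by simp
  moreover have "eventually (\<lambda>t. (k t powr (a - 1) * I (k t)) * ((a - 1) / c) = t * I (k t) / B t) (at_right 0)"
    using ev_basic
  proof eventually_elim
    case (elim t)
    have "k t powr (a - 1) = 1 / k t powr (1 - a)" using elim by (simp add: powr_minus_divide[symmetric])
    then show ?case using elim a c by (simp add: B_def field_simps)
  qed
  ultimately show ?thesis by (simp add: tendsto_cong)
qed

text \<open>The error terms involve the tail and its integral at \<open>h\<close>, while
  \<open>B\<close> is expressed at \<open>k\<close>; since \<open>h / k\<close> is fixed, the
  passage costs a power of \<open>\<beta> / 200\<close>. The added ones are slack over the limits
  \<open>c\<close> and \<open>c / (a - 1)\<close>. \<open>K1\<close> controls the blurring of one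
  big jump, \<open>K2\<close> the occurrence of several.\<close>

definition "K1 = (c + 1) * (\<beta> / 200) powr (- a) * ((a - 1) / c)"
definition "K2 = (c / (a - 1) + 1 + (c + 1)) * (\<beta> / 200) powr (1 - a) * ((a - 1) / c)"

lemma K_nonneg: "0 \<le> K1" "0 \<le> K2"
  using a c by (auto simp: K1_def K2_def)

lemma ev_m: "eventually (\<lambda>t. m t \<le> (c + 1) * h t powr (- a)) (at_right 0)"
proof -
  have "((\<lambda>t. h t powr a * m t) \<longlongrightarrow> c) (at_right 0)"
    unfolding m_def by (rule filterlim_compose[OF tail h_at_right])
  then have "eventually (\<lambda>t. h t powr a * m t < c + 1) (at_right 0)" by (rule order_tendstoD) simp
  then show ?thesis using ev_basic by eventually_elim (simp add: powr_minus field_simps)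
qed

lemma ev_K1: "eventually (\<lambda>t. t * k t * m t \<le> K1 * B t) (at_right 0)"
  using ev_m ev_basic
proof eventually_elim
  case (elim t)
  have "t * k t * m t \<le> t * k t * ((c + 1) * h t powr (- a))" using elim by (intro mult_left_mono) auto
  also have "h t powr (- a) = (\<beta> / 200) powr (- a) * k t powr (- a)"
    unfolding h_def by (rule powr_mult)
  also have "t * k t * ((c + 1) * ((\<beta> / 200) powr (- a) * k t powr (- a))) =
     (c + 1) * (\<beta> / 200) powr (- a) * (t * (k t * k t powr (- a)))" by (simp only: mult_ac)
  also have "k t * k t powr (- a) = k t powr (1 - a)" using elim powr_add[of "k t" 1 "- a"] by simp
  also have "(c + 1) * (\<beta> / 200) powr (- a) * (t * k t powr (1 - a)) = K1 * B t"
    using a c unfolding K1_def B_def by simp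
  finally show ?case .
qed

lemma ev_K2: "eventually (\<lambda>t. t * (I (h t) + h t * m t) \<le> K2 * B t) (at_right 0)"
proof -
  have "((\<lambda>t. h t powr (a - 1) * I (h t)) \<longlongrightarrow> c / (a - 1)) (at_right 0)"
    by (rule filterlim_compose[OF I_asymp h_at_right])
  then have "eventually (\<lambda>t. h t powr (a - 1) * I (h t) < c / (a - 1) + 1) (at_right 0)"
    by (rule order_tendstoD) simp
  then show ?thesis using ev_m ev_basic
  proof eventually_elim
    case (elim t)
    have i: "h t powr (a - 1) * h t powr (1 - a) = 1" using elim by (simp flip: powr_add)
    have "I (h t) = (h t powr (a - 1) * I (h t)) * h t powr (1 - a)"
      using i by (simp add: mult_ac)
    also have "\<dots> \<le> (c / (a - 1) + 1) * h t powr (1 - a)" using elim by (intro mult_right_mono) auto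
    finally have 1: "I (h t) \<le> (c / (a - 1) + 1) * h t powr (1 - a)" .
    have "h t * m t \<le> h t * ((c + 1) * h t powr (- a))" using elim by (intro mult_left_mono) auto
    also have "\<dots> = (c + 1) * (h t * h t powr (- a))" by simp
    also have "h t * h t powr (- a) = h t powr (1 - a)" using elim powr_add[of "h t" 1 "- a"] by simp
    finally have "I (h t) + h t * m t \<le> (c / (a - 1) + 1 + (c + 1)) * h t powr (1 - a)"
      using 1 by (simp only: distrib_right)
    also have "h t powr (1 - a) = (\<beta> / 200) powr (1 - a) * k t powr (1 - a)"
      unfolding h_def by (rule powr_mult)
    finally have "t * (I (h t) + h t * m t) \<le> t * ((c / (a - 1) + 1 + (c + 1)) * ((\<beta> / 200) powr (1 - a) * k t powr (1 - a)))"
      using elim by (intro mult_left_mono) auto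
    also have "\<dots> = K2 * B t" using a c unfolding K2_def B_def by simp
    finally show ?case .
  qed
qed

text \<open>The expected number of jumps beyond \<open>h\<close> is of order
  \<open>t * k powr (- \<alpha>)\<close>, again the quantity of the strike condition.\<close>

lemma l_tendsto: "(l \<longlongrightarrow> 0) (at_right 0)"
proof (rule tendsto_sandwich[OF _ _ tendsto_const])
  show "eventually (\<lambda>t. 0 \<le> l t) (at_right 0)" using ev_basic by eventually_elim (simp add: l_def)
  show "eventually (\<lambda>t. l t \<le> C * (\<beta> / 200) powr (- \<alpha>) * t powr \<beta>) (at_right 0)"
    using ev_basic k\<beta>
  proof eventually_elim
    case (elim t)
    have "measure \<nu> {z. h t < \<bar>z\<bar>} \<le> C * h t powr (- \<alpha>)"
      using abs_tail[of "h t"] elim C unfolding measure_def by (intro enn2real_leI) auto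
    also have "h t powr (- \<alpha>) = (\<beta> / 200) powr (- \<alpha>) * k t powr (- \<alpha>)"
      unfolding h_def by (rule powr_mult)
    finally have "l t \<le> t * (C * ((\<beta> / 200) powr (- \<alpha>) * k t powr (- \<alpha>)))"
      unfolding l_def using elim by (intro mult_left_mono) auto
    also have "\<dots> = C * (\<beta> / 200) powr (- \<alpha>) * (t * k t powr (- \<alpha>))" by (simp only: mult_ac)
    also have "\<dots> \<le> C * (\<beta> / 200) powr (- \<alpha>) * t powr \<beta>" using elim C by (intro mult_left_mono) auto
    finally show ?case .
  qed
  have "((\<lambda>t. C * (\<beta> / 200) powr (- \<alpha>) * t powr \<beta>) \<longlongrightarrow> C * (\<beta> / 200) powr (- \<alpha>) * 0) (at_right 0)"
    using \<beta> by (intro tendsto_mult_left tendsto_powr_at_right_0)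
  then show "((\<lambda>t. C * (\<beta> / 200) powr (- \<alpha>) * t powr \<beta>) \<longlongrightarrow> 0) (at_right 0)" by simp
qed

text \<open>One number \<open>e\<close> bounds all small quantities: \<open>s / k\<close>,
  \<open>\<bar>d\<bar> / k\<close>, the excess of the exponential moments, \<open>l\<close>, and the
  deviation of the one-jump term from \<open>B\<close>. Then \<open>U\<close> deviates from
  \<open>A\<close> by at most \<open>3 * e * A + e * B\<close>, the blurring
  \<open>r \<le> 4 * e * k\<close> of a big jump costs \<open>4 * K1 * e * B\<close>, and further
  jumps cost \<open>K2 * e * B\<close>. The restriction \<open>e \<le> 1 / 4\<close> keeps the drift
  within \<open>k / 4\<close>.\<close>

lemma linear_payoff_error:
  assumes e: "0 < e" "e \<le> 1 / 4"
  shows "eventually (\<lambda>t. \<bar>(\<integral>x. max (x - k t) 0 \<partial>\<mu> t) - (A t + B t)\<bar> \<le> (5 + 4 * K1 + K2) * e * (A t + B t)) (at_right 0)"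
proof -
  \<comment> \<open>\<open>Ce\<close> depends on \<open>e\<close> alone and is fixed before
    \<open>t\<close> tends to 0, so that \<open>W\<close>, which tends to 0, can absorb it.\<close>
  obtain Ce where Ce: "0 \<le> Ce" "\<And>y::real. exp \<bar>y\<bar> \<le> 1 + e + Ce * (exp y + exp (- y) - 2)"
    using exp_abs_le_cosh[OF e(1)] by blast
  have "((\<lambda>t. 2 * Ce * (exp (W t) - 1)) \<longlongrightarrow> 2 * Ce * (exp 0 - 1)) (at_right 0)"
    by (intro tendsto_mult_left tendsto_diff tendsto_exp tendsto_const W_tendsto)
  then have ev1: "eventually (\<lambda>t. 2 * Ce * (exp (W t) - 1) < e) (at_right 0)"
    using e by (intro order_tendstoD(2)) auto
  have "((\<lambda>t. exp (6 * k t * \<bar>t * b t\<bar> / (\<sigma> * sqrt t)\<^sup>2) * (1 + 2 * e)) \<longlongrightarrow> exp 0 * (1 + 2 * e)) (at_right 0)"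
    by (intro tendsto_mult_right tendsto_exp gauss_shift_exponent)
  then have ev2: "eventually (\<lambda>t. exp (6 * k t * \<bar>t * b t\<bar> / (\<sigma> * sqrt t)\<^sup>2) * (1 + 2 * e) < 1 + 3 * e) (at_right 0)"
    using e by (intro order_tendstoD(2)) auto
  have ev3: "eventually (\<lambda>t. k t * t\<^sup>2 * (1 + 4 * exp (W t)) / B t < e) (at_right 0)"
    using quadratic_remainder e by (intro order_tendstoD(2)) auto
  have ev4: "eventually (\<lambda>t. t * I (k t) / B t < 1 + e) (at_right 0)" "eventually (\<lambda>t. 1 - e < t * I (k t) / B t) (at_right 0)"
    using one_jump_asymp e by (auto intro: order_tendstoD)
  have ev5: "eventually (\<lambda>t. \<sigma> * sqrt t / k t < e) (at_right 0)" "eventually (\<lambda>t. t * \<bar>b t\<bar> / k t < e) (at_right 0)"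
    using sk drift_over_k e by (auto intro: order_tendstoD)
  have ev6: "eventually (\<lambda>t. l t < e) (at_right 0)"
    using l_tendsto e by (auto intro: order_tendstoD)
  from ev_basic ev_mgf_exponent ev1 ev2 ev3 ev4 ev5 ev6 ev_K1 ev_K2 show ?thesis
  proof eventually_elim
    case (elim t)
    define s where "s = \<sigma> * sqrt t"
    define d where "d = t * b t"
    define T where "T = (\<integral>x. max (x - k t) 0 \<partial>\<mu> t)"
    have t: "0 < t" and kt: "0 < k t" and ht: "0 < h t" "h t \<le> 1" "h t \<le> k t" using elim by auto
    have B: "0 < B t" using t by (rule B_pos)
    have A0: "0 \<le> A t" by (simp add: A_def gauss_call_nonneg)
    have s: "0 \<le> s" "s \<le> e * k t" using \<sigma>0 t elim kt unfolding s_def by (auto simp: field_simps)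
    have d: "\<bar>d\<bar> \<le> e * k t" using t elim kt unfolding d_def by (auto simp: field_simps abs_mult)
    have ek: "e * k t \<le> k t / 4" using e kt by simp
    obtain S where S: "real_distribution S"
      and mgf: "\<And>\<theta>. mgf S \<theta> \<le>
        ennreal (exp (t * \<theta>\<^sup>2 * exp (\<bar>\<theta>\<bar> * h t) * (\<integral>z. z\<^sup>2 * indicator {- h t..h t} z \<partial>\<nu>)))"
      and \<mu>t: "\<mu> t = ((gauss_law s d \<star> S) \<star> compound_poisson (big_jumps t (h t) \<nu>))"
      by (rule levy_decomposition[OF \<nu> rd[OF t] ch[OF t] t ht(1,2), folded b_def, folded d_def s_def]) (rule that)
    have W: "mgf S \<theta> \<le> ennreal (exp (W t))" if "\<bar>\<theta>\<bar> \<le> 100 * (- ln t) / k t" for \<theta>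
    proof -
      have "t * \<theta>\<^sup>2 * exp (\<bar>\<theta>\<bar> * h t) * (\<integral>z. z\<^sup>2 * indicator {- h t..h t} z \<partial>\<nu>) \<le> W t" using elim that by blast
      then have "ennreal (exp (t * \<theta>\<^sup>2 * exp (\<bar>\<theta>\<bar> * h t) * (\<integral>z. z\<^sup>2 * indicator {- h t..h t} z \<partial>\<nu>))) \<le> ennreal (exp (W t))"
        by (intro ennreal_leI) simp
      with mgf show ?thesis by (rule order_trans)
    qed
    have L: "1 \<le> - ln t" "t = exp (- (- ln t))" using elim by auto
    have sk': "s \<le> k t" "\<bar>d\<bar> \<le> k t / 4" using s d ek kt by linarith+
    note small = gauss_call_small_jumps[OF S W L kt s(1) sk' less_imp_le[OF e(1)] Ce W_nonneg]
    have iS: "integrable S (\<lambda>x. x)" by (rule small(1))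
    define w where "w = 2 * Ce * (exp (W t) - 1)"
    have w: "w \<le> e" using elim by (simp add: w_def)
    have "(\<integral>x. \<bar>x\<bar> \<partial>S) \<le> k t * (e + w)" unfolding w_def by (rule small(2))
    also have "\<dots> \<le> k t * (2 * e)" using w kt by (intro mult_left_mono) auto
    finally have xS: "(\<integral>x. \<bar>x\<bar> \<partial>S) \<le> 2 * e * k t" by (simp add: mult_ac)
    define U where "U = (\<integral>x. gauss_call s (k t - d - x) \<partial>S)"
    define r where "r = s + \<bar>d\<bar> + (\<integral>x. \<bar>x\<bar> \<partial>S)"
    have r: "r \<le> 4 * e * k t" using s d xS by (simp add: r_def)
    have U: "\<bar>U - A t\<bar> \<le> 3 * e * A t + e * B t"
    proof -
      have "\<bar>U - A t\<bar> \<le> A t * (exp (6 * k t * \<bar>d\<bar> / s\<^sup>2) * (1 + e + w) - 1) + k t * t\<^sup>2 * (1 + 4 * exp (W t))"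
        unfolding U_def w_def A_def s_def[symmetric] by (rule small(3))
      also have "\<dots> \<le> A t * (3 * e) + e * B t"
      proof (intro add_mono mult_left_mono A0)
        have "exp (6 * k t * \<bar>d\<bar> / s\<^sup>2) * (1 + e + w) \<le> exp (6 * k t * \<bar>d\<bar> / s\<^sup>2) * (1 + 2 * e)"
          using w by (intro mult_left_mono) auto
        also have "\<dots> \<le> 1 + 3 * e" using elim unfolding d_def s_def by simp
        finally show "exp (6 * k t * \<bar>d\<bar> / s\<^sup>2) * (1 + e + w) - 1 \<le> 3 * e" by simp
        show "k t * t\<^sup>2 * (1 + 4 * exp (W t)) \<le> e * B t"
          using elim B by (simp add: pos_divide_less_eq)
      qed
      finally show ?thesis by (simp add: mult_ac)
    qed
    have J: "t * I (k t) \<le> (1 + e) * B t" "(1 - e) * B t \<le> t * I (k t)"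
      using elim B by (simp_all add: pos_divide_less_eq pos_less_divide_eq)
    have m0: "0 \<le> m t" by (simp add: m_def)
    have rm: "t * (r * m t) \<le> 4 * K1 * e * B t"
    proof -
      have "t * (r * m t) \<le> t * ((4 * e * k t) * m t)" using r m0 t by (intro mult_left_mono mult_right_mono) auto
      also have "\<dots> = 4 * e * (t * k t * m t)" by simp
      also have "\<dots> \<le> 4 * e * (K1 * B t)" using elim e by (intro mult_left_mono) auto
      finally show ?thesis by (simp add: mult_ac)
    qed
    have l0: "0 \<le> l t" using t by (simp add: l_def)
    have lt: "l t * (t * (I (h t) + h t * m t)) \<le> K2 * e * B t"
    proof -
      have "l t * (t * (I (h t) + h t * m t)) \<le> e * (t * (I (h t) + h t * m t))"
        using elim t I_nonneg[of "h t"] m0 ht by (intro mult_right_mono) (auto intro!: mult_nonneg_nonneg add_nonneg_nonneg)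
      also have "\<dots> \<le> e * (K2 * B t)" using elim e by (intro mult_left_mono) auto
      finally have "l t * (t * (I (h t) + h t * m t)) \<le> e * (K2 * B t)" .
      then show ?thesis by (simp add: mult_ac)
    qed
    note sandwich = call_price_sandwich[OF \<nu> S iS less_imp_le[OF t] ht(1) ht(3) s(1) integrable_overshoot \<mu>t]
    have up: "T \<le> U + t * (I (k t) + r * m t) + l t * (t * (I (h t) + h t * m t))"
      unfolding T_def U_def I_def r_def m_def l_def by (rule sandwich(1))
    have low: "exp (- l t) * (U + t * I (k t)) \<le> T + t * (r * m t)"
      unfolding T_def U_def I_def r_def m_def l_def by (rule sandwich(2))
    have eA: "0 \<le> e * A t" and eB: "0 \<le> e * B t" and KB: "0 \<le> K1 * e * B t" "0 \<le> K2 * e * B t"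
      and KA: "0 \<le> K1 * e * A t" "0 \<le> K2 * e * A t"
      using e A0 B K_nonneg by (auto intro!: mult_nonneg_nonneg)
    have "T \<le> A t + B t + 3 * (e * A t) + 2 * (e * B t) + 4 * (K1 * e * B t) + K2 * e * B t"
      using up U J(1) rm lt by (simp add: abs_le_iff distrib_right distrib_left mult.assoc)
    then have upper: "T - (A t + B t) \<le> (5 + 4 * K1 + K2) * e * (A t + B t)"
      using eA eB KB KA by (simp add: distrib_right distrib_left mult.assoc)
    \<comment> \<open>The first factor bounds the probability \<open>exp (- l t)\<close> of no big
      jump from below, the second collects the losses in \<open>U\<close> and in the one-jump
      term.\<close>
    have "(1 - e) * ((1 - 3 * e) * (A t + B t)) \<le> exp (- l t) * (U + t * I (k t))"
    proof (intro mult_mono)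
      show "1 - e \<le> exp (- l t)" using exp_ge_add_one_self[of "- l t"] elim by linarith
      show "(1 - 3 * e) * (A t + B t) \<le> U + t * I (k t)"
        using U J(2) eA eB by (simp add: abs_le_iff distrib_right distrib_left left_diff_distrib mult.assoc)
      show "0 \<le> (1 - 3 * e) * (A t + B t)" using e A0 B by simp
    qed simp
    then have "(1 - e) * ((1 - 3 * e) * (A t + B t)) \<le> T + 4 * K1 * e * B t"
      using low rm by linarith
    moreover have "(1 - e) * ((1 - 3 * e) * (A t + B t)) \<ge> (1 - 4 * e) * (A t + B t)"
    proof -
      have "1 - 4 * e \<le> (1 - e) * (1 - 3 * e)" using e by (simp add: algebra_simps)
      then show ?thesis using A0 B by (simp add: mult.assoc[symmetric] mult_right_mono)
    qed
    ultimately have "A t + B t - 4 * (e * A t) - 4 * (e * B t) \<le> T + 4 * (K1 * e * B t)"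
      by (simp add: distrib_left left_diff_distrib mult.assoc)
    then have "A t + B t - T \<le> (5 + 4 * K1 + K2) * e * (A t + B t)"
      using eA eB KB KA by (simp add: distrib_right distrib_left mult.assoc)
    with upper show ?case unfolding T_def[symmetric] by (simp add: abs_le_iff)
  qed
qed

lemma linear_payoff_asymp:
  assumes e: "0 < e"
  shows "eventually (\<lambda>t. \<bar>(\<integral>x. max (x - k t) 0 \<partial>\<mu> t) - (A t + B t)\<bar> \<le> e * (A t + B t)) (at_right 0)"
proof -
  define K where "K = 5 + 4 * K1 + K2"
  have K: "0 < K" using K_nonneg by (simp add: K_def)
  define e' where "e' = min (1 / 4) (e / K)"
  have e': "0 < e'" "e' \<le> 1 / 4" "K * e' \<le> e"
    using e K by (auto simp: e'_def min_def field_simps)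
  from linear_payoff_error[OF e'(1,2)] ev_pos show ?thesis
  proof eventually_elim
    case (elim t)
    have "0 \<le> A t + B t" using B_pos[of t] elim by (simp add: A_def gauss_call_nonneg add_nonneg_pos less_imp_le)
    then have "K * e' * (A t + B t) \<le> e * (A t + B t)" using e' by (intro mult_right_mono) auto
    then show ?case using elim unfolding K_def by linarith
  qed
qed

text \<open>Both sides are compared with \<open>A + B\<close>. For the Gaussian law, too, replacing
  the exponential payoff costs an error of order \<open>t\<close>; it need not be small against the
  Gaussian price, only against \<open>B\<close>, so the comparison has to be made for the sum. The
  drift rate \<open>d0\<close> of the reference law is left open because it has opposite signs for
  call and put.\<close>

lemma payoff_asymp:
  assumes j: "j = 1 \<or> j = - 1" and d0: "\<sigma> = 0 \<Longrightarrow> d0 = 0"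
  shows "(\<lambda>t. \<integral>x. payoff j (k t) x \<partial>\<mu> t) \<sim>[at_right 0]
     (\<lambda>t. (\<integral>x. payoff j (k t) x \<partial>gauss_law (\<sigma> * sqrt t) (d0 * t)) + B t)"
proof -
  have AB: "0 < A t + B t" "0 \<le> A t" "0 < B t" if "0 < t" for t
    using B_pos[OF that] by (auto simp: A_def gauss_call_nonneg add_nonneg_pos)
  obtain Kp where Kp: "0 \<le> Kp" "\<And>t \<mu>. 0 < t \<Longrightarrow> real_distribution \<mu> \<Longrightarrow>
    (\<And>u. char \<mu> u = exp (complex_of_real t * levy_exponent (\<sigma>\<^sup>2) \<nu> \<gamma> u)) \<Longrightarrow>
    mgf \<mu> 1 \<le> ennreal (exp (Kp * t))"
    by (rule levy_exp_moment[OF \<nu> _ fin, of 1 \<sigma> \<gamma>]) (auto intro: that)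
  obtain Kn where Kn: "0 \<le> Kn" "\<And>t \<mu>. 0 < t \<Longrightarrow> real_distribution \<mu> \<Longrightarrow>
    (\<And>u. char \<mu> u = exp (complex_of_real t * levy_exponent (\<sigma>\<^sup>2) \<nu> \<gamma> u)) \<Longrightarrow>
    mgf \<mu> (- 1) \<le> ennreal (exp (Kn * t))"
    by (rule levy_exp_moment[OF \<nu> _ fin, of "- 1" \<sigma> \<gamma>]) (auto intro: that)
  \<comment> \<open>Bounds the logarithm of the exponential moments of orders 1 and -1 of the
    reference Gaussian law, per unit of time.\<close>
  define Kg where "Kg = \<bar>d0\<bar> + \<sigma>\<^sup>2 / 2"
  define K where "K = Kp + Kn + Kg"
  have Kg: "0 \<le> Kg" by (simp add: Kg_def)
  have K: "0 \<le> K" "Kp \<le> K" "Kn \<le> K" "Kg \<le> K" using Kp(1) Kn(1) Kg by (auto simp: K_def)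
  let ?G = "\<lambda>t. gauss_law (\<sigma> * sqrt t) (d0 * t)"
  have cosh_bd: "integrable \<rho> exp \<and> integrable \<rho> (\<lambda>x. exp (- x)) \<and> (\<integral>x. (exp x + exp (- x) - 2) \<partial>\<rho>) \<le> 2 * K * exp K * t"
    if t: "0 < t" "t < 1" and \<rho>: "\<rho> = \<mu> t \<or> \<rho> = ?G t" for t \<rho>
  proof -
    have "real_distribution \<rho>" using \<rho> rd[OF t(1)] real_distribution_gauss_law by auto
    moreover have "mgf \<rho> j \<le> ennreal (exp (K * t))" if j: "j = 1 \<or> j = - 1" for j
      using \<rho>
    proof
      assume \<rho>: "\<rho> = \<mu> t"
      have "mgf \<rho> j \<le> ennreal (exp (Kp * t)) \<or> mgf \<rho> j \<le> ennreal (exp (Kn * t))"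
        using j Kp(2)[OF t(1) rd[OF t(1)] ch[OF t(1)]] Kn(2)[OF t(1) rd[OF t(1)] ch[OF t(1)]] unfolding \<rho> by auto
      moreover have "exp (Kp * t) \<le> exp (K * t)" "exp (Kn * t) \<le> exp (K * t)"
        using K t by (auto intro: mult_right_mono)
      ultimately show ?thesis by (meson ennreal_leI order_trans)
    next
      assume \<rho>: "\<rho> = ?G t"
      have "mgf \<rho> j = ennreal (exp (j * (d0 * t) + j\<^sup>2 * (\<sigma> * sqrt t)\<^sup>2 / 2))"
        unfolding \<rho> by (rule nn_integral_exp_gauss_law)
      also have "j * (d0 * t) + j\<^sup>2 * (\<sigma> * sqrt t)\<^sup>2 / 2 \<le> K * t"
      proof -
        have "j * (d0 * t) \<le> \<bar>d0\<bar> * t" using j t by (auto simp: mult_right_mono simp flip: minus_mult_left)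
        moreover have "j\<^sup>2 * (\<sigma> * sqrt t)\<^sup>2 / 2 = \<sigma>\<^sup>2 / 2 * t" using j t by (auto simp: power_mult_distrib)
        moreover have "Kg * t \<le> K * t" using K t by (intro mult_right_mono) auto
        ultimately show ?thesis by (simp add: Kg_def distrib_right)
      qed
      finally show ?thesis by (simp add: ennreal_leI)
    qed
    from this[of 1] this[of "- 1"] have "(\<integral>\<^sup>+x. ennreal (exp x) \<partial>\<rho>) \<le> ennreal (exp (K * t))"
       "(\<integral>\<^sup>+x. ennreal (exp (- x)) \<partial>\<rho>) \<le> ennreal (exp (K * t))" by auto
    ultimately show ?thesis using cosh_integral_bound[of \<rho> K t] K t by auto
  qed
  have Glin: "(\<integral>x. max (x - k t) 0 \<partial>?G t) = gauss_call (\<sigma> * sqrt t) (k t - d0 * t)" for t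
    unfolding gauss_law_def gauss_call_def by (subst integral_distr) (auto simp: algebra_simps)
  have both: "eventually (\<lambda>t. \<bar>(\<integral>x. payoff j (k t) x \<partial>\<mu> t) - (A t + B t)\<bar> \<le> e * (A t + B t) \<and>
      \<bar>((\<integral>x. payoff j (k t) x \<partial>?G t) + B t) - (A t + B t)\<bar> \<le> e * (A t + B t)) (at_right 0)" if e: "0 < e" for e
  proof -
    \<comment> \<open>At most four errors of size \<open>e'\<close> accumulate in each summand: two
      because \<open>T\<close> itself may be as large as twice \<open>A + B\<close>, one from the
      linear asymptotics, and one from the cosh term.\<close>
    define e' where "e' = min (e / 4) 1"
    have e': "0 < e'" "e' \<le> 1" "4 * e' \<le> e" using e by (auto simp: e'_def)
    obtain Ce where Ce: "0 \<le> Ce"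
      "\<And>k \<mu>. 0 < k \<Longrightarrow> real_distribution \<mu> \<Longrightarrow> integrable \<mu> exp \<Longrightarrow> integrable \<mu> (\<lambda>x. exp (- x)) \<Longrightarrow>
      \<bar>(\<integral>x. payoff j k x \<partial>\<mu>) - (\<integral>x. max (x - k) 0 \<partial>\<mu>)\<bar> \<le>
       e' * (\<integral>x. max (x - k) 0 \<partial>\<mu>) + Ce * (\<integral>x. (exp x + exp (- x) - 2) \<partial>\<mu>)"
      by (rule payoff_integral_approx[OF e'(1,2) j]) (rule that)
    have "((\<lambda>t. Ce * (2 * K * exp K) * (t / B t)) \<longlongrightarrow> Ce * (2 * K * exp K) * 0) (at_right 0)"
      by (intro tendsto_mult_left t_over_B)
    then have ev1: "eventually (\<lambda>t. Ce * (2 * K * exp K) * (t / B t) < e') (at_right 0)"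
      using e' by (intro order_tendstoD(2)) auto
    \<comment> \<open>The reference drift moves the strike by \<open>d0 * t\<close>, which changes
      the Gaussian price by a factor with exponent of order \<open>k\<close>. For \<sigma> = 0 there
      is no log-Lipschitz bound, and the hypothesis makes the shift vanish.\<close>
    have shift: "eventually (\<lambda>t. \<bar>gauss_call (\<sigma> * sqrt t) (k t - d0 * t) - A t\<bar> \<le> e' * A t) (at_right 0)"
    proof (cases "\<sigma> = 0")
      case True
      have "\<bar>gauss_call (\<sigma> * sqrt t) (k t - d0 * t) - A t\<bar> \<le> e' * A t" for t
        using d0[OF True] e' by (simp add: A_def gauss_call_nonneg)
      then show ?thesis by (simp add: always_eventually)
    next
      case False
      then have \<sigma>: "0 < \<sigma>" using \<sigma>0 by simp
      have "((\<lambda>t. exp (6 * \<bar>d0\<bar> / \<sigma>\<^sup>2 * k t)) \<longlongrightarrow> exp (6 * \<bar>d0\<bar> / \<sigma>\<^sup>2 * 0)) (at_right 0)"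
        by (intro tendsto_exp tendsto_mult_left k0)
      then have "eventually (\<lambda>t. exp (6 * \<bar>d0\<bar> / \<sigma>\<^sup>2 * k t) < 1 + e') (at_right 0)"
        using e' by (intro order_tendstoD(2)) auto
      moreover have "eventually (\<lambda>t. \<sigma> * sqrt t / k t < 1) (at_right 0)"
        using sk by (rule order_tendstoD) simp
      moreover have "eventually (\<lambda>t. \<bar>d0\<bar> * t powr \<beta> < 1 / 2) (at_right 0)"
        using tendsto_mult_left[OF tendsto_powr_at_right_0[OF \<beta>(1)], of "\<bar>d0\<bar>"] by (intro order_tendstoD(2)) auto
      ultimately show ?thesis using t_over_k ev_basic
      proof eventually_elim
        case (elim t)
        have s: "0 < \<sigma> * sqrt t" "\<sigma> * sqrt t \<le> k t" using elim \<sigma> by (auto simp: field_simps)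
        have "\<bar>d0\<bar> * (t / k t) \<le> \<bar>d0\<bar> * t powr \<beta>" using elim by (intro mult_left_mono) auto
        then have "\<bar>d0\<bar> * (t / k t) \<le> 1 / 2" using elim by linarith
        then have x: "\<bar>d0 * t\<bar> \<le> k t / 2" using elim by (simp add: abs_mult field_simps)
        have "6 * k t * \<bar>d0 * t\<bar> / (\<sigma> * sqrt t)\<^sup>2 = 6 * \<bar>d0\<bar> / \<sigma>\<^sup>2 * k t"
          using elim by (simp add: power_mult_distrib abs_mult)
        then have "\<bar>gauss_call (\<sigma> * sqrt t) (k t - d0 * t) - A t\<bar> \<le> A t * (exp (6 * \<bar>d0\<bar> / \<sigma>\<^sup>2 * k t) - 1)"
          using gauss_call_diff_le[OF s x] unfolding A_def by simp
        also have "\<dots> \<le> A t * e'" using elim by (intro mult_left_mono) (auto simp: A_def gauss_call_nonneg)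
        finally show ?case by (simp add: mult.commute)
      qed
    qed
    from ev_basic ev1 shift linear_payoff_asymp[OF e'(1)] show ?thesis
    proof eventually_elim
      case (elim t)
      have t: "0 < t" "t < 1" and kt: "0 < k t" using elim by auto
      define T where "T = (\<integral>x. max (x - k t) 0 \<partial>\<mu> t)"
      define G where "G = gauss_call (\<sigma> * sqrt t) (k t - d0 * t)"
      have err: "Ce * (2 * K * exp K * t) \<le> e' * B t"
        using elim AB(3)[OF t(1)] by (simp add: pos_divide_less_eq)
      have pay: "\<bar>(\<integral>x. payoff j (k t) x \<partial>\<rho>) - (\<integral>x. max (x - k t) 0 \<partial>\<rho>)\<bar> \<le> e' * (\<integral>x. max (x - k t) 0 \<partial>\<rho>) + e' * B t"
        if \<rho>: "\<rho> = \<mu> t \<or> \<rho> = ?G t" for \<rho>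
      proof -
        have "real_distribution \<rho>" using \<rho> rd[OF t(1)] real_distribution_gauss_law by auto
        then have "\<bar>(\<integral>x. payoff j (k t) x \<partial>\<rho>) - (\<integral>x. max (x - k t) 0 \<partial>\<rho>)\<bar> \<le>
            e' * (\<integral>x. max (x - k t) 0 \<partial>\<rho>) + Ce * (\<integral>x. (exp x + exp (- x) - 2) \<partial>\<rho>)"
          using Ce(2)[OF kt] cosh_bd[OF t \<rho>] by blast
        also have "Ce * (\<integral>x. (exp x + exp (- x) - 2) \<partial>\<rho>) \<le> Ce * (2 * K * exp K * t)"
          using cosh_bd[OF t \<rho>] Ce(1) by (intro mult_left_mono) auto
        finally show ?thesis using err by linarith
      qed
      have p1: "\<bar>(\<integral>x. payoff j (k t) x \<partial>\<mu> t) - T\<bar> \<le> e' * T + e' * B t"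
        using pay[of "\<mu> t"] unfolding T_def by simp
      have p2: "\<bar>(\<integral>x. payoff j (k t) x \<partial>?G t) - G\<bar> \<le> e' * G + e' * B t"
        using pay[of "?G t"] unfolding Glin G_def by simp
      have T1: "\<bar>T - (A t + B t)\<bar> \<le> e' * (A t + B t)" using elim by (simp add: T_def)
      have G1: "\<bar>G - A t\<bar> \<le> e' * A t" using elim by (simp add: G_def)
      note ab = AB[OF t(1)]
      have eAB: "e' * (A t + B t) = e' * A t + e' * B t" by (rule distrib_left)
      have "e' * (A t + B t) \<le> 1 * (A t + B t)" "e' * A t \<le> 1 * A t" using e' ab by (intro mult_right_mono; simp)+
      then have "T \<le> 2 * (A t + B t)" "G \<le> 2 * A t"
        using abs_le_D1[OF T1] abs_le_D1[OF G1] by simp_all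
      then have "e' * T \<le> e' * (2 * (A t + B t))" "e' * G \<le> e' * (2 * A t)"
        using e' by (auto intro!: mult_left_mono)
      then have eT: "e' * T \<le> 2 * (e' * A t) + 2 * (e' * B t)" and eG: "e' * G \<le> 2 * (e' * A t)"
        by (simp_all add: distrib_left)
      have nn: "0 \<le> e' * A t" "0 \<le> e' * B t" using e' ab by simp_all
      have "4 * e' * (A t + B t) \<le> e * (A t + B t)" using e' ab by (intro mult_right_mono) auto
      then have fin: "4 * (e' * A t) + 4 * (e' * B t) \<le> e * (A t + B t)" by (simp add: distrib_left mult.assoc)
      show ?case
        using p1 p2 T1 G1 eT eG nn fin unfolding eAB abs_le_iff by (intro conjI) linarith+
    qed
  qed
  have ABpos: "eventually (\<lambda>t. 0 < A t + B t) (at_right 0)"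
    using ev_pos by eventually_elim (rule AB)
  have 1: "(\<lambda>t. \<integral>x. payoff j (k t) x \<partial>\<mu> t) \<sim>[at_right 0] (\<lambda>t. A t + B t)"
    by (rule asymp_equiv_relative_error[OF ABpos], rule eventually_mono[OF both]) (assumption, erule conjunct1)
  have 2: "(\<lambda>t. (\<integral>x. payoff j (k t) x \<partial>?G t) + B t) \<sim>[at_right 0] (\<lambda>t. A t + B t)"
    by (rule asymp_equiv_relative_error[OF ABpos], rule eventually_mono[OF both]) (assumption, erule conjunct2)
  from asymp_equiv_trans[OF 1 asymp_equiv_symI[OF 2]] show ?thesis .
qed

end

section \<open>Reflection and the two-sided statement\<close>

text \<open>Near 0 the two one-sided limits bound the tails, and the larger exponent is the worse
  one. For \<open>x\<close> between \<open>d\<close> and 1 the constant \<open>M\<close> suffices,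
  since \<open>x powr (- max p q)\<close> is at least 1 there.\<close>

lemma tail_abs_bound:
  assumes \<nu>: "levy_measure \<nu>"
    and tailp: "((\<lambda>x. x powr p * measure \<nu> {x<..}) \<longlongrightarrow> cp) (at_right 0)"
    and tailm: "((\<lambda>x. x powr q * measure \<nu> {..<-x}) \<longlongrightarrow> cm) (at_right 0)"
    and pq: "0 < p" "0 < q" and c: "0 \<le> cp" "0 \<le> cm"
  obtains C where "0 \<le> C"
    "\<And>x. 0 < x \<Longrightarrow> x \<le> 1 \<Longrightarrow> emeasure \<nu> {z. x < \<bar>z\<bar>} \<le> ennreal (C * x powr (- max p q))"
proof -
  have [simp, measurable_cong]: "sets \<nu> = sets borel" using \<nu> by (rule sets_levy_measure)
  have fm: "{z. x < \<bar>z\<bar>} \<in> fmeasurable \<nu>" "{x<..} \<in> fmeasurable \<nu>" "{..<-x} \<in> fmeasurable \<nu>" if "0 < x" for x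
    by (rule fmeasurable_levy_measure[OF \<nu> _ _ that]; auto)+
  have "eventually (\<lambda>x. x powr p * measure \<nu> {x<..} < cp + 1) (at_right 0)"
    using tailp by (rule order_tendstoD) simp
  moreover have "eventually (\<lambda>x. x powr q * measure \<nu> {..<-x} < cm + 1) (at_right 0)"
    using tailm by (rule order_tendstoD) simp
  ultimately have "eventually (\<lambda>x. x powr p * measure \<nu> {x<..} < cp + 1 \<and> x powr q * measure \<nu> {..<-x} < cm + 1) (at_right 0)"
    by eventually_elim simp
  then obtain d where d: "0 < d" and dd: "\<And>x. 0 < x \<Longrightarrow> x < d \<Longrightarrow>
      x powr p * measure \<nu> {x<..} < cp + 1 \<and> x powr q * measure \<nu> {..<-x} < cm + 1"
    by (auto simp: eventually_at_right_field)
  define M where "M = measure \<nu> {z. d / 2 < \<bar>z\<bar>}"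
  show thesis
  proof (rule that[of "cp + cm + 2 + M"])
    show "0 \<le> cp + cm + 2 + M" using c by (simp add: M_def)
    fix x :: real assume x: "0 < x" "x \<le> 1"
    have "measure \<nu> {z. x < \<bar>z\<bar>} \<le> (cp + cm + 2 + M) * x powr (- max p q)"
    proof (cases "x < d")
      case True
      have "measure \<nu> {z. x < \<bar>z\<bar>} = measure \<nu> ({x<..} \<union> {..<-x})"
        by (rule arg_cong[where f="measure \<nu>"]) (auto simp: abs_if)
      also have "\<dots> \<le> measure \<nu> {x<..} + measure \<nu> {..<-x}"
        using fm[OF x(1)] by (intro measure_Un_le) auto
      also have "\<dots> \<le> (cp + 1) * x powr (- p) + (cm + 1) * x powr (- q)"
        using dd[OF x(1) True] x by (intro add_mono) (auto simp: powr_minus field_simps)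
      also have "\<dots> \<le> (cp + 1) * x powr (- max p q) + (cm + 1) * x powr (- max p q)"
        using x c by (intro add_mono mult_left_mono powr_mono') auto
      also have "\<dots> = (cp + cm + 2) * x powr (- max p q)" by (simp add: algebra_simps)
      also have "\<dots> \<le> (cp + cm + 2 + M) * x powr (- max p q)"
        by (intro mult_right_mono) (auto simp: M_def)
      finally show ?thesis .
    next
      case False
      have "measure \<nu> {z. x < \<bar>z\<bar>} \<le> M"
        unfolding M_def using False d by (intro measure_mono_fmeasurable fm) auto
      also have "M \<le> (cp + cm + 2 + M) * 1" using c by simp
      also have "\<dots> \<le> (cp + cm + 2 + M) * x powr (- max p q)"
      proof (intro mult_left_mono)
        have "x powr 0 \<le> x powr (- max p q)" using x pq by (intro powr_mono') auto
        then show "1 \<le> x powr (- max p q)" using x by simp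
      qed (use c in \<open>simp add: M_def\<close>)
      finally show ?thesis .
    qed
    then show "emeasure \<nu> {z. x < \<bar>z\<bar>} \<le> ennreal ((cp + cm + 2 + M) * x powr (- max p q))"
      using emeasure_eq_measure2[OF fm(1)[OF x(1)]] by (simp add: ennreal_leI)
  qed
qed

text \<open>Eventually \<open>k t \<ge> t powr (1 / \<alpha>0)\<close>; raising this to the power
  \<open>- \<alpha>\<close> turns the strict gap between \<open>\<alpha>\<close> and
  \<open>\<alpha>0\<close> into a positive power of \<open>t\<close>.\<close>

lemma strike_condition:
  fixes k :: "real \<Rightarrow> real"
  assumes kpos: "\<And>t. 0 < t \<Longrightarrow> 0 < k t" and \<alpha>: "0 < \<alpha>" "\<alpha> < \<alpha>0"
    and lim: "((\<lambda>t. t powr (1 / \<alpha>0) / k t) \<longlongrightarrow> 0) (at_right 0)"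
  shows "eventually (\<lambda>t. t * k t powr (- \<alpha>) \<le> t powr (1 - \<alpha> / \<alpha>0)) (at_right 0)"
proof -
  have "eventually (\<lambda>t. t powr (1 / \<alpha>0) / k t < 1) (at_right 0)"
    by (rule order_tendstoD(2)[OF lim]) simp
  moreover have "eventually (\<lambda>t::real. 0 < t) (at_right 0)" by (simp add: eventually_at_filter)
  ultimately show ?thesis
  proof eventually_elim
    case (elim t)
    then have "t powr (1 / \<alpha>0) \<le> k t" using kpos[of t] by (simp add: field_simps)
    then have "k t powr (- \<alpha>) \<le> (t powr (1 / \<alpha>0)) powr (- \<alpha>)"
      using \<alpha> elim by (intro powr_mono2') auto
    also have "\<dots> = t powr (- (\<alpha> / \<alpha>0))" by (simp add: powr_powr)
    finally have "t * k t powr (- \<alpha>) \<le> t * t powr (- (\<alpha> / \<alpha>0))" using elim by (intro mult_left_mono) auto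
    also have "\<dots> = t powr (1 - \<alpha> / \<alpha>0)" using elim powr_add[of t 1 "- (\<alpha> / \<alpha>0)"] by simp
    finally show ?case .
  qed
qed

section \<open>Reflection of Levy measures, exponents and Gaussian laws\<close>

definition reflect :: "real measure \<Rightarrow> real measure" where
  "reflect \<nu> = distr \<nu> borel uminus"

lemma levy_measure_reflect:
  assumes \<nu>: "levy_measure \<nu>"
  shows "levy_measure (reflect \<nu>)"
proof -
  have [simp, measurable_cong]: "sets \<nu> = sets borel" using \<nu> by (rule sets_levy_measure)
  have "emeasure (reflect \<nu>) {0} = emeasure \<nu> {0}"
    unfolding reflect_def by (subst emeasure_distr) (auto simp: space_levy_measure[OF \<nu>] vimage_def)
  moreover have "integrable (reflect \<nu>) (\<lambda>z. min 1 (z\<^sup>2))"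
    unfolding reflect_def using \<nu> by (subst integrable_distr_eq) (auto simp: levy_measure_def)
  ultimately show ?thesis using \<nu> by (simp add: levy_measure_def reflect_def)
qed

lemma measure_reflect:
  assumes "levy_measure \<nu>" and A: "A \<in> sets borel"
  shows "measure (reflect \<nu>) A = measure \<nu> (uminus -` A)"
proof -
  have [simp, measurable_cong]: "sets \<nu> = sets borel" using assms(1) by (rule sets_levy_measure)
  show ?thesis unfolding reflect_def using A by (subst measure_distr) (auto simp: space_levy_measure[OF assms(1)])
qed

text \<open>The truncation interval is symmetric, so reflection only changes the sign of the drift,
  without a correction term.\<close>

lemma levy_exponent_reflect:
  assumes "levy_measure \<nu>"
  shows "levy_exponent s2 (reflect \<nu>) (- \<gamma>) u = levy_exponent s2 \<nu> \<gamma> (- u)"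
proof -
  have [simp, measurable_cong]: "sets \<nu> = sets borel" using assms(1) by (rule sets_levy_measure)
  have ind: "indicator {- 1..1} (- z) = (indicator {- 1..1} z :: real)" for z :: real
    by (auto simp: indicator_def)
  show ?thesis
    unfolding levy_exponent_def reflect_def
    by (subst integral_distr) (auto simp: ind)
qed

lemma gauss_law_uminus: "gauss_law (- s) d = gauss_law s d"
  by (rule Levy_uniqueness) (auto simp: real_distribution_gauss_law char_gauss_law)

text \<open>\<open>W 0\<close> vanishes only almost surely, so the law of \<open>W t\<close> is read
  off from the increment over the interval from 0 to \<open>t\<close>.\<close>

lemma brownian_integral:
  fixes g :: "real \<Rightarrow> real"
  assumes BM: "std_brownian_motion N W" and t: "0 < t" and [measurable]: "g \<in> borel_measurable borel"
  shows "(\<integral>\<omega>. g (W t \<omega>) \<partial>N) = (\<integral>x. g (sqrt t * x) \<partial>std_normal_distribution)"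
proof -
  interpret N: prob_space N using BM by (simp add: std_brownian_motion_def)
  have [measurable]: "W t \<in> borel_measurable N" "W 0 \<in> borel_measurable N"
    using BM t by (auto simp: std_brownian_motion_def)
  have W0: "AE \<omega> in N. W 0 \<omega> = 0" using BM by (simp add: std_brownian_motion_def)
  define Z where "Z \<omega> = (W t \<omega> - W 0 \<omega>) / sqrt t" for \<omega>
  have "distributed N lborel (\<lambda>\<omega>. W t \<omega> - W s \<omega>) (normal_density 0 (sqrt (t - s)))" if "0 \<le> s" "s < t" for s t
    using BM that by (simp add: std_brownian_motion_def)
  from this[of 0 t] t have "distributed N lborel (\<lambda>\<omega>. W t \<omega> - W 0 \<omega>) (normal_density 0 (sqrt t))"
    by simp
  then have "distributed N lborel Z std_normal_density"
    using N.normal_standard_normal_convert[of "sqrt t" "\<lambda>\<omega>. W t \<omega> - W 0 \<omega>" 0] t by (simp add: Z_def[abs_def])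
  then have Z: "distr N lborel Z = std_normal_distribution"
    by (rule distributed_distr_eq_density)
  have [measurable]: "Z \<in> borel_measurable N" unfolding Z_def by measurable
  have "(\<integral>\<omega>. g (W t \<omega>) \<partial>N) = (\<integral>\<omega>. g (sqrt t * Z \<omega>) \<partial>N)"
    by (rule integral_cong_AE) (use W0 t in \<open>auto simp: Z_def\<close>)
  also have "\<dots> = (\<integral>x. g (sqrt t * x) \<partial>distr N lborel Z)"
    by (subst integral_distr) auto
  finally show ?thesis unfolding Z .
qed

text \<open>Call and put are two instances of \<open>payoff_asymp\<close>. The put on
  \<open>X\<close> is the payoff with \<open>j = - 1\<close> of \<open>- X\<close>, whose Levy
  measure is \<open>reflect \<nu>\<close> and whose Gaussian comparison law drifts upwards by
  \<open>\<sigma>\<^sup>2 * t / 2\<close>.\<close>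

theorem theorem2p1:
  fixes M :: "'a measure" and X :: "real \<Rightarrow> 'a \<Rightarrow> real"
    and N :: "'b measure" and W :: "real \<Rightarrow> 'b \<Rightarrow> real"
    and \<sigma> \<gamma> :: real and \<nu> :: "real measure"
    and \<alpha>p \<alpha>m cp cm :: real and k :: "real \<Rightarrow> real"
  assumes levy: "levy_process M X"
    and triplet: "has_char_triplet M X (\<sigma>\<^sup>2) \<nu> \<gamma>"
    and sigma_nonneg: "\<sigma> \<ge> 0"
    and mart: "is_martingale M X (\<lambda>t \<omega>. exp (X t \<omega>))"
    and expmom: "\<exists>\<delta>>0. (\<integral>\<^sup>+ z. ennreal (indicator {z. \<bar>z\<bar> > 1} z * exp (\<bar>z\<bar> * (1 + \<delta>))) \<partial>\<nu>) < \<infinity>"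
    and tailp: "((\<lambda>x. x powr \<alpha>p * measure \<nu> {x<..}) \<longlongrightarrow> cp) (at_right 0)"
    and tailm: "((\<lambda>x. x powr \<alpha>m * measure \<nu> {..<-x}) \<longlongrightarrow> cm) (at_right 0)"
    and \<alpha>p: "1 < \<alpha>p" "\<alpha>p < 2" and \<alpha>m: "1 < \<alpha>m" "\<alpha>m < 2"
    and cp: "cp \<ge> 0" and cm: "cm \<ge> 0"
    and kpos: "\<forall>t>0. k t > 0"
    and k0: "(k \<longlongrightarrow> 0) (at_right 0)"
    and k_nogauss: "\<sigma>\<^sup>2 = 0 \<longrightarrow> (\<exists>\<alpha>. max \<alpha>m \<alpha>p < \<alpha> \<and> \<alpha> < 2 \<and>
                      ((\<lambda>t. t powr (1 / \<alpha>) / k t) \<longlongrightarrow> 0) (at_right 0))"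
    and k_gauss: "\<sigma>\<^sup>2 > 0 \<longrightarrow> ((\<lambda>t. sqrt t / k t) \<longlongrightarrow> 0) (at_right 0)"
    and BM: "std_brownian_motion N W"
  shows "(cp > 0 \<longrightarrow>
            (\<lambda>t. \<integral>\<omega>. max (exp (X t \<omega>) - exp (k t)) 0 \<partial>M) \<sim>[at_right 0]
            (\<lambda>t. (\<integral>\<omega>. max (exp (\<sigma> * W t \<omega> - \<sigma>\<^sup>2 * t / 2) - exp (k t)) 0 \<partial>N)
                 + t * k t powr (1 - \<alpha>p) * cp / (\<alpha>p - 1))) \<and>
         (cm > 0 \<longrightarrow>
            (\<lambda>t. \<integral>\<omega>. max (exp (- k t) - exp (X t \<omega>)) 0 \<partial>M) \<sim>[at_right 0]
            (\<lambda>t. (\<integral>\<omega>. max (exp (- k t) - exp (\<sigma> * W t \<omega> - \<sigma>\<^sup>2 * t / 2)) 0 \<partial>N)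
                 + t * k t powr (1 - \<alpha>m) * cm / (\<alpha>m - 1)))"
proof -
  interpret M: prob_space M using levy by (simp add: levy_process_def)
  have X: "X t \<in> borel_measurable M" if "0 < t" for t
    using levy that by (simp add: levy_process_def)
  have \<nu>: "levy_measure \<nu>" using triplet by (simp add: has_char_triplet_def)
  have [simp, measurable_cong]: "sets \<nu> = sets borel" using \<nu> by (rule sets_levy_measure)
  have [simp]: "space \<nu> = UNIV" using \<nu> by (rule space_levy_measure)
  have ch: "char (distr M borel (X t)) u = exp (complex_of_real t * levy_exponent (\<sigma>\<^sup>2) \<nu> \<gamma> u)"
    if "0 < t" for t u
    using triplet that by (simp add: has_char_triplet_def)
  have kpos': "0 < k t" if "0 < t" for t using kpos that by blast
  define \<alpha> where "\<alpha> = max \<alpha>p \<alpha>m"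
  have \<alpha>: "\<alpha>p \<le> \<alpha>" "\<alpha>m \<le> \<alpha>" "\<alpha> < 2" "0 < \<alpha>" using \<alpha>p \<alpha>m by (auto simp: \<alpha>_def)
  \<comment> \<open>Both strike hypotheses take one form: for \<sigma> > 0 the assumption on
    \<open>sqrt t / k t\<close> is the same condition with exponent 2, which exceeds
    \<open>\<alpha>\<close>.\<close>
  obtain \<alpha>0 where \<alpha>0: "\<alpha> < \<alpha>0" "((\<lambda>t. t powr (1 / \<alpha>0) / k t) \<longlongrightarrow> 0) (at_right 0)"
  proof (cases "\<sigma>\<^sup>2 = 0")
    case True
    then show thesis using k_nogauss that by (auto simp: \<alpha>_def max.commute)
  next
    case False
    then have "((\<lambda>t. sqrt t / k t) \<longlongrightarrow> 0) (at_right 0)" using k_gauss by simp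
    moreover have "eventually (\<lambda>t. sqrt t / k t = t powr (1 / 2) / k t) (at_right 0)"
      by (auto simp: eventually_at_filter powr_half_sqrt)
    ultimately have "((\<lambda>t. t powr (1 / 2) / k t) \<longlongrightarrow> 0) (at_right 0)" by (simp add: tendsto_cong)
    then show thesis using that[of 2] \<alpha> by simp
  qed
  have sk: "((\<lambda>t. \<sigma> * sqrt t / k t) \<longlongrightarrow> 0) (at_right 0)"
  proof (cases "\<sigma> = 0")
    case False
    then have "((\<lambda>t. \<sigma> * (sqrt t / k t)) \<longlongrightarrow> \<sigma> * 0) (at_right 0)"
      using k_gauss by (intro tendsto_mult_left) simp
    then show ?thesis by simp
  qed simp
  define \<beta> where "\<beta> = 1 - \<alpha> / \<alpha>0"
  have \<beta>: "0 < \<beta>" "\<beta> \<le> 1" using \<alpha>0 \<alpha> by (auto simp: \<beta>_def)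
  have k\<beta>: "eventually (\<lambda>t. t * k t powr (- \<alpha>) \<le> t powr \<beta>) (at_right 0)"
    unfolding \<beta>_def by (rule strike_condition[OF kpos' \<alpha>(4) \<alpha>0])
  obtain C where C: "0 \<le> C"
    "\<And>x. 0 < x \<Longrightarrow> x \<le> 1 \<Longrightarrow> emeasure \<nu> {z. x < \<bar>z\<bar>} \<le> ennreal (C * x powr (- \<alpha>))"
    unfolding \<alpha>_def by (rule tail_abs_bound[OF \<nu> tailp tailm _ _ cp cm]) (use \<alpha>p \<alpha>m in auto)
  have fin: "(\<integral>\<^sup>+z. ennreal (exp \<bar>z\<bar>) * indicator {z. 1 < \<bar>z\<bar>} z \<partial>\<nu>) < \<infinity>"
  proof -
    obtain \<delta> where \<delta>: "0 < \<delta>"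
      "(\<integral>\<^sup>+ z. ennreal (indicator {z. \<bar>z\<bar> > 1} z * exp (\<bar>z\<bar> * (1 + \<delta>))) \<partial>\<nu>) < \<infinity>"
      using expmom by blast
    have "(\<integral>\<^sup>+z. ennreal (exp \<bar>z\<bar>) * indicator {z. 1 < \<bar>z\<bar>} z \<partial>\<nu>) \<le>
       (\<integral>\<^sup>+ z. ennreal (indicator {z. \<bar>z\<bar> > 1} z * exp (\<bar>z\<bar> * (1 + \<delta>))) \<partial>\<nu>)"
    proof (intro nn_integral_mono)
      fix z :: real
      have "\<bar>z\<bar> * 1 \<le> \<bar>z\<bar> * (1 + \<delta>)" using \<delta>(1) by (intro mult_left_mono) auto
      then show "ennreal (exp \<bar>z\<bar>) * indicator {z. 1 < \<bar>z\<bar>} z \<le>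
          ennreal (indicator {z. \<bar>z\<bar> > 1} z * exp (\<bar>z\<bar> * (1 + \<delta>)))"
        by (auto simp: indicator_def intro!: ennreal_leI)
    qed
    then show ?thesis using \<delta>(2) by (rule le_less_trans)
  qed
  have fin': "(\<integral>\<^sup>+z. ennreal (exp \<bar>z\<bar>) * indicator {z. 1 < \<bar>z\<bar>} z \<partial>reflect \<nu>) < \<infinity>"
    unfolding reflect_def using fin by (subst nn_integral_distr) (auto simp: indicator_def)
  have C': "emeasure (reflect \<nu>) {z. x < \<bar>z\<bar>} \<le> ennreal (C * x powr (- \<alpha>))" if "0 < x" "x \<le> 1" for x
    using C(2)[OF that] unfolding reflect_def by (subst emeasure_distr) (auto simp: vimage_def)
  have tailm': "((\<lambda>x. x powr \<alpha>m * measure (reflect \<nu>) {x<..}) \<longlongrightarrow> cm) (at_right 0)"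
  proof -
    have "uminus -` {x<..} = {..<-x}" for x :: real by auto
    then show ?thesis using tailm by (simp add: measure_reflect[OF \<nu>])
  qed
  have rd: "real_distribution (distr M borel (X t))" if "0 < t" for t
    by (rule M.real_distribution_distr[OF X[OF that]])
  have rd': "real_distribution (distr M borel (\<lambda>\<omega>. - X t \<omega>))" if "0 < t" for t
    by (rule M.real_distribution_distr[OF borel_measurable_uminus[OF X[OF that]]])
  have ch': "char (distr M borel (\<lambda>\<omega>. - X t \<omega>)) u = exp (complex_of_real t * levy_exponent (\<sigma>\<^sup>2) (reflect \<nu>) (- \<gamma>) u)"
    if t: "0 < t" for t u
  proof -
    have "char (distr M borel (\<lambda>\<omega>. - X t \<omega>)) u = char (distr M borel (X t)) (- u)"
      unfolding char_def using X[OF t] by (simp add: integral_distr)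
    then show ?thesis using ch[OF t] by (simp add: levy_exponent_reflect[OF \<nu>])
  qed
  have pm [measurable]: "payoff j q \<in> borel_measurable borel" for j q
    unfolding payoff_def by measurable
  have G: "(\<integral>\<omega>. g (\<sigma> * W t \<omega> - \<sigma>\<^sup>2 * t / 2) \<partial>N) = (\<integral>x. g x \<partial>gauss_law (\<sigma> * sqrt t) (- (\<sigma>\<^sup>2 / 2) * t))"
    if t: "0 < t" and [measurable]: "g \<in> borel_measurable borel" for g :: "real \<Rightarrow> real" and t
  proof -
    have "(\<integral>\<omega>. g (\<sigma> * W t \<omega> - \<sigma>\<^sup>2 * t / 2) \<partial>N) = (\<integral>x. g (\<sigma> * (sqrt t * x) - \<sigma>\<^sup>2 * t / 2) \<partial>std_normal_distribution)"
      by (rule brownian_integral[OF BM t]) measurable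
    then show ?thesis unfolding gauss_law_def by (subst integral_distr) (auto simp: mult.assoc)
  qed
  \<comment> \<open>Reflection changes the sign of both scale and drift, but a centred Gaussian
    variable is symmetric, so the scale may keep its sign.\<close>
  have G': "(\<integral>x. g (- x) \<partial>gauss_law s d) = (\<integral>x. g x \<partial>gauss_law s (- d))"
    if [measurable]: "g \<in> borel_measurable borel" for g :: "real \<Rightarrow> real" and s d
  proof -
    have "(\<integral>x. g (- x) \<partial>gauss_law s d) = (\<integral>x. g x \<partial>gauss_law (- s) (- d))"
      unfolding gauss_law_def by (subst (1 2) integral_distr) auto
    then show ?thesis by (simp add: gauss_law_uminus)
  qed
  have pos: "eventually (\<lambda>t::real. 0 < t) (at_right 0)" by (simp add: eventually_at_filter)
  have call: "(\<lambda>t. \<integral>\<omega>. max (exp (X t \<omega>) - exp (k t)) 0 \<partial>M) \<sim>[at_right 0]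
            (\<lambda>t. (\<integral>\<omega>. max (exp (\<sigma> * W t \<omega> - \<sigma>\<^sup>2 * t / 2) - exp (k t)) 0 \<partial>N)
                 + t * k t powr (1 - \<alpha>p) * cp / (\<alpha>p - 1))" if "0 < cp"
  proof -
    interpret P: short_time_levy "\<lambda>t. distr M borel (X t)" \<sigma> \<gamma> \<alpha>p \<alpha> cp C \<beta> \<nu> k
      by (rule short_time_levy.intro; fact sigma_nonneg \<nu> rd ch fin tailp that \<alpha>p \<alpha> C \<beta> k\<beta> kpos' k0 sk)
    have "(\<lambda>t. \<integral>x. payoff 1 (k t) x \<partial>distr M borel (X t)) \<sim>[at_right 0]
      (\<lambda>t. (\<integral>x. payoff 1 (k t) x \<partial>gauss_law (\<sigma> * sqrt t) (- (\<sigma>\<^sup>2 / 2) * t)) + P.B t)"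
      by (rule P.payoff_asymp) auto
    also have "?this \<longleftrightarrow> ?thesis"
    proof (intro asymp_equiv_cong eventually_mono[OF pos])
      fix t :: real assume t: "0 < t"
      show "(\<integral>x. payoff 1 (k t) x \<partial>distr M borel (X t)) = (\<integral>\<omega>. max (exp (X t \<omega>) - exp (k t)) 0 \<partial>M)"
        using X[OF t] by (subst integral_distr) (auto simp: payoff_def)
      show "(\<integral>x. payoff 1 (k t) x \<partial>gauss_law (\<sigma> * sqrt t) (- (\<sigma>\<^sup>2 / 2) * t)) + P.B t =
        (\<integral>\<omega>. max (exp (\<sigma> * W t \<omega> - \<sigma>\<^sup>2 * t / 2) - exp (k t)) 0 \<partial>N) + t * k t powr (1 - \<alpha>p) * cp / (\<alpha>p - 1)"
        unfolding G[OF t pm, symmetric] by (simp add: payoff_def P.B_def)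
    qed
    finally show ?thesis .
  qed
  have put: "(\<lambda>t. \<integral>\<omega>. max (exp (- k t) - exp (X t \<omega>)) 0 \<partial>M) \<sim>[at_right 0]
            (\<lambda>t. (\<integral>\<omega>. max (exp (- k t) - exp (\<sigma> * W t \<omega> - \<sigma>\<^sup>2 * t / 2)) 0 \<partial>N)
                 + t * k t powr (1 - \<alpha>m) * cm / (\<alpha>m - 1))" if "0 < cm"
  proof -
    interpret P: short_time_levy "\<lambda>t. distr M borel (\<lambda>\<omega>. - X t \<omega>)" \<sigma> "- \<gamma>" \<alpha>m \<alpha> cm C \<beta> "reflect \<nu>" k
      by (rule short_time_levy.intro; fact sigma_nonneg levy_measure_reflect[OF \<nu>] rd' ch' fin' tailm' that \<alpha>m \<alpha> C(1) C' \<beta> k\<beta> kpos' k0 sk)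
    have "(\<lambda>t. \<integral>x. payoff (- 1) (k t) x \<partial>distr M borel (\<lambda>\<omega>. - X t \<omega>)) \<sim>[at_right 0]
      (\<lambda>t. (\<integral>x. payoff (- 1) (k t) x \<partial>gauss_law (\<sigma> * sqrt t) (\<sigma>\<^sup>2 / 2 * t)) + P.B t)"
      by (rule P.payoff_asymp) auto
    also have "?this \<longleftrightarrow> ?thesis"
    proof (intro asymp_equiv_cong eventually_mono[OF pos])
      fix t :: real assume t: "0 < t"
      show "(\<integral>x. payoff (- 1) (k t) x \<partial>distr M borel (\<lambda>\<omega>. - X t \<omega>)) = (\<integral>\<omega>. max (exp (- k t) - exp (X t \<omega>)) 0 \<partial>M)"
        using X[OF t] by (subst integral_distr) (auto simp: payoff_def)
      have "(\<integral>x. payoff (- 1) (k t) x \<partial>gauss_law (\<sigma> * sqrt t) (\<sigma>\<^sup>2 / 2 * t)) =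
        (\<integral>x. payoff (- 1) (k t) (- x) \<partial>gauss_law (\<sigma> * sqrt t) (- (\<sigma>\<^sup>2 / 2) * t))"
        by (subst G'[OF pm]) simp
      also have "\<dots> = (\<integral>\<omega>. payoff (- 1) (k t) (- (\<sigma> * W t \<omega> - \<sigma>\<^sup>2 * t / 2)) \<partial>N)"
        by (rule G[OF t, symmetric]) measurable
      also have "\<dots> = (\<integral>\<omega>. max (exp (- k t) - exp (\<sigma> * W t \<omega> - \<sigma>\<^sup>2 * t / 2)) 0 \<partial>N)"
        by (simp add: payoff_def)
      finally show "(\<integral>x. payoff (- 1) (k t) x \<partial>gauss_law (\<sigma> * sqrt t) (\<sigma>\<^sup>2 / 2 * t)) + P.B t =
        (\<integral>\<omega>. max (exp (- k t) - exp (\<sigma> * W t \<omega> - \<sigma>\<^sup>2 * t / 2)) 0 \<partial>N) + t * k t powr (1 - \<alpha>m) * cm / (\<alpha>m - 1)"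
        by (simp add: P.B_def)
    qed
    finally show ?thesis .
  qed
  show ?thesis using call put by blast
qed

end
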